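(* Each space ${\cal BH}(d)$, $d\in\mathbb Z$, is invariant under the $\rho'$ action restricted to $\mathfrak{sl}(2,\mathbb C)\times\mathfrak{sl}(2,\mathbb C)$, and for $l=0,\frac12,1,\frac32,\dots$ we have the following decompositions into irreducible components: $${\cal BH}(2l)=(V_l\boxtimes V_l)\oplus(V_{l-1}\boxtimes V_{l-1}),\qquad {\cal BH}(-2l)=(V_l\boxtimes V_l)\oplus(V_{l-1}\boxtimes V_{l-1}).$$ In particular, $\dim_{\mathbb C}{\cal BH}(0)=1$ and $\dim_{\mathbb C}{\cal BH}(d)=2d^2+2$ for $d\neq 0$. The functions $$\phi^{(1)}_{l,m,n}(Z)=t^l_{n\,\underline{m}}(Z),\quad m,n=-l,-l+1,\dots,l,\qquad \phi^{(2)}_{l,m,n}(Z)=N(Z)\cdot t^{l-1}_{n\,\underline{m}}(Z),\quad m,n=-l+1,-l+2,\dots,l-1,$$ span respectively the $V_l\boxtimes V_l$ and $V_{l-1}\boxtimes V_{l-1}$ components of ${\cal BH}(2l)$, $l=0,\frac12,1,\frac32,\dots$. The functions $$\tilde\phi^{(1)}_{l,m,n}(Z)=t^l_{m\,\underline{n}}(Z^{-1}),\quad m,n=-l,-l+1,\dots,l,\qquad \tilde\phi^{(2)}_{l,m,n}(Z)=N(Z)^{-1}\cdot t^{l-1}_{m\,\underline{n}}(Z^{-1}),\quad m,n=-l+1,\dots,l-1,$$ span respectively the $V_l\boxtimes V_l$ and $V_{l-1}\boxtimes V_{l-1}$ components of ${\cal BH}(-2l)$, $l=0,\frac12,1,\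frac32,\dots$.
   Context: $\mathbb H_{\mathbb C}=\mathbb C\otimes_{\mathbb R}\mathbb H$ is identified with the algebra of $2\times2$ complex matrices $Z=\bigl(\begin{smallmatrix} z_{11}&z_{12}\\ z_{21}&z_{22}\end{smallmatrix}\bigr)=z^0e_0+z^1e_1+z^2e_2+z^3e_3$, with $e_0=1$, $e_1=\bigl(\begin{smallmatrix}0&-i\\-i&0\end{smallmatrix}\bigr)$, $e_2=\bigl(\begin{smallmatrix}0&-1\\1&0\end{smallmatrix}\bigr)$, $e_3=\bigl(\begin{smallmatrix}-i&0\\0&i\end{smallmatrix}\bigr)$. $N(Z)=\det Z$. $\square=\sum_{j=0}^3\partial^2/(\partial z^j)^2$. $\operatorname{Re}(A)=\frac12\operatorname{Tr}A$. Matrix coefficients: for $l=0,\frac12,1,\dots$ and $m,n\in\mathbb Z+l$, $-l\le m,n\le l$, $$t^l_{n\,\underline{m}}(Z)=\frac1{2\pi i}\oint (sz_{11}+z_{21})^{l-m}(sz_{12}+z_{22})^{l+m}s^{-l+n}\,\frac{ds}s,$$ the integral over a counterclockwise loop around $0$. ${\cal BH}=\{f\in\mathbb C[z_{11},z_{12},z_{21},z_{22},N(Z)^{-1}];\ \square\square f=0\}$, and ${\cal BH}(d)$ is its subspace of functions homogeneous of degree $d$. The Lie algebra $\mathfrak{gl}(2,\mathbb H_{\mathbb C})\simeq\mathfrak{gl}(4,\mathbb C)$ acts on ${\cal BH}$ by $\rho'$, obtained by differentiating $(\rho'(h)f)(Z)=f\bigl((aZ+b)(cZ+d)^{-1}\bigr)$,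 $h^{-1}=\bigl(\begin{smallmatrix}a&b\\c&d\end{smallmatrix}\bigr)\in GL(2,\mathbb H_{\mathbb C})$. The subalgebra $\mathfrak{sl}(2,\mathbb C)\times\mathfrak{sl}(2,\mathbb C)$ consists of $\bigl(\begin{smallmatrix}A&0\\0&D\end{smallmatrix}\bigr)$ with $\operatorname{Re}A=\operatorname{Re}D=0$. $V_l$ is the irreducible $\mathfrak{sl}(2,\mathbb C)$-module of dimension $2l+1$ ($2l$-th symmetric power of the tautological module); in $V_p\boxtimes V_q$ the first factor is acted on by $A$, the second by $D$. Convention: $V_j=0$ if $j<0$. *)

theory Defs
  imports
    "HOL-Complex_Analysis.Complex_Analysis"
    "HOL-Library.Function_Algebras"
begin

text \<open>Complex vector spaces of functions, with pointwise operations. Addition and zero are those of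
  \<open>Function_Algebras\<close>.\<close>

definition fscale :: "complex \<Rightarrow> ('a \<Rightarrow> complex) \<Rightarrow> 'a \<Rightarrow> complex"
  where "fscale c f = (\<lambda>x. c * f x)"

interpretation fvs: vector_space "fscale :: complex \<Rightarrow> ('a \<Rightarrow> complex) \<Rightarrow> 'a \<Rightarrow> complex"
  by standard (auto simp: fscale_def fun_eq_iff algebra_simps)

definition direct_sum :: "('a \<Rightarrow> complex) set \<Rightarrow> ('a \<Rightarrow> complex) set \<Rightarrow> ('a \<Rightarrow> complex) set \<Rightarrow> bool"
  where "direct_sum W U1 U2 \<longleftrightarrow> fvs.subspace U1 \<and> fvs.subspace U2 \<and>
    W = {u + v |u v. u \<in> U1 \<and> v \<in> U2} \<and> U1 \<inter> U2 = {0}"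


section \<open>Complexified quaternions\<close>

type_synonym c2 = "complex^2"
type_synonym hc = "complex^2^2"

definition cscale :: "complex \<Rightarrow> complex^'n^'m \<Rightarrow> complex^'n^'m"
  where "cscale c A = (\<chi> i j. c * A $ i $ j)"

text \<open>The quaternionic units; only the indices 0, 1, 2, 3 are used.\<close>

definition qunit :: "nat \<Rightarrow> hc"
  where "qunit j =
    (if j = 0 then vector [vector [1, 0], vector [0, 1]]
     else if j = 1 then vector [vector [0, -\<i>], vector [-\<i>, 0]]
     else if j = 2 then vector [vector [0, -1], vector [1, 0]]
     else vector [vector [-\<i>, 0], vector [0, \<i>]])"

definition normN :: "hc \<Rightarrow> complex"
  where "normN Z = det Z"

definition Re_hc :: "hc \<Rightarrow> complex"
  where "Re_hc A = trace A / 2"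

text \<open>A function on the open set of invertible matrices is represented by its extension by zero.
  This makes these functions a subspace of all functions, and equality of two of them means
  equality on the invertible matrices.\<close>

definition on_inv :: "(hc \<Rightarrow> complex) \<Rightarrow> hc \<Rightarrow> complex"
  where "on_inv f = (\<lambda>Z. if normN Z \<noteq> 0 then f Z else 0)"

definition partial :: "nat \<Rightarrow> (hc \<Rightarrow> complex) \<Rightarrow> hc \<Rightarrow> complex"
  where "partial j f = on_inv (\<lambda>Z. deriv (\<lambda>w. f (Z + cscale w (qunit j))) 0)"

definition box :: "(hc \<Rightarrow> complex) \<Rightarrow> hc \<Rightarrow> complex"
  where "box f = (\<lambda>Z. \<Sum>j\<le>3. partial j (partial j f) Z)"

text \<open>The algebra generated by the four matrix entries and the inverse of the norm. A
  polynomial expression in these is determined by its values on invertible matrices, as they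
  are Zariski dense.\<close>

inductive_set regular_fun :: "(hc \<Rightarrow> complex) set" where
  const: "on_inv (\<lambda>Z. c) \<in> regular_fun"
| entry: "on_inv (\<lambda>Z. Z $ i $ j) \<in> regular_fun"
| norm_inverse: "on_inv (\<lambda>Z. inverse (normN Z)) \<in> regular_fun"
| add: "f \<in> regular_fun \<Longrightarrow> g \<in> regular_fun \<Longrightarrow> (\<lambda>Z. f Z + g Z) \<in> regular_fun"
| mult: "f \<in> regular_fun \<Longrightarrow> g \<in> regular_fun \<Longrightarrow> (\<lambda>Z. f Z * g Z) \<in> regular_fun"

definition biharmonic :: "(hc \<Rightarrow> complex) set"
  where "biharmonic = {f \<in> regular_fun. box (box f) = 0}"

definition BH :: "int \<Rightarrow> (hc \<Rightarrow> complex) set"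
  where "BH d = {f \<in> biharmonic.
    \<forall>c Z. c \<noteq> 0 \<longrightarrow> normN Z \<noteq> 0 \<longrightarrow> f (cscale c Z) = c powi d * f Z}"


section \<open>The action of the Lie algebra\<close>

primrec mat_power :: "complex^'n^'n \<Rightarrow> nat \<Rightarrow> complex^'n^'n" where
  "mat_power A 0 = mat 1"
| "mat_power A (Suc k) = A ** mat_power A k"

definition mat_exp :: "complex^'n^'n \<Rightarrow> complex^'n^'n"
  where "mat_exp A = (\<Sum>k. cscale (1 / fact k) (mat_power A k))"

text \<open>Two by two block matrices over \<^typ>\<open>hc\<close>, as matrices indexed by a disjoint union.\<close>

type_synonym gl2h = "complex^(2+2)^(2+2)"

definition block_diag :: "hc \<Rightarrow> hc \<Rightarrow> gl2h"
  where "block_diag A D = (\<chi> i j. case (i, j) of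
      (Inl i', Inl j') \<Rightarrow> A $ i' $ j'
    | (Inr i', Inr j') \<Rightarrow> D $ i' $ j'
    | _ \<Rightarrow> 0)"

definition rho :: "gl2h \<Rightarrow> (hc \<Rightarrow> complex) \<Rightarrow> hc \<Rightarrow> complex"
  where "rho h f = (\<lambda>Z.
    let g = matrix_inv h;
        a = (\<chi> i j. g $ Inl i $ Inl j); b = (\<chi> i j. g $ Inl i $ Inr j);
        c = (\<chi> i j. g $ Inr i $ Inl j); d = (\<chi> i j. g $ Inr i $ Inr j)
    in f ((a ** Z + b) ** matrix_inv (c ** Z + d)))"

definition drho :: "gl2h \<Rightarrow> (hc \<Rightarrow> complex) \<Rightarrow> hc \<Rightarrow> complex"
  where "drho X f = on_inv (\<lambda>Z. deriv (\<lambda>t. rho (mat_exp (cscale t X)) f Z) 0)"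

definition sl2sl2 :: "(hc \<times> hc) set"
  where "sl2sl2 = {(A, D). Re_hc A = 0 \<and> Re_hc D = 0}"

definition act_BH :: "hc \<times> hc \<Rightarrow> (hc \<Rightarrow> complex) \<Rightarrow> hc \<Rightarrow> complex"
  where "act_BH = (\<lambda>(A, D). drho (block_diag A D))"


section \<open>Modules over the pair algebra\<close>

definition submodule :: "(hc \<times> hc \<Rightarrow> ('a \<Rightarrow> complex) \<Rightarrow> 'a \<Rightarrow> complex) \<Rightarrow> ('a \<Rightarrow> complex) set \<Rightarrow> bool"
  where "submodule act U \<longleftrightarrow> fvs.subspace U \<and> (\<forall>X\<in>sl2sl2. \<forall>f\<in>U. act X f \<in> U)"

definition irreducible_module ::
    "(hc \<times> hc \<Rightarrow> ('a \<Rightarrow> complex) \<Rightarrow> 'a \<Rightarrow> complex) \<Rightarrow> ('a \<Rightarrow> complex) set \<Rightarrow> bool"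
  where "irreducible_module act U \<longleftrightarrow> submodule act U \<and> U \<noteq> {0} \<and>
    (\<forall>W. W \<subseteq> U \<and> submodule act W \<longrightarrow> W = {0} \<or> W = U)"

definition module_iso ::
    "(hc \<times> hc \<Rightarrow> ('a \<Rightarrow> complex) \<Rightarrow> 'a \<Rightarrow> complex) \<Rightarrow> ('a \<Rightarrow> complex) set \<Rightarrow>
     (hc \<times> hc \<Rightarrow> ('b \<Rightarrow> complex) \<Rightarrow> 'b \<Rightarrow> complex) \<Rightarrow> ('b \<Rightarrow> complex) set \<Rightarrow> bool"
  where "module_iso act U act' W \<longleftrightarrow> submodule act U \<and> submodule act' W \<and>
    (\<exists>T. bij_betw T U W \<and>
      (\<forall>f\<in>U. \<forall>g\<in>U. T (f + g) = T f + T g) \<and>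
      (\<forall>c. \<forall>f\<in>U. T (fscale c f) = fscale c (T f)) \<and>
      (\<forall>X\<in>sl2sl2. \<forall>f\<in>U. T (act X f) = act' X (T f)))"

text \<open>The \<open>k\<close>-th symmetric power of the tautological module of column vectors is realized as the
  homogeneous polynomials of degree \<open>k\<close> on the dual space of row vectors: a column vector \<open>w\<close>
  is the linear function \<open>\<xi> \<mapsto> \<xi> w\<close>, so a matrix \<open>g\<close> sends \<open>p\<close> to \<open>\<xi> \<mapsto> p (\<xi> g)\<close>.\<close>

definition sym_power :: "nat \<Rightarrow> (c2 \<Rightarrow> complex) set"
  where "sym_power k = fvs.span {(\<lambda>\<xi>. (\<xi> $ 1) ^ i * (\<xi> $ 2) ^ j) |i j. i + j = k}"

definition Vmod :: "real \<Rightarrow> (c2 \<Rightarrow> complex) set"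
  where "Vmod l = (if l < 0 then {0} else sym_power (nat \<lfloor>2 * l\<rfloor>))"

definition ext_tensor ::
    "(c2 \<Rightarrow> complex) set \<Rightarrow> (c2 \<Rightarrow> complex) set \<Rightarrow> (c2 \<times> c2 \<Rightarrow> complex) set"
    (infixl \<open>\<boxtimes>\<close> 70)
  where "U \<boxtimes> W = fvs.span {(\<lambda>(\<xi>, \<eta>). p \<xi> * q \<eta>) |p q. p \<in> U \<and> q \<in> W}"

definition act_tensor ::
    "hc \<times> hc \<Rightarrow> (c2 \<times> c2 \<Rightarrow> complex) \<Rightarrow> c2 \<times> c2 \<Rightarrow> complex"
  where "act_tensor = (\<lambda>(A, D) P (\<xi>, \<eta>).
    deriv (\<lambda>t. P (\<xi> v* mat_exp (cscale t A), \<eta> v* mat_exp (cscale t D))) 0)"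

text \<open>\<open>U1\<close> and \<open>U2\<close> are the two components of \<open>W\<close>; the second one is zero, hence not
  irreducible, exactly for \<open>l = 0\<close> and \<open>l = 1/2\<close>.\<close>

definition decomposition ::
    "real \<Rightarrow> (hc \<Rightarrow> complex) set \<Rightarrow> (hc \<Rightarrow> complex) set \<Rightarrow> (hc \<Rightarrow> complex) set \<Rightarrow> bool"
  where "decomposition l W U1 U2 \<longleftrightarrow>
    direct_sum W U1 U2 \<and>
    module_iso act_BH U1 act_tensor (Vmod l \<boxtimes> Vmod l) \<and>
    module_iso act_BH U2 act_tensor (Vmod (l - 1) \<boxtimes> Vmod (l - 1)) \<and>
    irreducible_module act_BH U1 \<and>
    (l \<ge> 1 \<longrightarrow> irreducible_module act_BH U2)"


section \<open>Matrix coefficients\<close>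

text \<open>The values \<open>-l, -l + 1, \<dots>, l\<close>; this is empty for negative \<open>l\<close>.\<close>

definition weights :: "real \<Rightarrow> real set"
  where "weights l = {m. m - l \<in> \<int> \<and> - l \<le> m \<and> m \<le> l}"

text \<open>\<open>tcoef l n m\<close> has the underlined index last. For \<open>m\<close> and \<open>n\<close> in \<^term>\<open>weights l\<close>, where
  \<open>2 * l\<close> is an integer, the exponents below are integers, the first two nonnegative, and
  the floors have no effect.\<close>

definition tcoef :: "real \<Rightarrow> real \<Rightarrow> real \<Rightarrow> hc \<Rightarrow> complex"
  where "tcoef l n m Z = 1 / (2 * of_real pi * \<i>) *
    contour_integral (circlepath 0 1) (\<lambda>s.
      (s * Z $ 1 $ 1 + Z $ 2 $ 1) ^ nat \<lfloor>l - m\<rfloor> *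
      (s * Z $ 1 $ 2 + Z $ 2 $ 2) ^ nat \<lfloor>l + m\<rfloor> *
      s powi \<lfloor>- l + n\<rfloor> / s)"

definition phi1 :: "real \<Rightarrow> real \<Rightarrow> real \<Rightarrow> hc \<Rightarrow> complex"
  where "phi1 l m n = on_inv (\<lambda>Z. tcoef l n m Z)"

definition phi2 :: "real \<Rightarrow> real \<Rightarrow> real \<Rightarrow> hc \<Rightarrow> complex"
  where "phi2 l m n = on_inv (\<lambda>Z. normN Z * tcoef (l - 1) n m Z)"

definition phi1' :: "real \<Rightarrow> real \<Rightarrow> real \<Rightarrow> hc \<Rightarrow> complex"
  where "phi1' l m n = on_inv (\<lambda>Z. tcoef l m n (matrix_inv Z))"

definition phi2' :: "real \<Rightarrow> real \<Rightarrow> real \<Rightarrow> hc \<Rightarrow> complex"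
  where "phi2' l m n = on_inv (\<lambda>Z. inverse (normN Z) * tcoef (l - 1) m n (matrix_inv Z))"

end

theory Submission
  imports Defs
begin

text \<open>Write \<open>t\<close> for the matrix coefficients of degree \<open>p = 2l\<close>: the coefficients of \<open>s\<^sup>b\<close> in
  \<open>(s z\<^sub>1\<^sub>1 + z\<^sub>2\<^sub>1)\<^sup>a (s z\<^sub>1\<^sub>2 + z\<^sub>2\<^sub>2)\<^sup>c\<close> with \<open>a + c = p\<close>. The theorem holds because the functions \<open>N\<^sup>k t\<close>, for all
  integers \<open>k\<close> and all \<open>p\<close>, form a basis of the algebra of regular functions in which every condition
  and every operator of the statement is explicit.

  They span (\<open>regular_fun_subset_span\<close>) because their span is closed under multiplication by the entries
  of \<open>Z\<close>, by a rule of Clebsch-Gordan type (\<open>gen_poly_entry_mult\<close>). They are independent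
  (\<open>basis_at_independent\<close>) because the terms with the lowest power of \<open>N\<close> can be isolated on the cone
  \<open>N = 0\<close>, where the matrix coefficients restrict to nonzero multiples of distinct monomials.

  The matrix coefficients are harmonic and homogeneous, so \<open>box (N\<^sup>k t) = 4 k (k + p + 1) N\<^sup>k\<^sup>-\<^sup>1 t\<close>
  (\<open>box_basis_fun\<close>). Hence \<open>BH d\<close> has as a basis the \<open>N\<^sup>k t\<close> with \<open>p + 2 k = d\<close> and
  \<open>k (k - 1) (k + p) (k + p + 1) = 0\<close> (\<open>BH_eq_span\<close>). For \<open>d = 2l \<ge> 0\<close> this leaves \<open>(k, p) = (0, d)\<close> and
  \<open>(1, d - 2)\<close>; for \<open>d = -2l \<le> 0\<close> it leaves \<open>(-2l, 2l)\<close> and \<open>(1 - 2l, 2l - 2)\<close>. Counting the pairs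
  \<open>(a, b)\<close> gives the dimensions.

  The pair \<open>exp (tA), exp (tD)\<close> sends \<open>f\<close> to \<open>f (exp (-tA) Z exp (tD))\<close>. For traceless \<open>A\<close> and
  \<open>D\<close> it fixes \<open>N\<close>, and after rescaling by signs and binomial coefficients the \<open>t\<close> of degree \<open>p\<close>
  transform like the monomials of bidegree \<open>(p, p)\<close> in two rows of length two
  (\<open>act_BH_weight_vector\<close>). The reason is that restricting \<open>t\<close> to matrices of rank one, a column times
  a row, is an equivariant map to such polynomials. Modules of this shape are irreducible by raising
  and lowering operators and determined up to isomorphism (locale \<open>weight_module\<close>), and the tensor
  products \<open>V\<^sub>l \<boxtimes> V\<^sub>l\<close> are of the same shape (\<open>weight_module_tensor\<close>).

  Finally the functions of the statement are identified with basis functions. Cauchy's formula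
  evaluates the contour integrals (\<open>tcoef_eq_mcoef\<close>), and the matrix coefficients of \<open>Z\<^sup>-\<^sup>1 = adj Z / N\<close>
  are, up to nonzero factors, \<open>N\<^sup>-\<^sup>p\<close> times those of \<open>Z\<close> (\<open>mcoef_adj\<close>).\<close>

(* The dollar sign is reserved for vector and matrix components. *)
no_notation fps_nth (infixl "$" 75)


section \<open>Gradients along curves\<close>

definition curve_deriv :: "(complex \<Rightarrow> hc) \<Rightarrow> hc \<Rightarrow> complex \<Rightarrow> bool"
  where "curve_deriv \<gamma> V t \<longleftrightarrow>
    (\<forall>i j. ((\<lambda>t. \<gamma> t $ i $ j) has_field_derivative V $ i $ j) (at t))"

definition pairing :: "hc \<Rightarrow> (2 \<Rightarrow> 2 \<Rightarrow> complex) \<Rightarrow> complex"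
  where "pairing V g = (\<Sum>i\<in>UNIV. \<Sum>j\<in>UNIV. V $ i $ j * g i j)"

text \<open>The functions are only examined through curves of matrices: straight lines give the operators
  \<open>partial\<close>, while the curves \<open>exp (-tA) Z exp (tD)\<close> give the Lie algebra action. One gradient
  computed by the Leibniz rule then serves both purposes. Singular points of a curve are ignored
  because regular functions live on the invertible matrices.\<close>

definition has_grad :: "(hc \<Rightarrow> complex) \<Rightarrow> (2 \<Rightarrow> 2 \<Rightarrow> hc \<Rightarrow> complex) \<Rightarrow> bool"
  where "has_grad f G \<longleftrightarrow> (\<forall>\<gamma> V t. curve_deriv \<gamma> V t \<longrightarrow> normN (\<gamma> t) \<noteq> 0 \<longrightarrow>
    ((\<lambda>t. f (\<gamma> t)) has_field_derivative pairing V (\<lambda>i j. G i j (\<gamma> t))) (at t))"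

lemma pairing_2:
  "pairing V g = V $ 1 $ 1 * g 1 1 + V $ 1 $ 2 * g 1 2 + V $ 2 $ 1 * g 2 1 + V $ 2 $ 2 * g 2 2"
  by (simp add: pairing_def sum_2)

lemma normN_2: "normN Z = Z $ 1 $ 1 * Z $ 2 $ 2 - Z $ 1 $ 2 * Z $ 2 $ 1"
  by (simp add: normN_def det_2)

text \<open>This is the partial derivative of the determinant with respect to the entry in position
  \<open>(i, j)\<close>; see \<open>has_grad_normN\<close>.\<close>

definition cofactor :: "2 \<Rightarrow> 2 \<Rightarrow> hc \<Rightarrow> complex"
  where "cofactor i j Z = (if i = 1 then if j = 1 then Z $ 2 $ 2 else - (Z $ 2 $ 1)
    else if j = 1 then - (Z $ 1 $ 2) else Z $ 1 $ 1)"

lemma has_grad_const: "has_grad (\<lambda>Z. c) (\<lambda>i j Z. 0)"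
  by (simp add: has_grad_def pairing_def)

lemma has_grad_entry: "has_grad (\<lambda>Z. Z $ i $ j) (\<lambda>a b Z. if a = i \<and> b = j then 1 else 0)"
  using exhaust_2[of i] exhaust_2[of j]
  by (auto simp: has_grad_def pairing_2 curve_deriv_def)

lemma has_gradD:
  assumes "has_grad f G" "curve_deriv \<gamma> V t" "normN (\<gamma> t) \<noteq> 0"
  shows "((\<lambda>t. f (\<gamma> t)) has_field_derivative pairing V (\<lambda>i j. G i j (\<gamma> t))) (at t)"
  using assms by (simp add: has_grad_def)

lemma has_grad_add:
  assumes "has_grad f F" "has_grad g G"
  shows "has_grad (\<lambda>Z. f Z + g Z) (\<lambda>i j Z. F i j Z + G i j Z)"
  unfolding has_grad_def
proof safe
  fix \<gamma> V t assume c: "curve_deriv \<gamma> V t" "normN (\<gamma> t) \<noteq> 0"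
  show "((\<lambda>t. f (\<gamma> t) + g (\<gamma> t)) has_field_derivative
      pairing V (\<lambda>i j. F i j (\<gamma> t) + G i j (\<gamma> t))) (at t)"
    by (rule DERIV_cong[OF DERIV_add[OF has_gradD[OF assms(1) c] has_gradD[OF assms(2) c]]])
      (simp add: pairing_2 algebra_simps)
qed

lemma has_grad_mult:
  assumes "has_grad f F" "has_grad g G"
  shows "has_grad (\<lambda>Z. f Z * g Z) (\<lambda>i j Z. F i j Z * g Z + f Z * G i j Z)"
  unfolding has_grad_def
proof safe
  fix \<gamma> V t assume c: "curve_deriv \<gamma> V t" "normN (\<gamma> t) \<noteq> 0"
  show "((\<lambda>t. f (\<gamma> t) * g (\<gamma> t)) has_field_derivative
      pairing V (\<lambda>i j. F i j (\<gamma> t) * g (\<gamma> t) + f (\<gamma> t) * G i j (\<gamma> t))) (at t)"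
    by (rule DERIV_cong[OF DERIV_mult[OF has_gradD[OF assms(1) c] has_gradD[OF assms(2) c]]])
      (simp add: pairing_2 algebra_simps)
qed

lemma has_grad_scale:
  assumes "has_grad f F"
  shows "has_grad (\<lambda>Z. c * f Z) (\<lambda>i j Z. c * F i j Z)"
  using has_grad_mult[OF has_grad_const[of c] assms] by simp

lemma has_grad_sum:
  assumes "finite I" "\<And>i. i \<in> I \<Longrightarrow> has_grad (f i) (G i)"
  shows "has_grad (\<lambda>Z. \<Sum>i\<in>I. f i Z) (\<lambda>a b Z. \<Sum>i\<in>I. G i a b Z)"
  using assms by (induction I) (auto intro: has_grad_const has_grad_add)

lemma has_grad_normN: "has_grad normN cofactor"
  unfolding has_grad_def normN_2 curve_deriv_def
  by (auto intro!: derivative_eq_intros simp: pairing_2 cofactor_def algebra_simps)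

lemma has_grad_normN_powi:
  "has_grad (\<lambda>Z. normN Z powi k) (\<lambda>i j Z. of_int k * normN Z powi (k - 1) * cofactor i j Z)"
  unfolding has_grad_def
proof safe
  fix \<gamma> V t assume c: "curve_deriv \<gamma> V t" "normN (\<gamma> t) \<noteq> 0"
  show "((\<lambda>t. normN (\<gamma> t) powi k) has_field_derivative
      pairing V (\<lambda>i j. of_int k * normN (\<gamma> t) powi (k - 1) * cofactor i j (\<gamma> t))) (at t)"
    by (rule DERIV_cong[OF DERIV_power_int[OF has_gradD[OF has_grad_normN c] disjI2[OF c(2)]]])
      (simp add: pairing_2 algebra_simps)
qed

lemma curve_deriv_eventually_invertible:
  assumes "curve_deriv \<gamma> V t" "normN (\<gamma> t) \<noteq> 0"
  shows "eventually (\<lambda>s. normN (\<gamma> s) \<noteq> 0) (nhds t)"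
proof -
  have "((\<lambda>t. normN (\<gamma> t)) has_field_derivative pairing V (\<lambda>i j. cofactor i j (\<gamma> t))) (at t)"
    using has_grad_normN assms by (auto simp: has_grad_def)
  then have "isCont (\<lambda>t. normN (\<gamma> t)) t" by (rule DERIV_isCont)
  then have "((\<lambda>t. normN (\<gamma> t)) \<longlongrightarrow> normN (\<gamma> t)) (nhds t)"
    using tendsto_at_iff_tendsto_nhds[of "\<lambda>t. normN (\<gamma> t)" t] by (simp add: isCont_def)
  then show ?thesis using assms(2) by (rule tendsto_imp_eventually_ne)
qed

text \<open>A differentiable curve through an invertible matrix stays invertible for a short time, so values
  at singular matrices do not influence a gradient.\<close>

lemma has_grad_cong:
  assumes "has_grad f F" "\<And>Z. normN Z \<noteq> 0 \<Longrightarrow> f Z = g Z"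
    "\<And>i j Z. normN Z \<noteq> 0 \<Longrightarrow> F i j Z = G i j Z"
  shows "has_grad g G"
  unfolding has_grad_def
proof safe
  fix \<gamma> V t assume c: "curve_deriv \<gamma> V t" "normN (\<gamma> t) \<noteq> 0"
  have "((\<lambda>t. f (\<gamma> t)) has_field_derivative pairing V (\<lambda>i j. F i j (\<gamma> t))) (at t)"
    using assms(1) c by (auto simp: has_grad_def)
  moreover have "eventually (\<lambda>s. f (\<gamma> s) = g (\<gamma> s)) (nhds t)"
    using curve_deriv_eventually_invertible[OF c] by eventually_elim (rule assms(2))
  ultimately show "((\<lambda>t. g (\<gamma> t)) has_field_derivative pairing V (\<lambda>i j. G i j (\<gamma> t))) (at t)"
    using DERIV_cong_ev[OF refl, of "\<lambda>s. f (\<gamma> s)" "\<lambda>s. g (\<gamma> s)" t] assms(3) c(2) by simp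
qed

lemma has_grad_on_inv: "has_grad f F \<Longrightarrow> has_grad (on_inv f) F"
  by (erule has_grad_cong) (auto simp: on_inv_def)

lemma curve_deriv_line: "curve_deriv (\<lambda>w. Z + cscale w Q) Q 0"
  unfolding curve_deriv_def cscale_def by (auto intro!: derivative_eq_intros)


section \<open>The operator \<open>box\<close> on regular functions\<close>

lemma partial_eq:
  assumes "has_grad f G"
  shows "partial j f = on_inv (\<lambda>Z. pairing (qunit j) (\<lambda>a b. G a b Z))"
proof -
  have "deriv (\<lambda>w. f (Z + cscale w (qunit j))) 0 = pairing (qunit j) (\<lambda>a b. G a b Z)"
    if "normN Z \<noteq> 0" for Z
  proof (rule DERIV_imp_deriv)
    have [simp]: "Z + cscale 0 Q = Z" for Q by (simp add: vec_eq_iff cscale_def)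
    show "((\<lambda>w. f (Z + cscale w (qunit j))) has_field_derivative
        pairing (qunit j) (\<lambda>a b. G a b Z)) (at 0)"
      using assms curve_deriv_line[of Z "qunit j"] that unfolding has_grad_def by fastforce
  qed
  then show ?thesis by (auto simp: partial_def on_inv_def fun_eq_iff)
qed

lemma has_grad_pairing:
  assumes "\<And>a b. has_grad (G a b) (H a b)"
  shows "has_grad (\<lambda>Z. pairing Q (\<lambda>a b. G a b Z)) (\<lambda>c d Z. pairing Q (\<lambda>a b. H a b c d Z))"
  unfolding pairing_2
  by (intro has_grad_add has_grad_scale assms)

text \<open>The element \<open>\<Sum>\<^sub>j e\<^sub>j \<otimes> e\<^sub>j\<close> is dual to the quadratic form \<open>N = z\<^sub>1\<^sub>1 z\<^sub>2\<^sub>2 - z\<^sub>1\<^sub>2 z\<^sub>2\<^sub>1\<close>. In the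
  coordinates given by the matrix entries the operator is therefore
  \<open>4 (\<partial>\<^sub>1\<^sub>1 \<partial>\<^sub>2\<^sub>2 - \<partial>\<^sub>1\<^sub>2 \<partial>\<^sub>2\<^sub>1)\<close>; it is written here in symmetrized form, which makes it independent of
  the order of differentiation.\<close>

lemma box_eq:
  assumes "has_grad f G" "\<And>a b. has_grad (G a b) (H a b)"
  shows "box f = on_inv (\<lambda>Z. 2 * (H 1 1 2 2 Z + H 2 2 1 1 Z - H 1 2 2 1 Z - H 2 1 1 2 Z))"
proof -
  have "partial j (partial j f) =
      on_inv (\<lambda>Z. pairing (qunit j) (\<lambda>c d. pairing (qunit j) (\<lambda>a b. H a b c d Z)))" for j
    unfolding partial_eq[OF assms(1)]
    by (rule partial_eq, rule has_grad_on_inv, rule has_grad_pairing, rule assms)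
  then show ?thesis
    by (simp add: box_def fun_eq_iff on_inv_def pairing_2 qunit_def numeral_3_eq_3
        vector_2 algebra_simps)
qed

lemma on_inv_add: "(\<lambda>Z. on_inv f Z + on_inv g Z) = on_inv (\<lambda>Z. f Z + g Z)"
  by (auto simp: on_inv_def)

lemma on_inv_mult: "(\<lambda>Z. on_inv f Z * on_inv g Z) = on_inv (\<lambda>Z. f Z * g Z)"
  by (auto simp: on_inv_def)

lemma regular_vanishes: "f \<in> regular_fun \<Longrightarrow> normN Z = 0 \<Longrightarrow> f Z = 0"
  by (induction rule: regular_fun.induct) (auto simp: on_inv_def)

lemma regular_zero: "(\<lambda>Z. 0) \<in> regular_fun"
  using regular_fun.const[of 0] by (simp add: on_inv_def)

lemma regular_scale:
  assumes "f \<in> regular_fun"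
  shows "(\<lambda>Z. c * f Z) \<in> regular_fun"
proof -
  have "(\<lambda>Z. on_inv (\<lambda>Z. c) Z * f Z) = (\<lambda>Z. c * f Z)"
    using regular_vanishes[OF assms] by (auto simp: on_inv_def fun_eq_iff)
  then show ?thesis using regular_fun.mult[OF regular_fun.const[of c] assms] by simp
qed

text \<open>By the Leibniz rule the algebra generated by the entries and \<open>N\<^sup>-\<^sup>1\<close> is closed under partial
  derivatives. In particular its elements have gradients of every order, which is what makes
  \<open>box\<close> linear on it.\<close>

lemma regular_grad:
  assumes "f \<in> regular_fun"
  shows "\<exists>G. has_grad f G \<and> (\<forall>a b. G a b \<in> regular_fun)"
  using assms
proof induction
  case (const c)
  show ?case
    by (rule exI[of _ "\<lambda>i j. on_inv (\<lambda>Z. 0)"])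
      (auto intro: regular_zero has_grad_cong[OF has_grad_const[of c]] simp: on_inv_def)
next
  case (entry i j)
  show ?case
    by (rule exI[of _ "\<lambda>a b. on_inv (\<lambda>Z. if a = i \<and> b = j then 1 else 0)"],
        intro conjI allI regular_fun.const)
      (rule has_grad_cong[OF has_grad_entry[of i j]], auto simp: on_inv_def)
next
  case norm_inverse
  let ?I = "on_inv (\<lambda>Z. inverse (normN Z))"
  have c: "on_inv (cofactor a b) \<in> regular_fun" for a b
  proof -
    have m: "on_inv (\<lambda>Z. - (Z $ i $ j)) \<in> regular_fun" for i j
      using regular_scale[OF regular_fun.entry[of i j], of "-1"]
      by (simp add: on_inv_def if_distrib cong: if_cong)
    have "on_inv (cofactor a b) \<in> {on_inv (\<lambda>Z. Z $ 2 $ 2), on_inv (\<lambda>Z. - (Z $ 2 $ 1)),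
       on_inv (\<lambda>Z. - (Z $ 1 $ 2)), on_inv (\<lambda>Z. Z $ 1 $ 1)}"
      by (cases "a = 1"; cases "b = 1") (simp_all add: cofactor_def[abs_def])
    then show ?thesis using m regular_fun.entry by auto
  qed
  show ?case
    by (rule exI[of _ "\<lambda>a b Z. (-1) * (?I Z * (?I Z * on_inv (cofactor a b) Z))"],
        intro conjI allI regular_scale regular_fun.mult c regular_fun.norm_inverse)
      (rule has_grad_cong[OF has_grad_normN_powi[of "-1"]],
        auto simp: on_inv_def power_int_def power2_eq_square field_simps)
next
  case (add f g)
  then obtain F G where "has_grad f F" "has_grad g G" "\<forall>a b. F a b \<in> regular_fun"
    "\<forall>a b. G a b \<in> regular_fun" by blast
  with has_grad_add[of f F g G] show ?case by (blast intro: regular_fun.add)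
next
  case (mult f g)
  then obtain F G where "has_grad f F" "has_grad g G" "\<forall>a b. F a b \<in> regular_fun"
    "\<forall>a b. G a b \<in> regular_fun" by blast
  with mult.hyps show ?case
    by (intro exI[of _ "\<lambda>a b Z. F a b Z * g Z + f Z * G a b Z"] conjI allI has_grad_mult
        regular_fun.add regular_fun.mult) auto
qed

lemma regular_subspace: "fvs.subspace regular_fun"
  using regular_zero regular_fun.add regular_scale
  by (auto simp: fvs.subspace_def fscale_def on_inv_def plus_fun_def zero_fun_def)

lemma regular_hessian:
  assumes "f \<in> regular_fun"
  obtains G H where "has_grad f G" "\<forall>a b. has_grad (G a b) (H a b)"
proof -
  obtain G where G: "has_grad f G" "\<And>a b. G a b \<in> regular_fun"
    using regular_grad[OF assms] by blast
  have "\<forall>a b. \<exists>K. has_grad (G a b) K" using regular_grad[OF G(2)] by blast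
  then obtain H where "\<forall>a b. has_grad (G a b) (H a b)" by metis
  with G(1) show ?thesis by (rule that)
qed

lemma box_add:
  assumes "f \<in> regular_fun" "g \<in> regular_fun"
  shows "box (f + g) = box f + box g"
proof -
  obtain F F' where 1: "has_grad f F" "\<forall>a b. has_grad (F a b) (F' a b)"
    by (rule regular_hessian[OF assms(1)])
  obtain G G' where 2: "has_grad g G" "\<forall>a b. has_grad (G a b) (G' a b)"
    by (rule regular_hessian[OF assms(2)])
  show ?thesis
    unfolding box_eq[OF 1(1) 1(2)[rule_format]] box_eq[OF 2(1) 2(2)[rule_format]] plus_fun_def
      box_eq[OF has_grad_add[OF 1(1) 2(1)] has_grad_add[OF 1(2)[rule_format] 2(2)[rule_format]]]
    by (auto simp: on_inv_def fun_eq_iff algebra_simps)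
qed

lemma box_scale:
  assumes "f \<in> regular_fun"
  shows "box (fscale c f) = fscale c (box f)"
proof -
  obtain F F' where 1: "has_grad f F" "\<forall>a b. has_grad (F a b) (F' a b)"
    by (rule regular_hessian[OF assms])
  show ?thesis
    unfolding box_eq[OF 1(1) 1(2)[rule_format]] fscale_def
      box_eq[OF has_grad_scale[OF 1(1)] has_grad_scale[OF 1(2)[rule_format]]]
    by (auto simp: on_inv_def fun_eq_iff algebra_simps)
qed


section \<open>The matrix exponential and the infinitesimal action\<close>

lemma matrix_inv_unique:
  fixes A B :: "complex^'n^'n"
  assumes "A ** B = mat 1" "B ** A = mat 1"
  shows "matrix_inv A = B"
proof -
  have "A ** matrix_inv A = mat 1 \<and> matrix_inv A ** A = mat 1"
    unfolding matrix_inv_def by (rule someI[of _ B]) (use assms in simp)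
  then have "matrix_inv A = (B ** A) ** matrix_inv A" "B ** (A ** matrix_inv A) = B"
    using assms by (simp_all add: matrix_mul_lid matrix_mul_rid)
  then show ?thesis by (simp add: matrix_mul_assoc)
qed

definition adj :: "hc \<Rightarrow> hc"
  where "adj Z = (\<chi> i j. cofactor j i Z)"

lemma adj_entries:
  "adj Z $ 1 $ 1 = Z $ 2 $ 2" "adj Z $ 1 $ 2 = - (Z $ 1 $ 2)"
  "adj Z $ 2 $ 1 = - (Z $ 2 $ 1)" "adj Z $ 2 $ 2 = Z $ 1 $ 1"
  by (simp_all add: adj_def cofactor_def)

lemma adj_mult:
  "Z ** adj Z = cscale (normN Z) (mat 1)" "adj Z ** Z = cscale (normN Z) (mat 1)"
  by (simp_all add: vec_eq_iff forall_2 matrix_matrix_mult_def sum_2 cscale_def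
      adj_entries mat_def normN_2 mult.commute)

lemma cscale_mult:
  "cscale c A ** B = cscale c (A ** B)" "A ** cscale c B = cscale c (A ** B)"
  by (simp_all add: vec_eq_iff matrix_matrix_mult_def cscale_def sum_distrib_left mult_ac)

lemma matrix_inv_hc:
  assumes "normN Z \<noteq> 0"
  shows "matrix_inv Z = cscale (inverse (normN Z)) (adj Z)"
  by (rule matrix_inv_unique)
    (use assms in \<open>simp_all add: cscale_mult adj_mult\<close>, simp_all add: cscale_def vec_eq_iff)

lemma normN_mat_1: "normN (mat 1) = 1"
  by (simp add: normN_2 mat_def)

lemma matrix_inv_hc_cancel:
  fixes Z :: hc
  assumes "normN Z \<noteq> 0"
  shows "Z ** matrix_inv Z = mat 1" "matrix_inv Z ** Z = mat 1"
  unfolding matrix_inv_hc[OF assms] cscale_mult adj_mult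
  using assms by (simp_all add: cscale_def vec_eq_iff)

lemma curve_deriv_mult:
  assumes "curve_deriv \<gamma> V t" "curve_deriv \<delta> W t"
  shows "curve_deriv (\<lambda>t. \<gamma> t ** \<delta> t) (V ** \<delta> t + \<gamma> t ** W) t"
  using assms unfolding curve_deriv_def
  by (auto simp: matrix_matrix_mult_def sum_2 intro!: derivative_eq_intros)

text \<open>For two by two matrices \<open>Z\<^sup>-\<^sup>1 = adj Z / N Z\<close>, where \<open>adj\<close> is linear and the derivative of \<open>N\<close> at the
  identity is the trace. So the derivative is \<open>adj V - tr V\<close>, which equals \<open>- V\<close>.\<close>

lemma curve_deriv_matrix_inv:
  assumes "curve_deriv \<gamma> V 0" "\<gamma> 0 = mat 1"
  shows "curve_deriv (\<lambda>t. matrix_inv (\<gamma> t)) (- V) 0"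
proof -
  have n: "normN (\<gamma> 0) \<noteq> 0" using assms by (simp add: normN_mat_1)
  have N: "((\<lambda>t. normN (\<gamma> t)) has_field_derivative V $ 1 $ 1 + V $ 2 $ 2) (at 0)"
    using has_gradD[OF has_grad_normN assms(1) n] assms(2)
    by (simp add: pairing_2 cofactor_def mat_def)
  have "((\<lambda>t. adj (\<gamma> t) $ i $ j) has_field_derivative adj V $ i $ j) (at 0)" for i j
    using exhaust_2[of i] exhaust_2[of j] assms(1) unfolding curve_deriv_def
    by (auto simp: adj_entries intro!: DERIV_minus)
  note D = DERIV_mult[OF DERIV_inverse'[OF N n] this]
  have d: "((\<lambda>t. inverse (normN (\<gamma> t)) * adj (\<gamma> t) $ i $ j) has_field_derivative - V $ i $ j) (at 0)"
    for i j
    using exhaust_2[of i] exhaust_2[of j]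
    by (intro DERIV_cong[OF D])
      (auto simp: assms(2) normN_mat_1 adj_entries, simp_all add: mat_def)
  have "((\<lambda>t. matrix_inv (\<gamma> t) $ i $ j) has_field_derivative - V $ i $ j) (at 0)" for i j
  proof -
    have ev: "eventually (\<lambda>t. matrix_inv (\<gamma> t) $ i $ j = inverse (normN (\<gamma> t)) * adj (\<gamma> t) $ i $ j)
        (nhds 0)"
      using curve_deriv_eventually_invertible[OF assms(1) n]
      by eventually_elim (simp add: matrix_inv_hc cscale_def)
    show ?thesis
      by (rule DERIV_cong_ev[OF refl ev refl, THEN iffD2]) (rule d)
  qed
  then show ?thesis by (simp add: curve_deriv_def)
qed

lemma mat_power_cscale: "mat_power (cscale t A) k = cscale (t ^ k) (mat_power A k)"
  by (induction k)
    (simp_all add: cscale_def vec_eq_iff matrix_matrix_mult_def sum_distrib_left mult_ac)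

text \<open>The sum of the absolute values of all entries is a submultiplicative size; the bound turns the
  exponential series into an entrywise absolutely convergent power series in the time parameter.\<close>

lemma mat_power_entry_bound:
  "norm (mat_power A k $ i $ j) \<le> (\<Sum>i\<in>UNIV. \<Sum>j\<in>UNIV. norm (A $ i $ j)) ^ k"
proof (induction k arbitrary: i)
  case 0
  then show ?case by (simp add: mat_def)
next
  case (Suc k)
  let ?M = "\<Sum>i\<in>UNIV. \<Sum>j\<in>UNIV. norm (A $ i $ j)"
  have "norm (mat_power A (Suc k) $ i $ j) \<le> (\<Sum>l\<in>UNIV. norm (A $ i $ l * mat_power A k $ l $ j))"
    by (simp add: matrix_matrix_mult_def norm_sum)
  also have "\<dots> \<le> (\<Sum>l\<in>UNIV. norm (A $ i $ l) * ?M ^ k)"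
    by (intro sum_mono) (auto simp: norm_mult intro!: mult_left_mono Suc.IH)
  also have "\<dots> = (\<Sum>l\<in>UNIV. norm (A $ i $ l)) * ?M ^ k"
    by (simp add: sum_distrib_right)
  also have "\<dots> \<le> ?M * ?M ^ k"
    by (intro mult_right_mono zero_le_power sum_nonneg
        member_le_sum[of i UNIV "\<lambda>i. \<Sum>j\<in>UNIV. norm (A $ i $ j)"]) auto
  finally show ?case by simp
qed

lemma mat_exp_entry_summable:
  "summable (\<lambda>k. (mat_power A k $ i $ j / fact k) * t ^ k)"
proof (rule summable_comparison_test)
  let ?M = "\<Sum>i\<in>UNIV. \<Sum>j\<in>UNIV. norm (A $ i $ j)"
  show "summable (\<lambda>k. (?M * norm t) ^ k / fact k)"
    using summable_exp_generic[of "?M * norm t"] by (simp add: divide_inverse mult.commute)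
  show "\<exists>N. \<forall>k\<ge>N. norm ((mat_power A k $ i $ j / fact k) * t ^ k) \<le> (?M * norm t) ^ k / fact k"
    by (auto simp: norm_mult norm_divide norm_power power_mult_distrib
        intro!: divide_right_mono mult_right_mono mat_power_entry_bound)
qed

lemma mat_exp_entry:
  "mat_exp (cscale t A) $ i $ j = (\<Sum>k. (mat_power A k $ i $ j / fact k) * t ^ k)"
proof -
  let ?S = "\<chi> i j. (\<Sum>k. (mat_power A k $ i $ j / fact k) * t ^ k)"
  have "(\<lambda>k. cscale (1 / fact k) (mat_power (cscale t A) k)) sums ?S"
    unfolding sums_def
  proof (intro vec_tendstoI)
    fix i j
    show "(\<lambda>n. (\<Sum>k<n. cscale (1 / fact k) (mat_power (cscale t A) k)) $ i $ j) \<longlonglongrightarrow> ?S $ i $ j"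
      using summable_LIMSEQ[OF mat_exp_entry_summable[of A i j t]]
      unfolding mat_power_cscale by (simp add: cscale_def mult_ac)
  qed
  then show ?thesis by (simp add: mat_exp_def sums_iff)
qed

lemma mat_exp_0: "mat_exp (cscale 0 A) = mat 1"
  by (simp add: vec_eq_iff mat_exp_entry del: times_divide_eq_left)

lemma curve_deriv_mat_exp:
  "((\<lambda>t. mat_exp (cscale t A) $ i $ j) has_field_derivative A $ i $ j) (at 0)"
proof -
  let ?c = "\<lambda>k. mat_power A k $ i $ j / fact k"
  have "((\<lambda>t. \<Sum>k. ?c k * t ^ k) has_field_derivative (\<Sum>k. diffs ?c k * 0 ^ k)) (at 0)"
    by (rule termdiffs_strong_converges_everywhere) (rule mat_exp_entry_summable)
  then show ?thesis by (simp add: mat_exp_entry diffs_def)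
qed

lemma block_diag_entries [simp]:
  "block_diag A D $ Inl i $ Inl j = A $ i $ j" "block_diag A D $ Inr i $ Inr j = D $ i $ j"
  "block_diag A D $ Inl i $ Inr j = 0" "block_diag A D $ Inr i $ Inl j = 0"
  by (simp_all add: block_diag_def)

lemma sum_blocks: "(\<Sum>i\<in>(UNIV :: (2 + 2) set). f i) = (\<Sum>i\<in>UNIV. f (Inl i)) + (\<Sum>i\<in>UNIV. f (Inr i))"
proof -
  have "(\<Sum>i\<in>(UNIV :: (2 + 2) set). f i) = (\<Sum>i\<in>(UNIV <+> UNIV). f i)" by simp
  also have "\<dots> = (\<Sum>i\<in>UNIV. f (Inl i)) + (\<Sum>i\<in>UNIV. f (Inr i))"
    by (subst sum.Plus) auto
  finally show ?thesis .
qed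

lemma forall_blocks: "(\<forall>i::2+2. P i) \<longleftrightarrow> (\<forall>i. P (Inl i)) \<and> (\<forall>i. P (Inr i))"
  by (metis sum.exhaust)

lemma block_diag_mult: "block_diag A D ** block_diag A' D' = block_diag (A ** A') (D ** D')"
  by (simp add: vec_eq_iff forall_blocks matrix_matrix_mult_def sum_blocks)

lemma block_diag_mat_1: "block_diag (mat 1) (mat 1) = mat 1"
  by (simp add: vec_eq_iff forall_blocks mat_def)

lemma mat_power_block_diag: "mat_power (block_diag A D) k = block_diag (mat_power A k) (mat_power D k)"
  by (induction k) (simp_all add: block_diag_mat_1 block_diag_mult)

lemma mat_exp_block_diag:
  "mat_exp (cscale t (block_diag A D)) = block_diag (mat_exp (cscale t A)) (mat_exp (cscale t D))"
  by (simp add: vec_eq_iff forall_blocks mat_exp_entry mat_power_block_diag)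

lemma rho_block_diag:
  assumes "normN E \<noteq> 0" "normN F \<noteq> 0"
  shows "rho (block_diag E F) f Z = f (matrix_inv E ** Z ** F)"
proof -
  have "matrix_inv (block_diag E F) = block_diag (matrix_inv E) (matrix_inv F)"
    by (rule matrix_inv_unique)
      (simp_all add: block_diag_mult matrix_inv_hc_cancel assms block_diag_mat_1)
  moreover have "matrix_inv (matrix_inv F) = F"
    by (rule matrix_inv_unique) (simp_all add: matrix_inv_hc_cancel assms)
  moreover have "(\<chi> i j. 0) = (0 :: hc)" by (simp add: vec_eq_iff)
  ultimately show ?thesis
    by (simp add: rho_def Let_def matrix_matrix_mult_def[of "0::hc"] vec_lambda_eta)
qed

text \<open>Differentiating \<open>f (exp (-tA) Z exp (tD))\<close> at \<open>t = 0\<close> shows that a pair \<open>(A, D)\<close> acts as the vector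
  field \<open>Z D - A Z\<close>.\<close>

lemma act_BH_eq:
  assumes "has_grad f G"
  shows "act_BH (A, D) f = on_inv (\<lambda>Z. pairing (Z ** D - A ** Z) (\<lambda>i j. G i j Z))"
proof -
  let ?E = "\<lambda>t. mat_exp (cscale t A)" and ?F = "\<lambda>t. mat_exp (cscale t D)"
  have c: "curve_deriv ?E A 0" "curve_deriv ?F D 0"
    by (simp_all add: curve_deriv_def curve_deriv_mat_exp)
  have one: "normN (?E 0) \<noteq> 0" "normN (?F 0) \<noteq> 0" by (simp_all add: mat_exp_0 normN_mat_1)
  have "deriv (\<lambda>t. rho (mat_exp (cscale t (block_diag A D))) f Z) 0 =
      pairing (Z ** D - A ** Z) (\<lambda>i j. G i j Z)" if "normN Z \<noteq> 0" for Z
  proof (rule DERIV_imp_deriv)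
    let ?g = "\<lambda>t. matrix_inv (?E t) ** Z ** ?F t"
    have inv1: "matrix_inv (mat 1) = (mat 1 :: hc)"
      by (rule matrix_inv_unique) (simp_all add: matrix_mul_lid)
    have "curve_deriv (\<lambda>t. Z) 0 0" by (simp add: curve_deriv_def)
    from curve_deriv_mult[OF curve_deriv_mult[OF
        curve_deriv_matrix_inv[OF c(1) mat_exp_0] this] c(2)]
    have "curve_deriv ?g (((- A) ** Z + matrix_inv (?E 0) ** 0) ** ?F 0
        + (matrix_inv (?E 0) ** Z) ** D) 0" by simp
    also have "((- A) ** Z + matrix_inv (?E 0) ** 0) ** ?F 0 + (matrix_inv (?E 0) ** Z) ** D
        = Z ** D - A ** Z"
      by (simp add: mat_exp_0 inv1 matrix_mul_lid matrix_mul_rid)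
        (simp add: vec_eq_iff matrix_matrix_mult_def sum_negf)
    finally have g: "curve_deriv ?g (Z ** D - A ** Z) 0" .
    have g0: "?g 0 = Z" by (simp add: mat_exp_0 inv1 matrix_mul_lid matrix_mul_rid)
    have ev: "eventually (\<lambda>t. rho (mat_exp (cscale t (block_diag A D))) f Z = f (?g t)) (nhds 0)"
      using curve_deriv_eventually_invertible[OF c(1) one(1)]
        curve_deriv_eventually_invertible[OF c(2) one(2)]
      by eventually_elim (simp add: mat_exp_block_diag rho_block_diag)
    show "((\<lambda>t. rho (mat_exp (cscale t (block_diag A D))) f Z) has_field_derivative
        pairing (Z ** D - A ** Z) (\<lambda>i j. G i j Z)) (at 0)"
      by (rule DERIV_cong_ev[OF refl ev refl, THEN iffD2])
        (use has_gradD[OF assms g] g0 that in simp)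
  qed
  then show ?thesis by (auto simp: act_BH_def drho_def on_inv_def fun_eq_iff)
qed


section \<open>Generating polynomials of the matrix coefficients\<close>

text \<open>With \<open>a = l - m\<close> and \<open>c = l + m\<close> this is the integrand of \<open>t\<^sup>l\<^sub>n\<^sub>m\<close> as a polynomial in the variable
  \<open>s\<close> of integration, without the power of \<open>s\<close>. The matrix coefficients are its coefficients, and
  the identities that they satisfy are proved for all of them at once as identities of polynomials
  in \<open>s\<close>.\<close>

definition gen_poly :: "nat \<Rightarrow> nat \<Rightarrow> hc \<Rightarrow> complex poly"
  where "gen_poly a c Z = [:Z $ 2 $ 1, Z $ 1 $ 1:] ^ a * [:Z $ 2 $ 2, Z $ 1 $ 2:] ^ c"

text \<open>The polynomial \<open>[:0, 1:]\<close> is the variable \<open>s\<close>, which accompanies exactly the entries of the first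
  row.\<close>

definition gen_poly_grad :: "nat \<Rightarrow> nat \<Rightarrow> 2 \<Rightarrow> 2 \<Rightarrow> hc \<Rightarrow> complex poly"
  where "gen_poly_grad a c i j Z =
    (if i = 1 then [:0, 1:] else 1) *
    (if j = 1 then smult (of_nat a) (gen_poly (a - 1) c Z) else smult (of_nat c) (gen_poly a (c - 1) Z))"

definition has_poly_grad :: "(hc \<Rightarrow> complex poly) \<Rightarrow> (2 \<Rightarrow> 2 \<Rightarrow> hc \<Rightarrow> complex poly) \<Rightarrow> bool"
  where "has_poly_grad P G \<longleftrightarrow>
    (\<forall>n. has_grad (\<lambda>Z. coeff (P Z) n) (\<lambda>i j Z. coeff (G i j Z) n))"

lemma has_poly_grad_mult:
  assumes "has_poly_grad P F" "has_poly_grad Q G"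
  shows "has_poly_grad (\<lambda>Z. P Z * Q Z) (\<lambda>i j Z. F i j Z * Q Z + P Z * G i j Z)"
  unfolding has_poly_grad_def
proof
  fix n
  have "has_grad (\<lambda>Z. \<Sum>m\<le>n. coeff (P Z) m * coeff (Q Z) (n - m))
      (\<lambda>i j Z. \<Sum>m\<le>n. coeff (F i j Z) m * coeff (Q Z) (n - m) + coeff (P Z) m * coeff (G i j Z) (n - m))"
    using assms by (intro has_grad_sum has_grad_mult) (auto simp: has_poly_grad_def)
  then show "has_grad (\<lambda>Z. coeff (P Z * Q Z) n) (\<lambda>i j Z. coeff (F i j Z * Q Z + P Z * G i j Z) n)"
    by (simp add: coeff_mult sum.distrib)
qed

lemma has_poly_grad_power:
  assumes "has_poly_grad P F"
  shows "has_poly_grad (\<lambda>Z. P Z ^ n) (\<lambda>i j Z. smult (of_nat n) (P Z ^ (n - 1)) * F i j Z)"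
proof (induction n)
  case 0
  show ?case by (simp add: has_poly_grad_def has_grad_const)
next
  case (Suc n)
  have "F i j Z * P Z ^ n + P Z * (smult (of_nat n) (P Z ^ (n - 1)) * F i j Z) =
      smult (of_nat (Suc n)) (P Z ^ (Suc n - 1)) * F i j Z" for i j Z
  proof -
    have "P Z * smult (of_nat n) (P Z ^ (n - 1)) = smult (of_nat n) (P Z ^ n)"
      by (cases n) simp_all
    then have "P Z * (smult (of_nat n) (P Z ^ (n - 1)) * F i j Z) = smult (of_nat n) (P Z ^ n) * F i j Z"
      by (simp add: mult.assoc[symmetric] del: mult_smult_left mult_smult_right)
    then show ?thesis
      by (simp add: smult_add_left distrib_right distrib_left mult.commute)
  qed
  with has_poly_grad_mult[OF assms Suc.IH] show ?case by simp
qed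

lemma has_poly_grad_linear:
  "has_poly_grad (\<lambda>Z. [:Z $ i $ j, Z $ k $ l:])
    (\<lambda>a b Z. (if a = i \<and> b = j then 1 else 0) + (if a = k \<and> b = l then [:0, 1:] else 0))"
  unfolding has_poly_grad_def
proof
  fix n :: nat
  consider "n = 0" | "n = 1" | "n \<ge> 2" by linarith
  then show "has_grad (\<lambda>Z. coeff [:Z $ i $ j, Z $ k $ l:] n) (\<lambda>a b Z. coeff
      ((if a = i \<and> b = j then 1 else 0) + (if a = k \<and> b = l then [:0, 1:] else 0)) n)"
  proof cases
    case 1
    then show ?thesis
      by (auto intro!: has_grad_cong[OF has_grad_entry[of i j]])
  next
    case 2
    then show ?thesis
      by (auto intro!: has_grad_cong[OF has_grad_entry[of k l]])
  next
    case 3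
    then obtain m where "n = Suc (Suc m)" by (metis add_2_eq_Suc le_Suc_ex)
    then show ?thesis
      by (auto intro!: has_grad_cong[OF has_grad_const[of 0]])
  qed
qed

lemma has_poly_grad_gen_poly: "has_poly_grad (gen_poly a c) (gen_poly_grad a c)"
proof -
  let ?l1 = "\<lambda>Z. [:Z $ 2 $ 1, Z $ 1 $ 1:]" and ?l2 = "\<lambda>Z. [:Z $ 2 $ 2, Z $ 1 $ 2:]"
  let ?d = "\<lambda>i j b. (if i = 2 \<and> j = b then 1 else 0) + (if i = (1::2) \<and> j = (b::2) then [:0, 1:] else 0)"
  \<comment> \<open>The shape in which the product and power rules deliver the gradient.\<close>
  have eq: "gen_poly_grad a c = (\<lambda>i j Z.
      smult (of_nat a) (?l1 Z ^ (a - 1)) * ?d i j 1 * ?l2 Z ^ c +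
      ?l1 Z ^ a * (smult (of_nat c) (?l2 Z ^ (c - 1)) * ?d i j 2))"
  proof (intro ext)
    fix i j Z
    show "gen_poly_grad a c i j Z =
      smult (of_nat a) (?l1 Z ^ (a - 1)) * ?d i j 1 * ?l2 Z ^ c +
      ?l1 Z ^ a * (smult (of_nat c) (?l2 Z ^ (c - 1)) * ?d i j 2)"
    proof -
      define x l1 l2 where "x = [:0, 1 :: complex:]" "l1 = ?l1 Z" "l2 = ?l2 Z"
      then show ?thesis
        using exhaust_2[of i] exhaust_2[of j] unfolding gen_poly_grad_def gen_poly_def
        by (elim disjE) (simp_all add: mult_ac flip: x_l1_l2_def)
    qed
  qed
  show ?thesis
    unfolding gen_poly_def[abs_def] eq
    by (intro has_poly_grad_mult has_poly_grad_power has_poly_grad_linear)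
qed

lemma has_poly_grad_gen_poly_grad:
  "has_poly_grad (gen_poly_grad a c i j) (\<lambda>k l Z.
    (if i = 1 then [:0, 1:] else 1) * (if j = 1 then smult (of_nat a) (gen_poly_grad (a - 1) c k l Z)
      else smult (of_nat c) (gen_poly_grad a (c - 1) k l Z)))"
proof -
  have const: "has_poly_grad (\<lambda>Z. Q) (\<lambda>k l Z. 0)" for Q
    by (simp add: has_poly_grad_def has_grad_const)
  have smult: "has_poly_grad (\<lambda>Z. smult x (gen_poly u v Z)) (\<lambda>k l Z. smult x (gen_poly_grad u v k l Z))"
    for x u v
    using has_poly_grad_mult[OF const[of "[:x:]"] has_poly_grad_gen_poly[of u v]] by simp
  have if_eq: "(\<lambda>Z. if j = 1 then f Z else g Z) = (if j = 1 then f else g)" for f g :: "hc \<Rightarrow> complex poly"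
    by simp
  show ?thesis
    unfolding gen_poly_grad_def[of a c i j]
    using has_poly_grad_mult[OF const smult, of "if i = 1 then [:0, 1:] else 1"]
    by (cases "j = 1") (simp_all del: mult_pCons_left mult_pCons_right)
qed

lemma gen_poly_Suc:
  "gen_poly (Suc a) c Z = [:Z $ 2 $ 1, Z $ 1 $ 1:] * gen_poly a c Z"
  "gen_poly a (Suc c) Z = [:Z $ 2 $ 2, Z $ 1 $ 2:] * gen_poly a c Z"
  by (simp_all add: gen_poly_def mult_ac del: mult_pCons_left mult_pCons_right)

text \<open>Euler's identity for a function that is homogeneous of degree \<open>a + c\<close>.\<close>

lemma gen_poly_euler:
  "(\<Sum>i\<in>UNIV. \<Sum>j\<in>UNIV. smult (Z $ i $ j) (gen_poly_grad a c i j Z)) =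
    smult (of_nat (a + c)) (gen_poly a c Z)"
proof -
  have 1: "smult (of_nat a) ([:Z $ 2 $ 1, Z $ 1 $ 1:] * gen_poly (a - 1) c Z) =
      smult (of_nat a) (gen_poly a c Z)"
    by (cases a) (simp_all add: gen_poly_Suc)
  have 2: "smult (of_nat c) ([:Z $ 2 $ 2, Z $ 1 $ 2:] * gen_poly a (c - 1) Z) =
      smult (of_nat c) (gen_poly a c Z)"
    by (cases c) (simp_all add: gen_poly_Suc)
  have "(\<Sum>i\<in>UNIV. \<Sum>j\<in>UNIV. smult (Z $ i $ j) (gen_poly_grad a c i j Z)) =
      smult (of_nat a) ([:Z $ 2 $ 1, Z $ 1 $ 1:] * gen_poly (a - 1) c Z) +
      smult (of_nat c) ([:Z $ 2 $ 2, Z $ 1 $ 2:] * gen_poly a (c - 1) Z)"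
    by (simp add: sum_2 gen_poly_grad_def smult_add_right algebra_simps)
  also have "\<dots> = smult (of_nat (a + c)) (gen_poly a c Z)"
    unfolding 1 2 by (simp add: smult_add_left)
  finally show ?thesis .
qed

text \<open>This is \<open>t\<^sup>l\<^sub>n\<^sub>m\<close> for \<open>a = l - m\<close>, \<open>c = l + m\<close>, \<open>b = l - n\<close>; see \<open>tcoef_eq\<close>. Natural number
  indices avoid all half-integers, and keeping both \<open>a\<close> and \<open>c\<close> avoids truncated subtraction.\<close>

definition mcoef :: "nat \<Rightarrow> nat \<Rightarrow> nat \<Rightarrow> hc \<Rightarrow> complex"
  where "mcoef a c b Z = coeff (gen_poly a c Z) b"

text \<open>In the Leibniz expansion the mixed term pairs the gradients of \<open>N\<close> and \<open>f\<close>. Since \<open>N\<close> is the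
  quadratic form dual to \<open>box\<close>, this pairing is a multiple of the Euler field applied to \<open>f\<close>, and
  homogeneity turns it into a multiple of \<open>N\<^sup>k\<^sup>-\<^sup>1 f\<close>.\<close>

lemma box_normN_powi_mult:
  assumes "has_grad f g" "\<And>a b. has_grad (g a b) (h a b)"
    and harmonic: "\<And>Z. h 1 1 2 2 Z + h 2 2 1 1 Z - h 1 2 2 1 Z - h 2 1 1 2 Z = 0"
    and euler: "\<And>Z. (\<Sum>i\<in>UNIV. \<Sum>j\<in>UNIV. Z $ i $ j * g i j Z) = e * f Z"
  shows "box (on_inv (\<lambda>Z. normN Z powi k * f Z)) =
    on_inv (\<lambda>Z. 4 * of_int k * (of_int k + 1 + e) * normN Z powi (k - 1) * f Z)"
proof -
  have cof: "has_grad (cofactor i j) (\<lambda>u v Z. if u = i \<or> v = j then 0 else if i = j then 1 else -1)" for i j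
  proof -
    let ?s = "if i = j then 1 else -1 :: complex"
    let ?i = "if i = 1 then 2 else 1 :: 2" and ?j = "if j = 1 then 2 else 1 :: 2"
    have 1: "?s * Z $ ?i $ ?j = cofactor i j Z" for Z
      using exhaust_2[of i] exhaust_2[of j] by (auto simp: cofactor_def)
    have 2: "?s * (if u = ?i \<and> v = ?j then 1 else 0) = (if u = i \<or> v = j then 0 else ?s)" for u v
      using exhaust_2[of i] exhaust_2[of j] exhaust_2[of u] exhaust_2[of v] by auto
    show ?thesis
      by (rule has_grad_cong[OF has_grad_scale[OF has_grad_entry[of ?i ?j], of ?s]]) (rule 1 2)+
  qed
  let ?G = "\<lambda>i j Z. of_int k * normN Z powi (k - 1) * cofactor i j Z * f Z + normN Z powi k * g i j Z"
  define X where "X i j u v Z =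
      (of_int k * (of_int (k - 1) * normN Z powi (k - 1 - 1) * cofactor u v Z) * cofactor i j Z +
         of_int k * normN Z powi (k - 1) * (if u = i \<or> v = j then 0 else if i = j then 1 else - 1)) * f Z +
        of_int k * normN Z powi (k - 1) * cofactor i j Z * g u v Z +
        (of_int k * normN Z powi (k - 1) * cofactor u v Z * g i j Z + normN Z powi k * h i j u v Z)"
    for i j u v Z
  have G: "has_grad (on_inv (\<lambda>Z. normN Z powi k * f Z)) ?G"
    by (intro has_grad_on_inv has_grad_mult has_grad_normN_powi assms(1))
  have H: "has_grad (?G i j) (X i j)" for i j
    unfolding X_def
    by (intro has_grad_add has_grad_mult has_grad_scale has_grad_normN_powi cof assms)
  have "2 * (X 1 1 2 2 Z + X 2 2 1 1 Z - X 1 2 2 1 Z - X 2 1 1 2 Z) =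
      4 * of_int k * (of_int k + 1 + e) * normN Z powi (k - 1) * f Z"
    if Z: "normN Z \<noteq> 0" for Z
  proof -
    \<comment> \<open>The powers of \<open>N\<close> become atoms, so that the claim is a polynomial identity.\<close>
    define N0 N1 N2 where "N0 = normN Z powi (k - 2)" "N1 = normN Z powi (k - 1)" "N2 = normN Z powi k"
    have n: "N1 = N0 * normN Z"
      using Z power_int_add_1[of "normN Z" "k - 2"] by (simp add: N0_N1_N2_def)
    have e: "Z $ 1 $ 1 * g 1 1 Z + Z $ 1 $ 2 * g 1 2 Z + Z $ 2 $ 1 * g 2 1 Z + Z $ 2 $ 2 * g 2 2 Z = e * f Z"
      using euler[of Z] by (simp add: sum_2 add.assoc)
    have "X 1 1 2 2 Z + X 2 2 1 1 Z - X 1 2 2 1 Z - X 2 1 1 2 Z =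
      2 * of_int k * ((of_int k - 1) * N0 * (Z $ 1 $ 1 * Z $ 2 $ 2 - Z $ 1 $ 2 * Z $ 2 $ 1) * f Z
        + 2 * N1 * f Z + N1 *
         (Z $ 1 $ 1 * g 1 1 Z + Z $ 1 $ 2 * g 1 2 Z + Z $ 2 $ 1 * g 2 1 Z + Z $ 2 $ 2 * g 2 2 Z))
       + N2 * (h 1 1 2 2 Z + h 2 2 1 1 Z - h 1 2 2 1 Z - h 2 1 1 2 Z)"
      unfolding X_def cofactor_def by (simp flip: N0_N1_N2_def) algebra
    then show ?thesis
      unfolding e harmonic normN_2[of Z, symmetric] N0_N1_N2_def(2)[symmetric]
      by (simp add: n algebra_simps)
  qed
  then show ?thesis
    unfolding box_eq[OF G H] by (intro ext) (simp add: on_inv_def)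
qed

definition basis_fun :: "int \<Rightarrow> nat \<Rightarrow> nat \<Rightarrow> nat \<Rightarrow> hc \<Rightarrow> complex"
  where "basis_fun k a c b = on_inv (\<lambda>Z. normN Z powi k * mcoef a c b Z)"

text \<open>The matrix coefficients are harmonic: \<open>\<partial>\<^sub>1\<^sub>1 \<partial>\<^sub>2\<^sub>2\<close> and \<open>\<partial>\<^sub>1\<^sub>2 \<partial>\<^sub>2\<^sub>1\<close> both multiply the generating
  polynomial by \<open>a c s\<close> and lower both exponents by one. So \<open>box\<close> acts on the products with powers of
  \<open>N\<close> by a scalar and a shift of the exponent.\<close>

lemma box_basis_fun:
  "box (basis_fun k a c b) =
    fscale (4 * of_int k * (of_int k + 1 + of_nat (a + c))) (basis_fun (k - 1) a c b)"
proof -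
  let ?g = "\<lambda>i j Z. coeff (gen_poly_grad a c i j Z) b"
  let ?h = "\<lambda>(i::2) (j::2) k l Z. coeff ((if i = 1 then [:0, 1:] else 1) *
    (if j = 1 then smult (of_nat a) (gen_poly_grad (a - 1) c k l Z)
      else smult (of_nat c) (gen_poly_grad a (c - 1) k l Z))) b"
  have "box (on_inv (\<lambda>Z. normN Z powi k * mcoef a c b Z)) =
    on_inv (\<lambda>Z. 4 * of_int k * (of_int k + 1 + of_nat (a + c)) * normN Z powi (k - 1) * mcoef a c b Z)"
  proof (rule box_normN_powi_mult)
    show "has_grad (mcoef a c b) ?g"
      using has_poly_grad_gen_poly[of a c] by (simp add: has_poly_grad_def mcoef_def[abs_def])
    show "has_grad (?g i j) (?h i j)" for i j
      using has_poly_grad_gen_poly_grad[of a c i j] by (simp add: has_poly_grad_def)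
    show "?h 1 1 2 2 Z + ?h 2 2 1 1 Z - ?h 1 2 2 1 Z - ?h 2 1 1 2 Z = 0" for Z
      by (simp add: gen_poly_grad_def)
    show "(\<Sum>i\<in>UNIV. \<Sum>j\<in>UNIV. Z $ i $ j * ?g i j Z) = of_nat (a + c) * mcoef a c b Z" for Z
      using arg_cong[OF gen_poly_euler[of Z a c], of "\<lambda>P. coeff P b"]
      by (simp add: coeff_sum mcoef_def)
  qed
  then show ?thesis
    by (simp add: basis_fun_def fscale_def on_inv_def fun_eq_iff mult.assoc)
qed


section \<open>The regular functions are spanned by \<open>N\<^sup>k t\<close>\<close>

lemma coeff_linear_mult:
  "coeff ([:x, y:] * P) b = x * coeff P b + (if b = 0 then 0 else y * coeff P (b - 1))"
  by (simp add: coeff_pCons split: nat.splits)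

lemma mcoef_0: "mcoef 0 0 b Z = (if b = 0 then 1 else 0)"
  by (simp add: mcoef_def gen_poly_def)

lemma mcoef_Suc:
  "mcoef (Suc a) c b Z = Z $ 2 $ 1 * mcoef a c b Z + (if b = 0 then 0 else Z $ 1 $ 1 * mcoef a c (b - 1) Z)"
  "mcoef a (Suc c) b Z = Z $ 2 $ 2 * mcoef a c b Z + (if b = 0 then 0 else Z $ 1 $ 2 * mcoef a c (b - 1) Z)"
  by (simp_all only: mcoef_def gen_poly_Suc coeff_linear_mult)

text \<open>For properties of the matrix coefficients that depend only on their being polynomials in the
  entries.\<close>

lemma mcoef_induct [case_names const entry_mult add]:
  assumes "\<And>x. Q (\<lambda>Z. x)"
    and "\<And>i j f. Q f \<Longrightarrow> Q (\<lambda>Z. Z $ i $ j * f Z)"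
    and "\<And>f g. Q f \<Longrightarrow> Q g \<Longrightarrow> Q (\<lambda>Z. f Z + g Z)"
  shows "Q (mcoef a c b)"
proof -
  have "Q (\<lambda>Z. mcoef 0 c b Z)" for c b
  proof (induction c arbitrary: b)
    case 0
    show ?case by (simp add: mcoef_0 assms(1))
  next
    case (Suc c)
    show ?case
      by (cases b) (simp_all add: mcoef_Suc assms(2,3) Suc)
  qed
  then have "Q (\<lambda>Z. mcoef a c b Z)" for c b
  proof (induction a arbitrary: c b)
    case 0
    then show ?case by simp
  next
    case (Suc a)
    show ?case
      by (cases b) (simp_all add: mcoef_Suc assms(2,3) Suc)
  qed
  then show ?thesis .
qed

lemma regular_normN_powi: "on_inv (\<lambda>Z. normN Z powi k) \<in> regular_fun"
proof -
  have one: "on_inv (\<lambda>Z. 1) \<in> regular_fun" by (rule regular_fun.const)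
  have pow: "on_inv (\<lambda>Z. h Z ^ n) \<in> regular_fun" if h: "on_inv h \<in> regular_fun" for h n
  proof (induction n)
    case (Suc n)
    show ?case using regular_fun.mult[OF h Suc] by (simp add: on_inv_mult)
  qed (simp add: one)
  have N: "on_inv normN \<in> regular_fun"
  proof -
    have "(\<lambda>Z. on_inv (\<lambda>Z. Z $ 1 $ 1) Z * on_inv (\<lambda>Z. Z $ 2 $ 2) Z +
        (-1) * (on_inv (\<lambda>Z. Z $ 1 $ 2) Z * on_inv (\<lambda>Z. Z $ 2 $ 1) Z)) \<in> regular_fun"
      by (intro regular_fun.add regular_scale regular_fun.mult regular_fun.entry)
    also have "(\<lambda>Z. on_inv (\<lambda>Z. Z $ 1 $ 1) Z * on_inv (\<lambda>Z. Z $ 2 $ 2) Z +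
        (-1) * (on_inv (\<lambda>Z. Z $ 1 $ 2) Z * on_inv (\<lambda>Z. Z $ 2 $ 1) Z)) = on_inv normN"
      by (auto simp: on_inv_def normN_2[abs_def] fun_eq_iff)
    finally show ?thesis .
  qed
  show ?thesis
    using pow[OF N, of "nat k"] pow[OF regular_fun.norm_inverse, of "nat (- k)"]
    by (cases "k \<ge> 0") (simp_all add: power_int_def)
qed

lemma regular_basis_fun: "basis_fun k a c b \<in> regular_fun"
proof -
  have "on_inv (mcoef a c b) \<in> regular_fun"
  proof (induction rule: mcoef_induct)
    case (const x)
    show ?case by (rule regular_fun.const)
  next
    case (entry_mult i j f)
    show ?case using regular_fun.mult[OF regular_fun.entry[of i j] entry_mult] by (simp only: on_inv_mult)
  next
    case (add f g)
    then show ?case using regular_fun.add[OF add] by (simp only: on_inv_add)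
  qed
  from regular_fun.mult[OF regular_normN_powi this]
  show ?thesis by (simp add: basis_fun_def on_inv_mult)
qed

text \<open>The product of an entry with a matrix coefficient of degree \<open>p = a + c\<close> is a combination of one
  of degree \<open>p + 1\<close> and of \<open>N\<close> times one of degree \<open>p - 1\<close>. Writing \<open>l\<^sub>1, l\<^sub>2\<close> for the two linear
  factors, two linear equations for the products of \<open>z\<^sub>1\<^sub>1\<close> and \<open>z\<^sub>1\<^sub>2\<close> with generating polynomials
  come from differentiating with respect to \<open>s\<close> and from \<open>z\<^sub>1\<^sub>1 l\<^sub>2 - z\<^sub>1\<^sub>2 l\<^sub>1 = N\<close>; the identities below are
  their solution.\<close>

lemma gen_poly_entry_mult:
  "smult (of_nat (a + c + 1) * Z $ 1 $ 1) (gen_poly a c Z) =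
    pderiv (gen_poly (Suc a) c Z) + smult (of_nat c * normN Z) (gen_poly a (c - 1) Z)" (is ?A)
  "smult (of_nat (a + c + 1) * Z $ 1 $ 2) (gen_poly a c Z) =
    pderiv (gen_poly a (Suc c) Z) - smult (of_nat a * normN Z) (gen_poly (a - 1) c Z)" (is ?B)
proof -
  define l1 l2 where l: "l1 = [:Z $ 2 $ 1, Z $ 1 $ 1:]" "l2 = [:Z $ 2 $ 2, Z $ 1 $ 2:]"
  have N: "smult (Z $ 1 $ 1) l2 - smult (Z $ 1 $ 2) l1 = [:normN Z:]"
    by (simp add: l normN_2)
  have d: "pderiv l1 = [:Z $ 1 $ 1:]" "pderiv l2 = [:Z $ 1 $ 2:]"
    by (simp_all add: l pderiv_pCons)
  have pd: "pderiv (l1 ^ a * l2 ^ c) =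
     smult (of_nat a * Z $ 1 $ 1) (l1 ^ (a - 1) * l2 ^ c) + smult (of_nat c * Z $ 1 $ 2) (l1 ^ a * l2 ^ (c - 1))"
    for a c
    by (simp add: pderiv_mult pderiv_power d smult_add_right mult_ac add.commute)
  have c: "smult (of_nat c * normN Z) (l1 ^ a * l2 ^ (c - 1)) =
      smult (of_nat c * Z $ 1 $ 1) (l1 ^ a * l2 ^ c) -
      smult (of_nat c * Z $ 1 $ 2) (l1 ^ Suc a * l2 ^ (c - 1))" for a c
  proof (cases c)
    case (Suc m)
    have "smult (of_nat c * normN Z) (l1 ^ a * l2 ^ (c - 1)) =
        smult (of_nat c) ([:normN Z:] * (l1 ^ a * l2 ^ (c - 1)))" by simp
    also have "\<dots> = smult (of_nat c) ((smult (Z $ 1 $ 1) l2 - smult (Z $ 1 $ 2) l1) * (l1 ^ a * l2 ^ (c - 1)))"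
      unfolding N ..
    finally show ?thesis
      by (simp add: Suc left_diff_distrib right_diff_distrib smult_diff_right mult_ac del: of_nat_Suc)
  qed simp
  have a: "smult (of_nat a * normN Z) (l1 ^ (a - 1) * l2 ^ c) =
      smult (of_nat a * Z $ 1 $ 1) (l1 ^ (a - 1) * l2 ^ Suc c) -
      smult (of_nat a * Z $ 1 $ 2) (l1 ^ a * l2 ^ c)" for a c
  proof (cases a)
    case (Suc m)
    have "smult (of_nat a * normN Z) (l1 ^ (a - 1) * l2 ^ c) =
        smult (of_nat a) ([:normN Z:] * (l1 ^ (a - 1) * l2 ^ c))" by simp
    also have "\<dots> = smult (of_nat a) ((smult (Z $ 1 $ 1) l2 - smult (Z $ 1 $ 2) l1) * (l1 ^ (a - 1) * l2 ^ c))"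
      unfolding N ..
    finally show ?thesis
      by (simp add: Suc left_diff_distrib right_diff_distrib smult_diff_right mult_ac del: of_nat_Suc)
  qed simp
  have s: "smult (of_nat (a + c + 1) * x) P = smult (of_nat (Suc a) * x) P + smult (of_nat c * x) P"
    "smult (of_nat (a + c + 1) * x) P = smult (of_nat a * x) P + smult (of_nat (Suc c) * x) P" for x P
    by (simp_all add: smult_add_left[symmetric] algebra_simps)
  show ?A
    unfolding gen_poly_def l[symmetric] pd c s(1) by simp
  show ?B
    unfolding gen_poly_def l[symmetric] pd a s(2) by simp
qed

definition basis_index :: "(int \<times> nat \<times> nat \<times> nat) set"
  where "basis_index = {(k, a, c, b). b \<le> a + c}"

definition basis_at :: "int \<times> nat \<times> nat \<times> nat \<Rightarrow> hc \<Rightarrow> complex"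
  where "basis_at = (\<lambda>(k, a, c, b). basis_fun k a c b)"

lemma mcoef_eq_0:
  assumes "b > a + c"
  shows "mcoef a c b Z = 0"
proof -
  have "degree ([:x, y:] ^ n) \<le> n" for x y :: complex and n
    using degree_power_le[of "[:x, y:]" n] by (auto split: if_splits)
  then have "degree (gen_poly a c Z) \<le> a + c"
    unfolding gen_poly_def by (intro order.trans[OF degree_mult_le] add_mono)
  then show ?thesis unfolding mcoef_def using assms by (intro coeff_eq_0) simp
qed

lemma basis_fun_in_span: "basis_fun k a c b \<in> fvs.span (basis_at ` basis_index)"
proof (cases "b \<le> a + c")
  case True
  then have "basis_fun k a c b = basis_at (k, a, c, b)" "(k, a, c, b) \<in> basis_index"
    by (simp_all add: basis_at_def basis_index_def)
  then show ?thesis by (metis fvs.span_base imageI)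
next
  case False
  then have "basis_fun k a c b = 0"
    by (auto simp: basis_fun_def mcoef_eq_0 on_inv_def)
  then show ?thesis by (simp add: fvs.span_zero)
qed

lemma normN_powi_mult_basis_fun:
  "(\<lambda>Z. on_inv (\<lambda>Z. normN Z powi m) Z * basis_fun k a c b Z) = basis_fun (m + k) a c b"
  by (auto simp: basis_fun_def on_inv_def power_int_add fun_eq_iff)

text \<open>The first row is \<open>gen_poly_entry_mult\<close>. The second row follows because multiplying the generating
  polynomial by \<open>s z\<^sub>1\<^sub>j + z\<^sub>2\<^sub>j\<close> only raises one of its exponents.\<close>

lemma entry_mult_basis_fun:
  "(\<lambda>Z. on_inv (\<lambda>Z. Z $ i $ j) Z * basis_fun k a c b Z) \<in> fvs.span (basis_at ` basis_index)"
proof -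
  let ?S = "fvs.span (basis_at ` basis_index)"
  have row1: "(\<lambda>Z. on_inv (\<lambda>Z. Z $ 1 $ j) Z * basis_fun k a c b Z) \<in> ?S" for b j
  proof -
    define n where "n = complex_of_nat (a + c + 1)"
    have n: "n \<noteq> 0" unfolding n_def by (metis add_is_0 of_nat_eq_0_iff one_neq_zero)
    have 1: "n * (Z $ 1 $ 1 * mcoef a c b Z) = of_nat (b + 1) * mcoef (Suc a) c (b + 1) Z +
        of_nat c * (normN Z * mcoef a (c - 1) b Z)" for Z
      using arg_cong[OF gen_poly_entry_mult(1)[of a c Z], of "\<lambda>P. coeff P b"]
      by (simp add: n_def mcoef_def coeff_pderiv mult.assoc del: of_nat_add of_nat_Suc)
    have 2: "n * (Z $ 1 $ 2 * mcoef a c b Z) = of_nat (b + 1) * mcoef a (Suc c) (b + 1) Z -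
        of_nat a * (normN Z * mcoef (a - 1) c b Z)" for Z
      using arg_cong[OF gen_poly_entry_mult(2)[of a c Z], of "\<lambda>P. coeff P b"]
      by (simp add: n_def mcoef_def coeff_pderiv mult.assoc del: of_nat_add of_nat_Suc)
    have combine: "z * (X * m) = \<beta> / n * (X * m1) + \<gamma> / n * (N * X * m2)"
      if "n * (z * m) = \<beta> * m1 + \<gamma> * (N * m2)" for z X m \<beta> \<gamma> m1 m2 N
    proof -
      have "n * (z * (X * m)) = X * (n * (z * m))" by (simp add: mult_ac)
      also have "\<dots> = X * (\<beta> * m1 + \<gamma> * (N * m2))" using that by simp
      finally show ?thesis using n by (simp add: field_simps)
    qed
    have "(\<lambda>Z. on_inv (\<lambda>Z. Z $ 1 $ 1) Z * basis_fun k a c b Z) =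
        fscale (of_nat (b + 1) / n) (basis_fun k (Suc a) c (b + 1)) +
        fscale (of_nat c / n) (basis_fun (1 + k) a (c - 1) b)"
      using combine[OF 1] by (auto simp: fun_eq_iff basis_fun_def on_inv_def fscale_def power_int_add)
    moreover have "(\<lambda>Z. on_inv (\<lambda>Z. Z $ 1 $ 2) Z * basis_fun k a c b Z) =
        fscale (of_nat (b + 1) / n) (basis_fun k a (Suc c) (b + 1)) +
        fscale (- of_nat a / n) (basis_fun (1 + k) (a - 1) c b)"
      using combine[OF trans[OF 2], of _ _ _ "- of_nat a"]
      by (auto simp: fun_eq_iff basis_fun_def on_inv_def fscale_def power_int_add)
    ultimately show ?thesis
      using exhaust_2[of j]
      by (auto intro!: fvs.span_add fvs.span_diff fvs.span_scale basis_fun_in_span)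
  qed
  have row2: "(\<lambda>Z. on_inv (\<lambda>Z. Z $ 2 $ j) Z * basis_fun k a c b Z) \<in> ?S"
  proof -
    define a' c' where "a' = (if j = 1 then Suc a else a)" "c' = (if j = 1 then c else Suc c)"
    have "(\<lambda>Z. on_inv (\<lambda>Z. Z $ 2 $ j) Z * basis_fun k a c b Z) =
        basis_fun k a' c' b - (if b = 0 then 0 else (\<lambda>Z. on_inv (\<lambda>Z. Z $ 1 $ j) Z * basis_fun k a c (b - 1) Z))"
      using exhaust_2[of j]
      by (auto simp: fun_eq_iff basis_fun_def on_inv_def a'_c'_def mcoef_Suc algebra_simps)
    then show ?thesis
      using row1[of j "b - 1"] by (auto intro!: fvs.span_diff basis_fun_in_span)
  qed
  show ?thesis using row1 row2 exhaust_2[of i] by auto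
qed

text \<open>The functions that map the span into itself by multiplication form an algebra. It contains the
  generators of the regular functions, hence all of them, and the span contains the constant
  \<open>1\<close>.\<close>

lemma regular_fun_subset_span: "regular_fun \<subseteq> fvs.span (basis_at ` basis_index)"
proof
  let ?S = "fvs.span (basis_at ` basis_index)"
  have lin: "(\<lambda>Z. h Z * g Z) \<in> ?S"
    if h: "\<And>k a c b. (\<lambda>Z. h Z * basis_fun k a c b Z) \<in> ?S" and g: "g \<in> ?S" for h g
    using g
  proof (induction rule: fvs.span_induct)
    case base
    have e: "(\<lambda>Z. h Z * (f + g) Z) = (\<lambda>Z. h Z * f Z) + (\<lambda>Z. h Z * g Z)"
      "(\<lambda>Z. h Z * fscale r f Z) = fscale r (\<lambda>Z. h Z * f Z)" "(\<lambda>Z. h Z * 0 Z) = 0" for r f g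
      by (auto simp: fun_eq_iff fscale_def algebra_simps)
    show ?case
      unfolding fvs.subspace_def mem_Collect_eq e by (auto intro: fvs.span_zero fvs.span_add fvs.span_scale)
  next
    case (step x)
    then show ?case using h by (auto simp: basis_at_def)
  qed
  fix f assume f: "f \<in> regular_fun"
  have "\<forall>g\<in>?S. (\<lambda>Z. f Z * g Z) \<in> ?S"
    using f
  proof induction
    case (const x)
    have e: "(\<lambda>Z. on_inv (\<lambda>Z. x) Z * basis_fun k a c b Z) = fscale x (basis_fun k a c b)" for k a c b
      by (auto simp: fun_eq_iff basis_fun_def on_inv_def fscale_def)
    show ?case by (intro ballI, rule lin) (simp_all add: e fvs.span_scale basis_fun_in_span)
  next
    case (entry i j)
    show ?case by (intro ballI, rule lin) (simp_all add: entry_mult_basis_fun)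
  next
    case norm_inverse
    have e: "(\<lambda>Z. on_inv (\<lambda>Z. inverse (normN Z)) Z * basis_fun k a c b Z) = basis_fun (-1 + k) a c b"
      for k a c b
      using normN_powi_mult_basis_fun[of "-1" k a c b] by (simp add: power_int_minus)
    show ?case by (intro ballI, rule lin) (simp_all add: e basis_fun_in_span)
  next
    case (add f g)
    have "(\<lambda>Z. (f Z + g Z) * h Z) = (\<lambda>Z. f Z * h Z) + (\<lambda>Z. g Z * h Z)" for h
      by (auto simp: fun_eq_iff algebra_simps)
    with add show ?case by (auto intro!: fvs.span_add)
  next
    case (mult f g)
    then show ?case by (simp add: mult.assoc)
  qed
  moreover have one: "(\<lambda>Z. f Z * basis_fun 0 0 0 0 Z) = f"
    using regular_vanishes[OF f] by (auto simp: fun_eq_iff basis_fun_def on_inv_def mcoef_0)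
  moreover have "basis_fun 0 0 0 0 \<in> ?S" by (rule basis_fun_in_span)
  ultimately have "(\<lambda>Z. f Z * basis_fun 0 0 0 0 Z) \<in> ?S" by blast
  with one show "f \<in> ?S" by simp
qed


section \<open>Linear independence of \<open>N\<^sup>k t\<close>\<close>

lemma continuous_on_mcoef: "continuous_on UNIV (mcoef a c b)"
proof (induction rule: mcoef_induct)
  case (const x)
  show ?case by (rule continuous_on_const)
next
  case (entry_mult i j f)
  then show ?case by (intro continuous_intros)
next
  case (add f g)
  then show ?case by (intro continuous_intros)
qed

text \<open>The determinant of \<open>Z + w\<close> is a quadratic polynomial in the scalar \<open>w\<close> with leading coefficient
  \<open>1\<close>, so invertible matrices accumulate at every singular one.\<close>

lemma vanishes_on_singular:
  assumes cont: "continuous_on UNIV g" and zero: "\<And>Z. normN Z \<noteq> 0 \<Longrightarrow> g Z = (0::complex)"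
  shows "g Z = 0"
proof (cases "normN Z = 0")
  case True
  let ?\<gamma> = "\<lambda>w::complex. Z + cscale w (mat 1)"
  let ?tr = "Z $ 1 $ 1 + Z $ 2 $ 2"
  have N: "normN (?\<gamma> w) = w * (?tr + w)" for w
    using True by (simp add: normN_2 cscale_def mat_def algebra_simps)
  have "continuous_on UNIV ?\<gamma>"
    unfolding cscale_def by (intro continuous_intros continuous_on_vec_lambda)
  then have "continuous_on UNIV (\<lambda>w. g (?\<gamma> w))"
    using continuous_on_compose2[OF cont] by blast
  then have "isCont (\<lambda>w. g (?\<gamma> w)) 0"
    by (simp add: continuous_on_eq_continuous_at)
  then have lim: "((\<lambda>w. g (?\<gamma> w)) \<longlongrightarrow> g Z) (at 0)"
    by (simp add: isCont_def cscale_def zero_vec_def[symmetric])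
  have "eventually (\<lambda>w::complex. w \<noteq> 0 \<and> w \<noteq> - ?tr) (at 0)"
    by (intro eventually_conj eventually_neq_at_within)
  then have "eventually (\<lambda>w. g (?\<gamma> w) = 0) (at 0)"
    by eventually_elim (intro zero, simp add: N add_eq_0_iff)
  then have "((\<lambda>w. g (?\<gamma> w)) \<longlongrightarrow> 0) (at 0)"
    by (rule tendsto_eventually)
  with lim show ?thesis by (rule tendsto_unique[rotated]) simp
qed (rule zero)

text \<open>The product of the column \<open>(x, 1)\<close> and the row \<open>(y1, y2)\<close>.\<close>

definition rank_one :: "complex \<Rightarrow> complex \<Rightarrow> complex \<Rightarrow> hc"
  where "rank_one x y1 y2 = vector [vector [x * y1, x * y2], vector [y1, y2]]"

lemma normN_rank_one: "normN (rank_one x y1 y2) = 0"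
  by (simp add: normN_2 rank_one_def)

text \<open>On a matrix of rank one the two linear factors of the generating polynomial are proportional, so
  its coefficients become monomials.\<close>

lemma mcoef_rank_one:
  "mcoef a c b (rank_one x y1 y2) = y1 ^ a * y2 ^ c * of_nat ((a + c) choose b) * x ^ b"
proof -
  have l: "[:y, x * y:] = smult y [:1, x:]" for y by simp
  have "gen_poly a c (rank_one x y1 y2) = smult (y1 ^ a * y2 ^ c) ([:1, x:] ^ (a + c))"
    unfolding gen_poly_def rank_one_def
    by (simp add: l smult_power power_add mult_ac del: smult_pCons)
  then show ?thesis
    by (cases "b \<le> a + c") (simp_all add: mcoef_eq_0, simp add: mcoef_def coeff_linear_poly_power mult_ac)
qed

lemma digits_eq:
  assumes "a + R * (c + R * b) = a' + R * (c' + R * (b'::nat))"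
    "a < R" "c < R" "a' < R" "c' < R"
  shows "a = a' \<and> c = c' \<and> b = b'"
proof -
  have 1: "a = a'" "c + R * b = c' + R * b'"
    using arg_cong[OF assms(1), of "\<lambda>e. e mod R"] arg_cong[OF assms(1), of "\<lambda>e. e div R"] assms(2-)
    by (simp_all add: div_add1_eq)
  have "c = c'" "b = b'"
    using arg_cong[OF 1(2), of "\<lambda>e. e mod R"] arg_cong[OF 1(2), of "\<lambda>e. e div R"] assms(2-)
    by (simp_all add: div_add1_eq)
  with 1 show ?thesis by simp
qed

text \<open>The substitution \<open>y1 = w\<close>, \<open>y2 = w\<^sup>R\<close>, \<open>x = w ^ (R * R)\<close> with a large base \<open>R\<close> turns the monomials of
  \<open>mcoef_rank_one\<close> into powers of one variable, whose exponents are distinct because their digits in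
  base \<open>R\<close> are.\<close>

lemma mcoef_rank_one_independent:
  assumes fin: "finite I" and le: "\<And>a c b. (a, c, b) \<in> I \<Longrightarrow> b \<le> a + c"
    and zero: "\<And>x y1 y2. (\<Sum>(a, c, b)\<in>I. u (a, c, b) * mcoef a c b (rank_one x y1 y2)) = 0"
    and i: "(a0, c0, b0) \<in> I"
  shows "u (a0, c0, b0) = 0"
proof -
  \<comment> \<open>\<open>R\<close> exceeds every \<open>a\<close> and \<open>c\<close>; the leading digit \<open>b\<close> may be arbitrary.\<close>
  define R where "R = Suc (\<Sum>(a, c, b)\<in>I. a + c)"
  have less: "a < R \<and> c < R" if "(a, c, b) \<in> I" for a c b
    using member_le_sum[of "(a, c, b)" I "\<lambda>(a, c, b). a + c"] that fin by (simp add: R_def)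
  define e where "e = (\<lambda>(a, c, b). a + R * (c + R * b))"
  define v where "v = (\<lambda>(a, c, b). u (a, c, b) * of_nat ((a + c) choose b))"
  define P where "P = (\<Sum>i\<in>I. monom (v i) (e i))"
  have "poly P w = 0" for w
  proof -
    have e: "w ^ (a + R * (c + R * b)) = w ^ a * (w ^ R) ^ c * (w ^ (R * R)) ^ b" for a c b
      by (simp add: power_add power_mult[symmetric] distrib_left mult.assoc)
    have "poly P w = (\<Sum>(a, c, b)\<in>I. u (a, c, b) * mcoef a c b (rank_one (w ^ (R * R)) w (w ^ R)))"
      unfolding P_def poly_sum
      by (intro sum.cong) (auto simp: poly_monom v_def e_def mcoef_rank_one e)
    then show ?thesis using zero by simp
  qed
  then have "P = 0" using poly_all_0_iff_0 by blast
  have "0 = coeff P (e (a0, c0, b0))" by (simp add: \<open>P = 0\<close>)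
  also have "\<dots> = (\<Sum>i\<in>I. if i = (a0, c0, b0) then v i else 0)"
    unfolding P_def coeff_sum
  proof (intro sum.cong refl)
    fix j assume "j \<in> I"
    moreover obtain a c b where "j = (a, c, b)" by (cases j)
    ultimately show "coeff (monom (v j) (e j)) (e (a0, c0, b0)) = (if j = (a0, c0, b0) then v j else 0)"
      using digits_eq[of a R c b a0 c0 b0] less[of a c b] less[OF i] by (auto simp: e_def)
  qed
  also have "\<dots> = v (a0, c0, b0)"
    using fin i by simp
  finally show ?thesis using le[OF i] by (simp add: v_def)
qed

text \<open>In a vanishing combination consider the terms with the lowest power of \<open>N\<close>. After division by this
  power, continuity allows restriction to the matrices with \<open>N = 0\<close>, where only these terms survive;
  there the matrix coefficients are independent already on matrices of rank one.\<close>

lemma basis_at_independent: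
  assumes fin: "finite I" and sub: "I \<subseteq> basis_index"
    and zero: "(\<Sum>i\<in>I. fscale (u i) (basis_at i)) = 0" and "j \<in> I"
  shows "u j = 0"
proof (rule ccontr)
  assume "u j \<noteq> 0"
  define J where "J = {i \<in> I. u i \<noteq> 0}"
  have J: "finite J" "J \<subseteq> I" "j \<in> J" using fin \<open>j \<in> I\<close> \<open>u j \<noteq> 0\<close> by (auto simp: J_def)
  define k0 where "k0 = Min (fst ` J)"
  have k0: "k0 \<le> k" if "(k, a, c, b) \<in> J" for k a c b
    using J(1) that unfolding k0_def by (intro Min_le) force+
  have "k0 \<in> fst ` J" unfolding k0_def using J by (intro Min_in) auto
  then obtain a0 c0 b0 where i0: "(k0, a0, c0, b0) \<in> J" by auto
  \<comment> \<open>The combination divided by the lowest power of \<open>N\<close>; it is continuous on all matrices.\<close>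
  define g where "g Z = (\<Sum>(k, a, c, b)\<in>J. u (k, a, c, b) * (normN Z ^ nat (k - k0) * mcoef a c b Z))" for Z
  have "continuous_on UNIV normN"
    unfolding normN_2[abs_def] by (intro continuous_intros)
  then have cont: "continuous_on UNIV g"
    unfolding g_def case_prod_unfold by (intro continuous_intros continuous_on_mcoef)
  have inv: "g Z = 0" if N: "normN Z \<noteq> 0" for Z
  proof -
    have "0 = (\<Sum>i\<in>I. fscale (u i) (basis_at i)) Z" by (simp add: zero)
    also have "\<dots> = (\<Sum>i\<in>I. u i * basis_at i Z)"
      using fin by (induction I) (auto simp: fscale_def)
    also have "\<dots> = (\<Sum>i\<in>J. u i * basis_at i Z)"
      unfolding J_def using fin by (intro sum.mono_neutral_right) auto
    finally have "0 = normN Z powi (- k0) * (\<Sum>i\<in>J. u i * basis_at i Z)" by simp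
    also have "\<dots> = g Z"
      unfolding g_def sum_distrib_left
    proof (intro sum.cong refl)
      fix i assume "i \<in> J"
      moreover obtain k a c b where i: "i = (k, a, c, b)" by (cases i)
      ultimately have "k0 \<le> k" using k0 by blast
      then have "normN Z powi (- k0) * normN Z powi k = normN Z ^ nat (k - k0)"
        using N by (simp add: power_int_add[symmetric]) (simp add: power_int_def)
      then show "normN Z powi (- k0) * (u i * basis_at i Z) =
          (case i of (k, a, c, b) \<Rightarrow> u (k, a, c, b) * (normN Z ^ nat (k - k0) * mcoef a c b Z))"
        using N by (simp add: i basis_at_def basis_fun_def on_inv_def mult.assoc[symmetric])
    qed
    finally show ?thesis by simp
  qed
  define I0 where "I0 = {(a, c, b). (k0, a, c, b) \<in> J}"
  have I0: "I0 = snd ` {i \<in> J. fst i = k0}" by (force simp: I0_def)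
  have "u (k0, a0, c0, b0) = 0"
  proof (rule mcoef_rank_one_independent[of I0 "\<lambda>(a, c, b). u (k0, a, c, b)", simplified])
    show "finite I0" unfolding I0 using J(1) by simp
    show "b \<le> a + c" if "(a, c, b) \<in> I0" for a c b
      using that sub J(2) by (auto simp: I0_def basis_index_def)
    show "(a0, c0, b0) \<in> I0" using i0 by (simp add: I0_def)
    fix x y1 y2
    define Z where "Z = rank_one x y1 y2"
    have N: "normN Z = 0" unfolding Z_def by (rule normN_rank_one)
    have "(\<Sum>(a, c, b)\<in>I0. u (k0, a, c, b) * mcoef a c b Z) =
        (\<Sum>(k, a, c, b)\<in>{i \<in> J. fst i = k0}. u (k, a, c, b) * mcoef a c b Z)"
      unfolding I0 by (subst sum.reindex) (auto intro!: inj_onI sum.cong)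
    also have "\<dots> = g Z"
      unfolding g_def
    proof (rule sum.mono_neutral_cong_left)
      show "\<forall>i\<in>J - {i \<in> J. fst i = k0}.
          (case i of (k, a, c, b) \<Rightarrow> u (k, a, c, b) * (normN Z ^ nat (k - k0) * mcoef a c b Z)) = 0"
      proof safe
        fix k a c b assume i: "(k, a, c, b) \<in> J" "u (k, a, c, b) * (normN Z ^ nat (k - k0) * mcoef a c b Z) \<noteq> 0"
        then have "\<not> k > k0" using N by auto
        then show "fst (k, a, c, b) = k0" using k0[OF i(1)] by simp
      qed
    qed (use J(1) in auto)
    also have "g Z = 0" using vanishes_on_singular[OF cont inv] .
    finally show "(\<Sum>(a, c, b)\<in>I0. u (k0, a, c, b) * mcoef a c b (rank_one x y1 y2)) = 0"
      unfolding Z_def .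
  qed
  with i0 show False by (simp add: J_def)
qed

lemma in_span_image_explicit:
  assumes "f \<in> fvs.span (g ` A)"
  obtains I u where "finite I" "I \<subseteq> A" "f = (\<Sum>i\<in>I. fscale (u i) (g i))"
proof -
  obtain t r where t: "finite t" "t \<subseteq> g ` A" "f = (\<Sum>x\<in>t. fscale (r x) x)"
    using assms by (auto simp: fvs.span_explicit)
  from t(1,2) obtain I where I: "I \<subseteq> A" "finite I" "inj_on g I" "t = g ` I"
    by (metis subset_image_inj finite_imageD)
  have "f = (\<Sum>i\<in>I. fscale (r (g i)) (g i))"
    unfolding t(3) I(4) by (subst sum.reindex[OF I(3)]) simp
  with I show ?thesis by (intro that[of I "\<lambda>i. r (g i)"])
qed


section \<open>Biharmonic functions of a given degree\<close>

lemma mcoef_cscale: "mcoef a c b (cscale t Z) = t ^ (a + c) * mcoef a c b Z"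
proof -
  have l: "[:t * x, t * y:] = smult t [:x, y:]" for x y by simp
  have "gen_poly a c (cscale t Z) = smult (t ^ (a + c)) (gen_poly a c Z)"
    unfolding gen_poly_def
    by (simp add: cscale_def l smult_power power_add mult_ac del: smult_pCons)
  then show ?thesis by (simp add: mcoef_def)
qed

definition basis_degree :: "int \<times> nat \<times> nat \<times> nat \<Rightarrow> int"
  where "basis_degree = (\<lambda>(k, a, c, b). 2 * k + int (a + c))"

definition bibox_factor :: "int \<times> nat \<times> nat \<times> nat \<Rightarrow> int"
  where "bibox_factor = (\<lambda>(k, a, c, b). k * (k - 1) * (k + int (a + c)) * (k + int (a + c) + 1))"

definition BH_index :: "int \<Rightarrow> (int \<times> nat \<times> nat \<times> nat) set"
  where "BH_index d = {i \<in> basis_index. basis_degree i = d \<and> bibox_factor i = 0}"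

lemma normN_cscale: "normN (cscale t Z) = t ^ 2 * normN Z"
  by (simp add: normN_2 cscale_def power2_eq_square algebra_simps)

lemma basis_at_cscale:
  assumes "t \<noteq> 0"
  shows "basis_at i (cscale t Z) = t powi basis_degree i * basis_at i Z"
proof -
  obtain k a c b where i: "i = (k, a, c, b)" by (cases i)
  have "(t ^ 2 * normN Z) powi k = t powi (2 * k) * normN Z powi k"
    by (simp add: power_int_mult_distrib power_int_mult)
  moreover have "t powi (2 * k + int (a + c)) = t powi (2 * k) * t ^ (a + c)"
    using assms by (simp only: power_int_add power_int_of_nat simp_thms)
  ultimately show ?thesis
    using assms by (simp add: i basis_at_def basis_fun_def on_inv_def normN_cscale mcoef_cscale
        basis_degree_def mult_ac)
qed

lemma regular_basis_at: "basis_at i \<in> regular_fun"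
  by (simp add: basis_at_def regular_basis_fun split: prod.splits)

lemma box_zero: "box 0 = 0"
  using box_scale[OF regular_basis_fun, of 0] by simp

lemma box_regular:
  assumes "f \<in> regular_fun"
  shows "box f \<in> regular_fun"
proof -
  have sub: "box g \<in> regular_fun" if "g \<in> fvs.span (basis_at ` basis_index)" for g
  proof -
    have "fvs.span (basis_at ` basis_index) \<subseteq> {g \<in> regular_fun. box g \<in> regular_fun}"
    proof (rule fvs.span_minimal)
      show "basis_at ` basis_index \<subseteq> {g \<in> regular_fun. box g \<in> regular_fun}"
        by (auto simp: basis_at_def box_basis_fun
            intro!: regular_basis_fun fvs.subspace_scale[OF regular_subspace])
      show "fvs.subspace {g \<in> regular_fun. box g \<in> regular_fun}"
        using regular_subspace by (auto simp: fvs.subspace_def box_zero box_add box_scale)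
    qed
    with that show ?thesis by blast
  qed
  show ?thesis using assms regular_fun_subset_span sub by blast
qed

lemma box_sum:
  assumes "finite I" "\<And>i. i \<in> I \<Longrightarrow> g i \<in> regular_fun"
  shows "box (\<Sum>i\<in>I. fscale (u i) (g i)) = (\<Sum>i\<in>I. fscale (u i) (box (g i)))"
  using assms
proof (induction I)
  case (insert i I)
  have "(\<Sum>i\<in>I. fscale (u i) (g i)) \<in> regular_fun"
    using insert.prems regular_subspace
    by (intro fvs.subspace_sum[OF regular_subspace] fvs.subspace_scale[OF regular_subspace]) auto
  moreover have "fscale (u i) (g i) \<in> regular_fun"
    using insert.prems by (intro fvs.subspace_scale[OF regular_subspace]) auto
  ultimately show ?case
    using insert by (simp only: sum.insert[OF insert.hyps] box_add box_scale insertI1 insertI2)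
qed (simp add: box_zero)

lemma bibox_basis_at:
  "box (box (basis_at (k, a, c, b))) =
    fscale (16 * of_int (bibox_factor (k, a, c, b))) (basis_at (k - 2, a, c, b))"
proof -
  have "4 * of_int k * (of_int k + 1 + of_nat (a + c)) *
      (4 * of_int (k - 1) * (of_int (k - 1) + 1 + of_nat (a + c))) =
      (16 * of_int (bibox_factor (k, a, c, b)) :: complex)"
    by (simp add: bibox_factor_def algebra_simps)
  then show ?thesis
    by (simp only: basis_at_def box_basis_fun box_scale[OF regular_basis_fun] fvs.scale_scale prod.case)
      simp
qed

text \<open>Scaling of the argument and \<open>box\<close> applied twice both act on the basis functions by scalars, the
  second one up to the injective shift \<open>k \<mapsto> k - 2\<close> of the index. By independence both conditions
  that define the space can therefore be imposed on each term of an expansion separately.\<close>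

lemma BH_eq_span: "BH d = fvs.span (basis_at ` BH_index d)"
proof
  have sub: "fvs.subspace (BH d)"
    unfolding fvs.subspace_def
  proof (intro conjI ballI allI)
    show "0 \<in> BH d"
      using regular_zero by (simp add: BH_def biharmonic_def box_zero) (simp add: zero_fun_def)
    show "f + g \<in> BH d" if "f \<in> BH d" "g \<in> BH d" for f g
      using that fvs.subspace_add[OF regular_subspace, of f g]
      by (simp add: BH_def biharmonic_def box_add box_regular distrib_left)
    show "fscale r f \<in> BH d" if "f \<in> BH d" for r f
      using that fvs.subspace_scale[OF regular_subspace, of f r]
      by (simp add: BH_def biharmonic_def box_scale box_regular) (simp add: fscale_def)
  qed
  show "fvs.span (basis_at ` BH_index d) \<subseteq> BH d"
  proof (rule fvs.span_minimal[OF _ sub], safe)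
    fix k a c b assume "(k, a, c, b) \<in> BH_index d"
    then show "basis_at (k, a, c, b) \<in> BH d"
      by (auto simp: BH_index_def BH_def biharmonic_def regular_basis_at bibox_basis_at basis_at_cscale)
  qed
  show "BH d \<subseteq> fvs.span (basis_at ` BH_index d)"
  proof
    fix f assume f: "f \<in> BH d"
    then have reg: "f \<in> regular_fun" and bb: "box (box f) = 0"
      and hom: "\<And>c Z. c \<noteq> 0 \<Longrightarrow> normN Z \<noteq> 0 \<Longrightarrow> f (cscale c Z) = c powi d * f Z"
      by (auto simp: BH_def biharmonic_def)
    obtain I u where I: "finite I" "I \<subseteq> basis_index" and f_eq: "f = (\<Sum>i\<in>I. fscale (u i) (basis_at i))"
      by (rule in_span_image_explicit[OF subsetD[OF regular_fun_subset_span reg]])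
    have app: "(\<Sum>i\<in>I. fscale (v i) (h i)) Z = (\<Sum>i\<in>I. v i * h i Z)"
      for v :: "_ \<Rightarrow> complex" and h :: "_ \<Rightarrow> hc \<Rightarrow> complex" and Z
      using I(1) by (induction I) (auto simp: fscale_def)
    \<comment> \<open>Scaling by \<open>2\<close> already separates the degrees, as powers of \<open>2\<close> are distinct.\<close>
    have deg: "u i = 0" if "i \<in> I" "basis_degree i \<noteq> d" for i
    proof -
      have "(\<Sum>i\<in>I. fscale (u i * (2 powi basis_degree i - 2 powi d)) (basis_at i)) = 0"
      proof
        fix Z
        show "(\<Sum>i\<in>I. fscale (u i * (2 powi basis_degree i - 2 powi d)) (basis_at i)) Z = 0 Z"
        proof (cases "normN Z = 0")
          case True
          then show ?thesis
            unfolding app using regular_vanishes[OF regular_basis_at] by simp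
        next
          case False
          have "(\<Sum>i\<in>I. u i * (2 powi basis_degree i * basis_at i Z)) = f (cscale 2 Z)"
            by (simp add: f_eq app basis_at_cscale)
          also have "\<dots> = 2 powi d * (\<Sum>i\<in>I. u i * basis_at i Z)"
            using hom[of 2 Z] False by (simp add: f_eq app)
          finally show ?thesis
            by (simp add: app algebra_simps sum_subtractf sum_distrib_left)
        qed
      qed
      from basis_at_independent[OF I this that(1)]
      have "u i = 0 \<or> (2::complex) powi basis_degree i = 2 powi d" by simp
      moreover have "(2::complex) powi basis_degree i \<noteq> 2 powi d"
      proof
        assume "(2::complex) powi basis_degree i = 2 powi d"
        then have "norm ((2::complex) powi basis_degree i) = norm ((2::complex) powi d)" by simp
        then have "(2::real) powi basis_degree i = 2 powi d" by (simp add: norm_power_int)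
        then show False
          using that(2) power_int_strict_increasing[of "basis_degree i" d "2::real"]
            power_int_strict_increasing[of d "basis_degree i" "2::real"] by linarith
      qed
      ultimately show ?thesis by simp
    qed
    \<comment> \<open>The shifts \<open>\<sigma>\<close> of distinct indices are distinct, so independence applies to \<open>box (box f)\<close>.\<close>
    have bib: "u i = 0" if "i \<in> I" "bibox_factor i \<noteq> 0" for i
    proof -
      define \<sigma> \<tau> where "\<sigma> = (\<lambda>(k, a, c, b). (k - 2 :: int, a :: nat, c :: nat, b :: nat))"
        and "\<tau> = (\<lambda>(k, a, c, b). (k + 2 :: int, a :: nat, c :: nat, b :: nat))"
      have \<tau>: "\<tau> (\<sigma> i) = i" for i by (cases i) (simp add: \<sigma>_def \<tau>_def)
      have inj: "inj_on \<sigma> I" by (rule inj_on_inverseI[of _ \<tau>]) (rule \<tau>)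
      have sub: "\<sigma> ` I \<subseteq> basis_index" using I(2) by (auto simp: basis_index_def \<sigma>_def)
      define v where "v i = u (\<tau> i) * (16 * of_int (bibox_factor (\<tau> i)))" for i
      have "(\<Sum>i\<in>\<sigma> ` I. fscale (v i) (basis_at i)) =
          (\<Sum>i\<in>I. fscale (u i * (16 * of_int (bibox_factor i))) (basis_at (\<sigma> i)))"
        by (subst sum.reindex[OF inj]) (simp add: v_def \<tau>)
      also have "\<dots> = (\<Sum>i\<in>I. fscale (u i) (box (box (basis_at i))))"
        by (intro sum.cong) (auto simp: \<sigma>_def bibox_basis_at)
      also have "\<dots> = box (box f)"
      proof -
        show ?thesis
          unfolding f_eq using I(1) by (simp add: box_sum regular_basis_at box_regular)
      qed
      finally have "(\<Sum>i\<in>\<sigma> ` I. fscale (v i) (basis_at i)) = 0" using bb by simp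
      from basis_at_independent[OF _ sub this, of "\<sigma> i"] I(1) that
      show ?thesis by (simp add: v_def \<tau>)
    qed
    have "fscale (u i) (basis_at i) \<in> fvs.span (basis_at ` BH_index d)" if "i \<in> I" for i
    proof (cases "u i = 0")
      case False
      then have "i \<in> BH_index d" using deg[OF that] bib[OF that] that I(2) unfolding BH_index_def by blast
      then show ?thesis by (intro fvs.span_scale fvs.span_base) simp
    qed (simp add: fvs.span_zero)
    then show "f \<in> fvs.span (basis_at ` BH_index d)"
      unfolding f_eq by (intro fvs.span_sum)
  qed
qed


section \<open>Modules with a basis of monomial type\<close>

abbreviation weight_grid :: "nat \<Rightarrow> (nat \<times> nat) set"
  where "weight_grid p \<equiv> {..p} \<times> {..p}"

text \<open>If \<open>v (a, b)\<close> is the monomial \<open>\<xi>\<^sub>1\<^sup>b \<xi>\<^sub>2\<^sup>p\<^sup>-\<^sup>b \<eta>\<^sub>1\<^sup>a \<eta>\<^sub>2\<^sup>p\<^sup>-\<^sup>a\<close>, this is its derivative along the vector field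
  \<open>(\<xi> A, \<eta> D)\<close> for traceless \<open>A\<close> and \<open>D\<close>. At the boundary of the grid the vectors outside it, as well
  as those with a truncated index, carry the coefficient \<open>0\<close>.\<close>

definition weight_action ::
    "nat \<Rightarrow> hc \<Rightarrow> hc \<Rightarrow> (nat \<times> nat \<Rightarrow> 'a \<Rightarrow> complex) \<Rightarrow> nat \<times> nat \<Rightarrow> 'a \<Rightarrow> complex"
  where "weight_action p A D v = (\<lambda>(a, b).
    fscale ((2 * of_nat b - of_nat p) * A $ 1 $ 1 + (2 * of_nat a - of_nat p) * D $ 1 $ 1) (v (a, b)) +
    fscale (of_nat b * A $ 2 $ 1) (v (a, b - 1)) +
    fscale (of_nat (p - b) * A $ 1 $ 2) (v (a, b + 1)) +
    fscale (of_nat a * D $ 2 $ 1) (v (a - 1, b)) +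
    fscale (of_nat (p - a) * D $ 1 $ 2) (v (a + 1, b)))"

text \<open>The coefficients of \<open>weight_action\<close>; having the action as a matrix makes it evident that it is the
  same for every choice of the vectors.\<close>

definition weight_matrix :: "nat \<Rightarrow> hc \<Rightarrow> hc \<Rightarrow> nat \<times> nat \<Rightarrow> nat \<times> nat \<Rightarrow> complex"
  where "weight_matrix p A D = (\<lambda>(a, b) j.
    (if j = (a, b) then (2 * of_nat b - of_nat p) * A $ 1 $ 1 + (2 * of_nat a - of_nat p) * D $ 1 $ 1 else 0) +
    (if j = (a, b - 1) then of_nat b * A $ 2 $ 1 else 0) +
    (if j = (a, b + 1) then of_nat (p - b) * A $ 1 $ 2 else 0) +
    (if j = (a - 1, b) then of_nat a * D $ 2 $ 1 else 0) +
    (if j = (a + 1, b) then of_nat (p - a) * D $ 1 $ 2 else 0))"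

lemma weight_action_eq_sum:
  assumes "i \<in> weight_grid p"
  shows "weight_action p A D v i = (\<Sum>j\<in>weight_grid p. fscale (weight_matrix p A D i j) (v j))"
proof -
  obtain a b where i: "i = (a, b)" "a \<le> p" "b \<le> p" using assms by (cases i) auto
  have s: "(\<Sum>j\<in>weight_grid p. fscale (if j = c then x else 0) (v j)) = fscale x (v c)"
    if "c \<notin> weight_grid p \<Longrightarrow> x = 0" for c x
  proof -
    have "(\<Sum>j\<in>weight_grid p. fscale (if j = c then x else 0) (v j)) =
        (\<Sum>j\<in>weight_grid p. if j = c then fscale x (v j) else 0)"
      by (intro sum.cong) auto
    then show ?thesis using that by (auto simp: sum.delta)
  qed
  show ?thesis
    unfolding i weight_action_def weight_matrix_def prod.case fvs.scale_left_distrib sum.distrib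
    using i by (subst s, force)+ (simp only: fvs.scale_left_distrib)
qed

definition grid_sum :: "nat \<Rightarrow> (nat \<times> nat \<Rightarrow> 'a \<Rightarrow> complex) \<Rightarrow> (nat \<times> nat \<Rightarrow> complex) \<Rightarrow> 'a \<Rightarrow> complex"
  where "grid_sum p v u = (\<Sum>i\<in>weight_grid p. fscale (u i) (v i))"

lemma grid_sum_weight_action:
  "grid_sum p (weight_action p A D v) u =
    grid_sum p v (\<lambda>j. \<Sum>i\<in>weight_grid p. u i * weight_matrix p A D i j)"
proof -
  have "grid_sum p (weight_action p A D v) u =
      (\<Sum>i\<in>weight_grid p. \<Sum>j\<in>weight_grid p. fscale (u i * weight_matrix p A D i j) (v j))"
    unfolding grid_sum_def
    by (intro sum.cong refl) (simp add: weight_action_eq_sum fvs.scale_sum_right)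
  also have "\<dots> = (\<Sum>j\<in>weight_grid p. \<Sum>i\<in>weight_grid p. fscale (u i * weight_matrix p A D i j) (v j))"
    by (rule sum.swap)
  finally show ?thesis
    by (simp add: grid_sum_def fvs.scale_sum_left)
qed

lemma grid_sum_add: "grid_sum p v (\<lambda>i. u i + w i) = grid_sum p v u + grid_sum p v w"
  by (simp add: grid_sum_def fvs.scale_left_distrib sum.distrib)

lemma grid_sum_scale: "grid_sum p v (\<lambda>i. r * u i) = fscale r (grid_sum p v u)"
  by (simp add: grid_sum_def fvs.scale_sum_right)

lemma grid_sum_cong:
  "(\<And>i. i \<in> weight_grid p \<Longrightarrow> u i = w i) \<Longrightarrow> grid_sum p v u = grid_sum p v w"
  unfolding grid_sum_def by (intro sum.cong) auto

lemma grid_sum_single: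
  assumes "j \<in> weight_grid p" "\<And>i. i \<in> weight_grid p \<Longrightarrow> i \<noteq> j \<Longrightarrow> u i = 0"
  shows "grid_sum p v u = fscale (u j) (v j)"
proof -
  have "grid_sum p v u = (\<Sum>i\<in>weight_grid p. if i = j then fscale (u i) (v i) else 0)"
    unfolding grid_sum_def using assms(2) by (intro sum.cong) auto
  then show ?thesis using assms(1) by simp
qed

lemma span_grid: "fvs.span (v ` weight_grid p) = range (grid_sum p v)"
proof
  show "fvs.span (v ` weight_grid p) \<subseteq> range (grid_sum p v)"
  proof
    fix x assume "x \<in> fvs.span (v ` weight_grid p)"
    then obtain I u where I: "finite I" "I \<subseteq> weight_grid p" "x = (\<Sum>i\<in>I. fscale (u i) (v i))"
      by (rule in_span_image_explicit)
    have "x = (\<Sum>i\<in>weight_grid p. fscale (if i \<in> I then u i else 0) (v i))"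
      unfolding I(3) using I(2) by (intro sum.mono_neutral_cong_left) auto
    then show "x \<in> range (grid_sum p v)" by (auto simp: grid_sum_def)
  qed
  show "range (grid_sum p v) \<subseteq> fvs.span (v ` weight_grid p)"
    unfolding grid_sum_def by (auto intro!: fvs.span_sum fvs.span_scale intro: fvs.span_base)
qed

text \<open>Independent vectors that transform like the monomials of bidegree \<open>(p, p)\<close>. All that is needed
  about the two concrete modules, the components of the biharmonic functions and the tensor products
  of symmetric powers, follows from this description.\<close>

locale weight_module =
  fixes act :: "hc \<times> hc \<Rightarrow> ('a \<Rightarrow> complex) \<Rightarrow> 'a \<Rightarrow> complex"
    and p :: nat and v :: "nat \<times> nat \<Rightarrow> 'a \<Rightarrow> complex"
  assumes independent: "\<And>u i. grid_sum p v u = 0 \<Longrightarrow> i \<in> weight_grid p \<Longrightarrow> u i = 0"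
    and action: "\<And>A D u. (A, D) \<in> sl2sl2 \<Longrightarrow>
      act (A, D) (grid_sum p v u) = grid_sum p (weight_action p A D v) u"
begin

lemma act_grid_sum:
  "(A, D) \<in> sl2sl2 \<Longrightarrow> act (A, D) (grid_sum p v u) =
    grid_sum p v (\<lambda>j. \<Sum>i\<in>weight_grid p. u i * weight_matrix p A D i j)"
  by (simp add: action grid_sum_weight_action)

lemma grid_sum_eqD:
  assumes "grid_sum p v u = grid_sum p v w" "i \<in> weight_grid p"
  shows "u i = w i"
proof -
  have "grid_sum p v (\<lambda>i. u i + (-1) * w i) = 0"
    unfolding grid_sum_add grid_sum_scale assms(1) by (simp add: fscale_def fun_eq_iff)
  from independent[OF this assms(2)] show ?thesis by simp
qed

lemma act_basis:
  assumes "(A, D) \<in> sl2sl2" "i \<in> weight_grid p"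
  shows "act (A, D) (v i) = weight_action p A D v i"
proof -
  have e: "grid_sum p w (\<lambda>j. if j = i then 1 else 0) = w i" for w :: "nat \<times> nat \<Rightarrow> 'a \<Rightarrow> complex"
    using assms(2) by (subst grid_sum_single[of i]) auto
  show ?thesis using action[OF assms(1), of "\<lambda>j. if j = i then 1 else 0"] by (simp add: e)
qed

lemma submodule: "submodule act (fvs.span (v ` weight_grid p))"
  unfolding submodule_def span_grid
  using fvs.subspace_span[of "v ` weight_grid p"] by (auto simp: span_grid act_grid_sum)

text \<open>The matrix unit in position \<open>(1, 2)\<close> of the first factor maps \<open>v (a, b)\<close> to a nonzero multiple of \<open>v (a, b + 1)\<close> as long
  as \<open>b < p\<close>. Applied to a vector, it increases the least second index that occurs, until only \<open>b = p\<close>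
  is left.\<close>

lemma raise_right:
  assumes W: "submodule act W" and u: "grid_sum p v u \<in> W" "\<exists>i\<in>weight_grid p. u i \<noteq> 0"
  shows "\<exists>u. grid_sum p v u \<in> W \<and> (\<exists>i\<in>weight_grid p. u i \<noteq> 0) \<and>
    (\<forall>i\<in>weight_grid p. u i \<noteq> 0 \<longrightarrow> snd i = p)"
proof -
  have "\<exists>u. grid_sum p v u \<in> W \<and> (\<exists>i\<in>weight_grid p. u i \<noteq> 0) \<and>
      (\<forall>i\<in>weight_grid p. u i \<noteq> 0 \<longrightarrow> snd i \<ge> n)" if "n \<le> p" for n
    using that
  proof (induction n)
    case 0
    then show ?case using u by auto
  next
    case (Suc n)
    then obtain u where u: "grid_sum p v u \<in> W" "\<exists>i\<in>weight_grid p. u i \<noteq> 0"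
      "\<forall>i\<in>weight_grid p. u i \<noteq> 0 \<longrightarrow> snd i \<ge> n" by auto
    show ?case
    proof (cases "\<exists>a\<le>p. u (a, n) \<noteq> 0")
      case False
      then have "\<forall>i\<in>weight_grid p. u i \<noteq> 0 \<longrightarrow> snd i \<ge> Suc n"
        using u(3) by (force simp: Suc_le_eq order.strict_iff_order)
      with u show ?thesis by blast
    next
      case True
      then obtain a where a: "a \<le> p" "u (a, n) \<noteq> 0" by blast
      let ?E = "(\<chi> i j. if i = 1 \<and> j = 2 then 1 else 0) :: hc"
      have E: "?E $ 1 $ 1 = 0" "?E $ 2 $ 1 = 0" "?E $ 1 $ 2 = 1" by simp_all
      define w where "w j = (\<Sum>i\<in>weight_grid p. u i * weight_matrix p ?E 0 i j)" for j
      have X: "(?E, 0) \<in> sl2sl2" by (simp add: sl2sl2_def Re_hc_def trace_def sum_2)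
      have "act X (grid_sum p v u) \<in> W" if "X \<in> sl2sl2" for X
        using W u(1) that unfolding submodule_def by blast
      from this[OF X] have "grid_sum p v w \<in> W"
        unfolding w_def[abs_def] act_grid_sum[OF X] .
      moreover have w: "w (a, b) = (if b = 0 then 0 else of_nat (p - (b - 1)) * u (a, b - 1))"
        if "a \<le> p" "b \<le> p" for a b
      proof -
        have m: "weight_matrix p ?E 0 i j = (if j = (fst i, Suc (snd i)) then of_nat (p - snd i) else 0)" for i j
          by (simp only: weight_matrix_def case_prod_unfold E zero_index mult_zero_right mult_1_right
              if_cancel add_0_left add_0_right Suc_eq_plus1)
        have "w (a, b) = (\<Sum>i\<in>weight_grid p. if b \<noteq> 0 \<and> i = (a, b - 1) then of_nat (p - snd i) * u i else 0)"
          unfolding w_def m by (intro sum.cong) auto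
        also have "\<dots> = (if b = 0 then 0 else of_nat (p - (b - 1)) * u (a, b - 1))"
          using that by (cases "b = 0") (simp_all add: sum.delta le_diff_conv)
        finally show ?thesis .
      qed
      moreover have "w (a, Suc n) \<noteq> 0" using w[OF a(1) Suc.prems] a Suc.prems by simp
      moreover have "snd i \<ge> Suc n" if i: "i \<in> weight_grid p" "w i \<noteq> 0" for i
      proof -
        obtain a b where ab: "i = (a, b)" by (cases i)
        then have "b \<noteq> 0" "u (a, b - 1) \<noteq> 0" using i w[of a b] by (auto split: if_splits)
        then show ?thesis using u(3)[rule_format, of "(a, b - 1)"] i ab by (cases b) auto
      qed
      ultimately show ?thesis using a(1) Suc.prems by (intro exI[of _ w] conjI bexI[of _ "(a, Suc n)"]) auto
    qed
  qed
  from this[of p] show ?thesis by (auto simp: order_antisym_conv)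
qed

text \<open>The same argument for the second factor, which preserves the second index.\<close>

lemma raise_left:
  assumes W: "submodule act W" and u: "grid_sum p v u \<in> W" "\<exists>i\<in>weight_grid p. u i \<noteq> 0"
    and right: "\<forall>i\<in>weight_grid p. u i \<noteq> 0 \<longrightarrow> snd i = p"
  shows "\<exists>u. grid_sum p v u \<in> W \<and> (\<exists>i\<in>weight_grid p. u i \<noteq> 0) \<and>
    (\<forall>i\<in>weight_grid p. u i \<noteq> 0 \<longrightarrow> i = (p, p))"
proof -
  have "\<exists>u. grid_sum p v u \<in> W \<and> (\<exists>i\<in>weight_grid p. u i \<noteq> 0) \<and>
      (\<forall>i\<in>weight_grid p. u i \<noteq> 0 \<longrightarrow> fst i \<ge> n \<and> snd i = p)" if "n \<le> p" for n
    using that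
  proof (induction n)
    case 0
    then show ?case using u right by auto
  next
    case (Suc n)
    then obtain u where u: "grid_sum p v u \<in> W" "\<exists>i\<in>weight_grid p. u i \<noteq> 0"
      "\<forall>i\<in>weight_grid p. u i \<noteq> 0 \<longrightarrow> fst i \<ge> n \<and> snd i = p" by auto
    show ?case
    proof (cases "u (n, p) = 0")
      case True
      then have "\<forall>i\<in>weight_grid p. u i \<noteq> 0 \<longrightarrow> fst i \<ge> Suc n \<and> snd i = p"
        using u(3) by (force simp: Suc_le_eq order.strict_iff_order)
      with u show ?thesis by blast
    next
      case False
      let ?E = "(\<chi> i j. if i = 1 \<and> j = 2 then 1 else 0) :: hc"
      have E: "?E $ 1 $ 1 = 0" "?E $ 2 $ 1 = 0" "?E $ 1 $ 2 = 1" by simp_all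
      define w where "w j = (\<Sum>i\<in>weight_grid p. u i * weight_matrix p 0 ?E i j)" for j
      have X: "(0, ?E) \<in> sl2sl2" by (simp add: sl2sl2_def Re_hc_def trace_def sum_2)
      have "act X (grid_sum p v u) \<in> W" if "X \<in> sl2sl2" for X
        using W u(1) that unfolding submodule_def by blast
      from this[OF X] have "grid_sum p v w \<in> W"
        unfolding w_def[abs_def] act_grid_sum[OF X] .
      moreover have w: "w (a, b) = (if a = 0 then 0 else of_nat (p - (a - 1)) * u (a - 1, b))"
        if "a \<le> p" "b \<le> p" for a b
      proof -
        have m: "weight_matrix p 0 ?E i j = (if j = (Suc (fst i), snd i) then of_nat (p - fst i) else 0)" for i j
          by (simp only: weight_matrix_def case_prod_unfold E zero_index mult_zero_right mult_1_right
              if_cancel add_0_left add_0_right Suc_eq_plus1)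
        have "w (a, b) = (\<Sum>i\<in>weight_grid p. if a \<noteq> 0 \<and> i = (a - 1, b) then of_nat (p - fst i) * u i else 0)"
          unfolding w_def m by (intro sum.cong) auto
        also have "\<dots> = (if a = 0 then 0 else of_nat (p - (a - 1)) * u (a - 1, b))"
          using that by (cases "a = 0") (simp_all add: sum.delta le_diff_conv)
        finally show ?thesis .
      qed
      moreover have "w (Suc n, p) \<noteq> 0" using w[OF Suc.prems] False Suc.prems by simp
      moreover have "fst i \<ge> Suc n \<and> snd i = p" if i: "i \<in> weight_grid p" "w i \<noteq> 0" for i
      proof -
        obtain a b where ab: "i = (a, b)" by (cases i)
        then have "a \<noteq> 0" "u (a - 1, b) \<noteq> 0" using i w[of a b] by (auto split: if_splits)
        then show ?thesis using u(3)[rule_format, of "(a - 1, b)"] i ab by (cases a) auto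
      qed
      ultimately show ?thesis using Suc.prems by (intro exI[of _ w] conjI bexI[of _ "(Suc n, p)"]) auto
    qed
  qed
  from this[of p] show ?thesis by (auto simp: order_antisym_conv)
qed

text \<open>The matrix units in position \<open>(2, 1)\<close> of the two factors lower the indices one at a time with nonzero coefficients.\<close>

lemma submodule_contains_basis:
  assumes W: "submodule act W" and top: "v (p, p) \<in> W" and ab: "a \<le> p" "b \<le> p"
  shows "v (a, b) \<in> W"
proof -
  let ?F = "(\<chi> i j. if i = 2 \<and> j = 1 then 1 else 0) :: hc"
  have X: "(?F, 0) \<in> sl2sl2" "(0, ?F) \<in> sl2sl2" by (simp_all add: sl2sl2_def Re_hc_def trace_def sum_2)
  have wa: "weight_action p ?F 0 v (a, b) = fscale (of_nat b) (v (a, b - 1))"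
    "weight_action p 0 ?F v (a, b) = fscale (of_nat a) (v (a - 1, b))" for a b
    by (simp_all add: weight_action_def)
  have unscale: "x \<in> W" if "fscale r x \<in> W" "r \<noteq> 0" for r x
  proof -
    have "fscale (inverse r) (fscale r x) \<in> W"
      using W that(1) unfolding submodule_def by (blast intro: fvs.subspace_scale)
    then show ?thesis using that(2) by simp
  qed
  have *: "v (p, p - n) \<in> W" for n
  proof (induction n)
    case (Suc n)
    show ?case
    proof (cases "n < p")
      case True
      have "act (?F, 0) (v (p, p - n)) \<in> W" using W X(1) Suc unfolding submodule_def by blast
      then have "fscale (of_nat (p - n)) (v (p, p - Suc n)) \<in> W"
        by (simp add: act_basis[OF X(1)] wa del: of_nat_diff)
      then show ?thesis by (rule unscale) (use True in simp)
    qed (use Suc in simp)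
  qed (simp add: top)
  have "v (p - n, b) \<in> W" for n
  proof (induction n)
    case 0
    show ?case using *[of "p - b"] ab by simp
  next
    case (Suc n)
    show ?case
    proof (cases "n < p")
      case True
      have "act (0, ?F) (v (p - n, b)) \<in> W" using W X(2) Suc unfolding submodule_def by blast
      then have "fscale (of_nat (p - n)) (v (p - Suc n, b)) \<in> W"
        using ab by (simp add: act_basis[OF X(2)] wa del: of_nat_diff)
      then show ?thesis by (rule unscale) (use True in simp)
    qed (use Suc in simp)
  qed
  from this[of "p - a"] show ?thesis using ab by simp
qed

text \<open>A nonzero submodule contains the highest vector by raising and then all vectors by lowering.\<close>

lemma irreducible: "irreducible_module act (fvs.span (v ` weight_grid p))"
  unfolding irreducible_module_def
proof (intro conjI allI impI submodule)
  have "v (0, 0) \<noteq> 0"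
  proof
    assume "v (0, 0) = 0"
    then have "grid_sum p v (\<lambda>j. if j = (0, 0) then 1 else 0) = 0"
      by (subst grid_sum_single[of "(0, 0)"]) auto
    from independent[OF this, of "(0, 0)"] show False by simp
  qed
  then show "fvs.span (v ` weight_grid p) \<noteq> {0}"
    using fvs.span_base[of "v (0, 0)" "v ` weight_grid p"] by force
next
  fix W assume "W \<subseteq> fvs.span (v ` weight_grid p) \<and> submodule act W"
  then have sub: "W \<subseteq> fvs.span (v ` weight_grid p)" and W: "submodule act W" by auto
  show "W = {0} \<or> W = fvs.span (v ` weight_grid p)"
  proof (cases "W = {0}")
    case False
    have "0 \<in> W" using W unfolding submodule_def by (blast intro: fvs.subspace_0)
    with False obtain x where x: "x \<in> W" "x \<noteq> 0" by blast
    then obtain u where u: "x = grid_sum p v u" using sub unfolding span_grid by blast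
    have "\<exists>i\<in>weight_grid p. u i \<noteq> 0"
    proof (rule ccontr)
      assume "\<not> ?thesis"
      then have "grid_sum p v u = 0" unfolding grid_sum_def by (intro sum.neutral) auto
      with x u show False by simp
    qed
    from raise_right[OF W x(1)[unfolded u] this] obtain w where w: "grid_sum p v w \<in> W"
      "\<exists>i\<in>weight_grid p. w i \<noteq> 0" "\<forall>i\<in>weight_grid p. w i \<noteq> 0 \<longrightarrow> snd i = p" by blast
    from raise_left[OF W w] obtain t where t: "grid_sum p v t \<in> W"
      "\<exists>i\<in>weight_grid p. t i \<noteq> 0" "\<forall>i\<in>weight_grid p. t i \<noteq> 0 \<longrightarrow> i = (p, p)" by blast
    have "grid_sum p v t = fscale (t (p, p)) (v (p, p))"
      using t(3) by (intro grid_sum_single) auto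
    moreover have "t (p, p) \<noteq> 0" using t(2,3) by metis
    moreover have "fscale (inverse (t (p, p))) (grid_sum p v t) \<in> W"
      using W t(1) unfolding submodule_def by (blast intro: fvs.subspace_scale)
    ultimately have "v (p, p) \<in> W" by simp
    then have "v ` weight_grid p \<subseteq> W" using submodule_contains_basis[OF W] by auto
    then have "fvs.span (v ` weight_grid p) \<subseteq> W"
      using W unfolding submodule_def by (intro fvs.span_minimal) auto
    with sub show ?thesis by blast
  qed simp
qed

end

text \<open>Corresponding combinations of the two families are identified; the matrices of the action agree.\<close>

lemma weight_module_iso:
  assumes "weight_module act p v" "weight_module act' p v'"
  shows "module_iso act (fvs.span (v ` weight_grid p)) act' (fvs.span (v' ` weight_grid p))"
proof -
  interpret V: weight_module act p v by fact
  interpret V': weight_module act' p v' by fact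
  define T where "T x = grid_sum p v' (SOME u. x = grid_sum p v u)" for x
  have T: "T (grid_sum p v u) = grid_sum p v' u" for u
  proof -
    have "grid_sum p v u = grid_sum p v (SOME w. grid_sum p v u = grid_sum p v w)"
      by (rule someI[of "\<lambda>w. grid_sum p v u = grid_sum p v w" u]) simp
    then show ?thesis
      unfolding T_def by (intro grid_sum_cong) (metis V.grid_sum_eqD)
  qed
  show ?thesis
    unfolding module_iso_def
  proof (intro conjI exI[of _ T] V.submodule V'.submodule)
    show "bij_betw T (fvs.span (v ` weight_grid p)) (fvs.span (v' ` weight_grid p))"
      unfolding span_grid
    proof (rule bij_betw_imageI)
      show "inj_on T (range (grid_sum p v))"
      proof (rule inj_onI, safe)
        fix u w assume "T (grid_sum p v u) = T (grid_sum p v w)"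
        then show "grid_sum p v u = grid_sum p v w"
          unfolding T by (intro grid_sum_cong) (rule V'.grid_sum_eqD)
      qed
      show "T ` range (grid_sum p v) = range (grid_sum p v')"
        by (auto simp: T image_iff)
    qed
    show "\<forall>f\<in>fvs.span (v ` weight_grid p). \<forall>g\<in>fvs.span (v ` weight_grid p). T (f + g) = T f + T g"
      unfolding span_grid by (auto simp: T grid_sum_add[symmetric])
    show "\<forall>c. \<forall>f\<in>fvs.span (v ` weight_grid p). T (fscale c f) = fscale c (T f)"
      unfolding span_grid by (auto simp: T grid_sum_scale[symmetric])
    show "\<forall>X\<in>sl2sl2. \<forall>f\<in>fvs.span (v ` weight_grid p). T (act X f) = act' X (T f)"
      unfolding span_grid by (auto simp: T V.act_grid_sum V'.act_grid_sum)
  qed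
qed


section \<open>Tensor products of symmetric powers\<close>

definition tensor_monomial :: "nat \<Rightarrow> nat \<times> nat \<Rightarrow> c2 \<times> c2 \<Rightarrow> complex"
  where "tensor_monomial p = (\<lambda>(a, b) (\<xi>, \<eta>).
    ((\<xi> $ 1) ^ b * (\<xi> $ 2) ^ (p - b)) * ((\<eta> $ 1) ^ a * (\<eta> $ 2) ^ (p - a)))"

lemma tensor_monomial_span:
  "sym_power p \<boxtimes> sym_power p = fvs.span (tensor_monomial p ` weight_grid p)"
proof
  let ?S = "fvs.span (tensor_monomial p ` weight_grid p)"
  let ?M = "{(\<lambda>\<xi>::c2. (\<xi> $ 1) ^ i * (\<xi> $ 2) ^ j) |i j. i + j = p}"
  have base: "(\<lambda>(\<xi>, \<eta>). f \<xi> * g \<eta>) \<in> ?S" if fg: "f \<in> ?M" "g \<in> ?M" for f g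
  proof -
    obtain i i' where i: "i + i' = p" "f = (\<lambda>\<xi>. (\<xi> $ 1) ^ i * (\<xi> $ 2) ^ i')" using fg(1) by auto
    obtain j j' where j: "j + j' = p" "g = (\<lambda>\<xi>. (\<xi> $ 1) ^ j * (\<xi> $ 2) ^ j')" using fg(2) by auto
    have "p - i = i'" "p - j = j'" "i \<le> p" "j \<le> p" using i(1) j(1) by auto
    moreover from this have "(\<lambda>(\<xi>, \<eta>). f \<xi> * g \<eta>) = tensor_monomial p (j, i)"
      by (simp add: i(2) j(2) tensor_monomial_def)
    ultimately show ?thesis by (simp add: fvs.span_base)
  qed
  have left: "(\<lambda>(\<xi>, \<eta>). f \<xi> * g \<eta>) \<in> ?S" if "f \<in> fvs.span ?M" "g \<in> ?M" for f g
    using that(1)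
  proof (induction rule: fvs.span_induct)
    case base
    have e: "(\<lambda>(\<xi>, \<eta>). (f + h) \<xi> * g \<eta>) = (\<lambda>(\<xi>, \<eta>). f \<xi> * g \<eta>) + (\<lambda>(\<xi>, \<eta>). h \<xi> * g \<eta>)"
      "(\<lambda>(\<xi>, \<eta>). fscale r f \<xi> * g \<eta>) = fscale r (\<lambda>(\<xi>, \<eta>). f \<xi> * g \<eta>)"
      "(\<lambda>(\<xi>, \<eta>). 0 \<xi> * g \<eta>) = 0" for r f h
      by (auto simp: fun_eq_iff fscale_def algebra_simps)
    show ?case
      unfolding fvs.subspace_def mem_Collect_eq e by (auto intro: fvs.span_zero fvs.span_add fvs.span_scale)
  qed (rule base[OF _ that(2)])
  have right: "(\<lambda>(\<xi>, \<eta>). f \<xi> * g \<eta>) \<in> ?S" if "f \<in> fvs.span ?M" "g \<in> fvs.span ?M" for f g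
    using that(2)
  proof (induction rule: fvs.span_induct)
    case base
    have e: "(\<lambda>(\<xi>, \<eta>). f \<xi> * (g + h) \<eta>) = (\<lambda>(\<xi>, \<eta>). f \<xi> * g \<eta>) + (\<lambda>(\<xi>, \<eta>). f \<xi> * h \<eta>)"
      "(\<lambda>(\<xi>, \<eta>). f \<xi> * fscale r g \<eta>) = fscale r (\<lambda>(\<xi>, \<eta>). f \<xi> * g \<eta>)"
      "(\<lambda>(\<xi>, \<eta>). f \<xi> * 0 \<eta>) = 0" for r g h
      by (auto simp: fun_eq_iff fscale_def algebra_simps)
    show ?case
      unfolding fvs.subspace_def mem_Collect_eq e by (auto intro: fvs.span_zero fvs.span_add fvs.span_scale)
  qed (rule left[OF that(1)])
  show "sym_power p \<boxtimes> sym_power p \<subseteq> ?S"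
    unfolding ext_tensor_def sym_power_def
    by (intro fvs.span_minimal) (use right in auto)
  show "?S \<subseteq> sym_power p \<boxtimes> sym_power p"
  proof (unfold ext_tensor_def, intro fvs.span_mono subsetI)
    fix f assume "f \<in> tensor_monomial p ` weight_grid p"
    then obtain a b where ab: "a \<le> p" "b \<le> p" "f = tensor_monomial p (a, b)" by auto
    have m: "(\<lambda>\<xi>. (\<xi> $ 1) ^ c * (\<xi> $ 2) ^ (p - c)) \<in> sym_power p" if "c \<le> p" for c
    proof -
      have "c + (p - c) = p" using that by simp
      then show ?thesis unfolding sym_power_def by - (rule fvs.span_base, blast)
    qed
    show "f \<in> {(\<lambda>(\<xi>, \<eta>). q \<xi> * r \<eta>) |q r. q \<in> sym_power p \<and> r \<in> sym_power p}"
    proof (intro CollectI exI conjI)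
      show "f = (\<lambda>(\<xi>, \<eta>). (\<xi> $ 1 ^ b * \<xi> $ 2 ^ (p - b)) * (\<eta> $ 1 ^ a * \<eta> $ 2 ^ (p - a)))"
        by (simp add: ab(3) tensor_monomial_def)
    qed (rule m ab)+
  qed
qed

lemma sum_fun_apply: "(\<Sum>i\<in>I. fscale (u i) (f i)) x = (\<Sum>i\<in>I. u i * f i x)"
  by (induction I rule: infinite_finite_induct) (auto simp: fscale_def)

lemma grid_sum_apply: "grid_sum p v u x = (\<Sum>i\<in>weight_grid p. u i * v i x)"
  by (simp add: grid_sum_def sum_fun_apply)

text \<open>The second index is the exponent \<open>b\<close> of the first variable. The truncated exponents \<open>b - 1\<close> and
  \<open>p - (b + 1)\<close> occur only with the coefficients \<open>b\<close> and \<open>p - b\<close>, which vanish when the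
  truncation takes effect.\<close>

lemma binary_monomial_deriv:
  assumes x: "(x has_field_derivative x0 * A $ 1 $ 1 + y0 * A $ 2 $ 1) (at 0)" "x 0 = x0"
    and y: "(y has_field_derivative x0 * A $ 1 $ 2 + y0 * A $ 2 $ 2) (at 0)" "y 0 = (y0::complex)"
    and tr: "A $ 2 $ 2 = - (A $ 1 $ 1 :: complex)" and b: "b \<le> p"
  shows "((\<lambda>t. x t ^ b * y t ^ (p - b)) has_field_derivative
    (2 * of_nat b - of_nat p) * A $ 1 $ 1 * (x0 ^ b * y0 ^ (p - b)) +
    of_nat b * A $ 2 $ 1 * (x0 ^ (b - 1) * y0 ^ (p - (b - 1))) +
    of_nat (p - b) * A $ 1 $ 2 * (x0 ^ (b + 1) * y0 ^ (p - (b + 1)))) (at 0)"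
proof -
  obtain c where p: "p = b + c" using b le_Suc_ex by blast
  have 1: "of_nat b * (x0 ^ (b - 1) * x0) = of_nat b * x0 ^ b"
    "of_nat b * (x0 ^ (b - 1) * y0 ^ (p - (b - 1))) = of_nat b * (x0 ^ (b - 1) * (y0 ^ c * y0))"
    by (cases b; simp add: p mult.commute)+
  have 2: "of_nat c * (y0 ^ (c - 1) * y0) = of_nat c * y0 ^ c"
    "of_nat (p - b) * (x0 ^ (b + 1) * y0 ^ (p - (b + 1))) = of_nat c * (x0 ^ b * x0 * y0 ^ (c - 1))"
    by (cases c; simp add: p mult.commute)+
  have "((\<lambda>t. x t ^ b * y t ^ c) has_field_derivative
      (of_nat b * x0 ^ (b - 1) * (x0 * A $ 1 $ 1 + y0 * A $ 2 $ 1)) * y0 ^ c +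
      x0 ^ b * (of_nat c * y0 ^ (c - 1) * (x0 * A $ 1 $ 2 + y0 * A $ 2 $ 2))) (at 0)"
    using x y by (auto intro!: derivative_eq_intros)
  also have "(of_nat b * x0 ^ (b - 1) * (x0 * A $ 1 $ 1 + y0 * A $ 2 $ 1)) * y0 ^ c +
      x0 ^ b * (of_nat c * y0 ^ (c - 1) * (x0 * A $ 1 $ 2 + y0 * A $ 2 $ 2)) =
      (of_nat b * (x0 ^ (b - 1) * x0)) * y0 ^ c * A $ 1 $ 1 +
      A $ 2 $ 1 * (of_nat b * (x0 ^ (b - 1) * (y0 ^ c * y0))) +
      A $ 1 $ 2 * (of_nat c * (x0 ^ b * x0 * y0 ^ (c - 1))) -
      (of_nat c * (y0 ^ (c - 1) * y0)) * x0 ^ b * A $ 1 $ 1"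
    by (simp add: tr algebra_simps)
  also have "\<dots> = (2 * of_nat b - of_nat p) * A $ 1 $ 1 * (x0 ^ b * y0 ^ (p - b)) +
    of_nat b * A $ 2 $ 1 * (x0 ^ (b - 1) * y0 ^ (p - (b - 1))) +
    of_nat (p - b) * A $ 1 $ 2 * (x0 ^ (b + 1) * y0 ^ (p - (b + 1)))"
    unfolding 1(1) 1(2)[symmetric] 2(1) 2(2)[symmetric] by (simp add: p algebra_simps)
  finally show ?thesis by (simp add: p)
qed

lemma row_mat_exp_deriv:
  fixes \<xi> :: c2
  shows "((\<lambda>t. (\<xi> v* mat_exp (cscale t A)) $ 1) has_field_derivative \<xi> $ 1 * A $ 1 $ 1 + \<xi> $ 2 * A $ 2 $ 1) (at 0)"
    "((\<lambda>t. (\<xi> v* mat_exp (cscale t A)) $ 2) has_field_derivative \<xi> $ 1 * A $ 1 $ 2 + \<xi> $ 2 * A $ 2 $ 2) (at 0)"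
proof -
  have e: "(\<xi> v* M) $ j = \<xi> $ 1 * M $ 1 $ j + \<xi> $ 2 * M $ 2 $ j" for M :: hc and j
    by (simp add: vector_matrix_mult_def sum_2 mult.commute)
  show "((\<lambda>t. (\<xi> v* mat_exp (cscale t A)) $ 1) has_field_derivative \<xi> $ 1 * A $ 1 $ 1 + \<xi> $ 2 * A $ 2 $ 1) (at 0)"
    "((\<lambda>t. (\<xi> v* mat_exp (cscale t A)) $ 2) has_field_derivative \<xi> $ 1 * A $ 1 $ 2 + \<xi> $ 2 * A $ 2 $ 2) (at 0)"
    unfolding e by (intro DERIV_add DERIV_cmult curve_deriv_mat_exp)+
qed

lemma tensor_monomial_deriv:
  assumes X: "(A, D) \<in> sl2sl2" and i: "i \<in> weight_grid p"
  shows "((\<lambda>t. tensor_monomial p i (\<xi> v* mat_exp (cscale t A), \<eta> v* mat_exp (cscale t D)))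
    has_field_derivative weight_action p A D (tensor_monomial p) i (\<xi>, \<eta>)) (at 0)"
proof -
  obtain a b where i: "i = (a, b)" "a \<le> p" "b \<le> p" using i by (cases i) auto
  have tr: "A $ 2 $ 2 = - (A $ 1 $ 1)" "D $ 2 $ 2 = - (D $ 1 $ 1)"
    using X by (auto simp: sl2sl2_def Re_hc_def trace_def sum_2 eq_neg_iff_add_eq_0 add.commute)
  have 0: "\<xi> v* mat_exp (cscale 0 A) = \<xi>" for \<xi> :: c2 and A
    by (simp add: mat_exp_0)
  have dA: "((\<lambda>t. (\<xi> v* mat_exp (cscale t A)) $ 1 ^ b * (\<xi> v* mat_exp (cscale t A)) $ 2 ^ (p - b))
    has_field_derivative
    (2 * of_nat b - of_nat p) * A $ 1 $ 1 * (\<xi> $ 1 ^ b * \<xi> $ 2 ^ (p - b)) +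
    of_nat b * A $ 2 $ 1 * (\<xi> $ 1 ^ (b - 1) * \<xi> $ 2 ^ (p - (b - 1))) +
    of_nat (p - b) * A $ 1 $ 2 * (\<xi> $ 1 ^ (b + 1) * \<xi> $ 2 ^ (p - (b + 1)))) (at 0)"
    if "A $ 2 $ 2 = - (A $ 1 $ 1)" "b \<le> p" for A :: hc and \<xi> :: c2 and b
    by (rule binary_monomial_deriv[OF row_mat_exp_deriv(1) _ row_mat_exp_deriv(2)])
      (use that in \<open>simp_all add: 0\<close>)
  show ?thesis
    unfolding i tensor_monomial_def prod.case
    by (rule DERIV_cong[OF DERIV_mult[OF dA[OF tr(1) i(3)] dA[OF tr(2) i(2)]]])
      (simp add: 0 weight_action_def fscale_def algebra_simps)
qed

text \<open>Independence is that of the matrix coefficients on matrices of rank one, where they are multiples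
  of these monomials at \<open>\<xi> = (x, 1)\<close> and \<open>\<eta> = (y1, y2)\<close>.\<close>

lemma weight_module_tensor: "weight_module act_tensor p (tensor_monomial p)"
proof
  fix A D u assume X: "(A, D) \<in> sl2sl2"
  show "act_tensor (A, D) (grid_sum p (tensor_monomial p) u) =
      grid_sum p (weight_action p A D (tensor_monomial p)) u"
  proof (rule ext, clarify)
    fix \<xi> \<eta> :: c2
    show "act_tensor (A, D) (grid_sum p (tensor_monomial p) u) (\<xi>, \<eta>) =
        grid_sum p (weight_action p A D (tensor_monomial p)) u (\<xi>, \<eta>)"
      unfolding act_tensor_def prod.case grid_sum_apply
      by (intro DERIV_imp_deriv DERIV_sum DERIV_cmult tensor_monomial_deriv[OF X])
  qed
next
  fix u i assume zero: "grid_sum p (tensor_monomial p) u = 0" and i: "i \<in> weight_grid p"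
  obtain a0 b0 where i0: "i = (a0, b0)" "a0 \<le> p" "b0 \<le> p" using i by (cases i) auto
  let ?f = "\<lambda>(a, b). (a, p - a, b)"
  define w where "w = (\<lambda>(a, c :: nat, b). u (a, b) / of_nat (p choose b) :: complex)"
  have "w (a0, p - a0, b0) = 0"
  proof (rule mcoef_rank_one_independent[of "?f ` weight_grid p" w])
    fix x y1 y2 :: complex
    have inj: "inj_on ?f (weight_grid p)" by (auto intro: inj_onI)
    have "(\<Sum>(a, c, b)\<in>?f ` weight_grid p. w (a, c, b) * mcoef a c b (rank_one x y1 y2)) =
        (\<Sum>(a, b)\<in>weight_grid p. w (a, p - a, b) * mcoef a (p - a) b (rank_one x y1 y2))"
      by (subst sum.reindex[OF inj]) (simp add: case_prod_unfold)
    also have "\<dots> = grid_sum p (tensor_monomial p) u (vector [x, 1], vector [y1, y2])"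
      unfolding grid_sum_apply
      by (intro sum.cong) (auto simp: w_def tensor_monomial_def mcoef_rank_one)
    also have "\<dots> = 0" by (simp add: zero)
    finally show "(\<Sum>(a, c, b)\<in>?f ` weight_grid p. w (a, c, b) * mcoef a c b (rank_one x y1 y2)) = 0" .
  qed (use i0 in auto)
  then show "u i = 0" using i0 by (simp add: w_def)
qed


section \<open>The action on the functions \<open>N\<^sup>k t\<close>\<close>

text \<open>The generating polynomial is a function of the row \<open>(s, 1) Z\<close>. The part \<open>Z D\<close> of the vector field
  acts on this row from the right. The part \<open>A Z\<close> replaces \<open>(s, 1)\<close> by \<open>(s, 1) A\<close>, which is a multiple
  of \<open>(s, 1)\<close> plus a multiple of its derivative \<open>(1, 0)\<close>; so it acts by Euler's identity and by
  differentiation with respect to \<open>s\<close>.\<close>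

lemma gen_poly_action:
  fixes A D Z :: hc
  defines "V \<equiv> Z ** D - A ** Z"
  shows "(\<Sum>i\<in>UNIV. \<Sum>j\<in>UNIV. smult (V $ i $ j) (gen_poly_grad a c i j Z)) =
    - (smult (of_nat (a + c)) ([:A $ 2 $ 2, A $ 1 $ 2:] * gen_poly a c Z)
       + [:A $ 2 $ 1, A $ 1 $ 1 - A $ 2 $ 2, - (A $ 1 $ 2):] * pderiv (gen_poly a c Z))
    + smult (of_nat a * D $ 1 $ 1) (gen_poly a c Z)
    + smult (of_nat a * D $ 2 $ 1) (gen_poly (a - 1) (c + 1) Z)
    + smult (of_nat c * D $ 1 $ 2) (gen_poly (a + 1) (c - 1) Z)
    + smult (of_nat c * D $ 2 $ 2) (gen_poly a c Z)"
proof (rule poly_ext)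
  fix s :: complex
  define l1 l2 where "l1 = Z $ 2 $ 1 + s * Z $ 1 $ 1" and "l2 = Z $ 2 $ 2 + s * Z $ 1 $ 2"
  have F: "poly (gen_poly a c Z) s = l1 ^ a * l2 ^ c" for a c
    by (simp add: gen_poly_def l1_def l2_def)
  define G1 G2 where "G1 = of_nat a * (l1 ^ (a - 1) * l2 ^ c)" and "G2 = of_nat c * (l1 ^ a * l2 ^ (c - 1))"
  have pd: "poly (pderiv (gen_poly a c Z)) s = Z $ 1 $ 1 * G1 + Z $ 1 $ 2 * G2"
    by (simp add: gen_poly_def pderiv_mult pderiv_power pderiv_pCons G1_def G2_def l1_def l2_def algebra_simps)
  have a: "of_nat a * (l1 ^ a * l2 ^ c) = l1 * G1"
    "of_nat a * (l1 ^ (a - 1) * l2 ^ (c + 1)) = l2 * G1"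
    by (cases a; simp add: G1_def mult_ac)+
  have c: "of_nat c * (l1 ^ a * l2 ^ c) = l2 * G2"
    "of_nat c * (l1 ^ (a + 1) * l2 ^ (c - 1)) = l1 * G2"
    by (cases c; simp add: G2_def mult_ac)+
  have g: "poly (gen_poly_grad a c i j Z) s = (if i = 1 then s else 1) * (if j = 1 then G1 else G2)" for i j
    by (simp add: gen_poly_grad_def F G1_def G2_def)
  have V: "V $ 1 $ 1 = Z $ 1 $ 1 * D $ 1 $ 1 + Z $ 1 $ 2 * D $ 2 $ 1 - (A $ 1 $ 1 * Z $ 1 $ 1 + A $ 1 $ 2 * Z $ 2 $ 1)"
    "V $ 1 $ 2 = Z $ 1 $ 1 * D $ 1 $ 2 + Z $ 1 $ 2 * D $ 2 $ 2 - (A $ 1 $ 1 * Z $ 1 $ 2 + A $ 1 $ 2 * Z $ 2 $ 2)"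
    "V $ 2 $ 1 = Z $ 2 $ 1 * D $ 1 $ 1 + Z $ 2 $ 2 * D $ 2 $ 1 - (A $ 2 $ 1 * Z $ 1 $ 1 + A $ 2 $ 2 * Z $ 2 $ 1)"
    "V $ 2 $ 2 = Z $ 2 $ 1 * D $ 1 $ 2 + Z $ 2 $ 2 * D $ 2 $ 2 - (A $ 2 $ 1 * Z $ 1 $ 2 + A $ 2 $ 2 * Z $ 2 $ 2)"
    by (simp_all add: V_def matrix_matrix_mult_def sum_2)
  have "poly (\<Sum>i\<in>UNIV. \<Sum>j\<in>UNIV. smult (V $ i $ j) (gen_poly_grad a c i j Z)) s =
      V $ 1 $ 1 * (s * G1) + V $ 1 $ 2 * (s * G2) + V $ 2 $ 1 * G1 + V $ 2 $ 2 * G2"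
    by (simp add: sum_2 g)
  also have "\<dots> = - ((A $ 2 $ 2 + s * A $ 1 $ 2) * (l1 * G1 + l2 * G2)
       + (A $ 2 $ 1 + s * (A $ 1 $ 1 - A $ 2 $ 2 - s * A $ 1 $ 2)) * (Z $ 1 $ 1 * G1 + Z $ 1 $ 2 * G2))
    + D $ 1 $ 1 * (l1 * G1) + D $ 2 $ 1 * (l2 * G1) + D $ 1 $ 2 * (l1 * G2) + D $ 2 $ 2 * (l2 * G2)"
    unfolding V l1_def l2_def by (simp add: algebra_simps)
  also have "\<dots> = poly (- (smult (of_nat (a + c)) ([:A $ 2 $ 2, A $ 1 $ 2:] * gen_poly a c Z)
       + [:A $ 2 $ 1, A $ 1 $ 1 - A $ 2 $ 2, - (A $ 1 $ 2):] * pderiv (gen_poly a c Z))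
    + smult (of_nat a * D $ 1 $ 1) (gen_poly a c Z)
    + smult (of_nat a * D $ 2 $ 1) (gen_poly (a - 1) (c + 1) Z)
    + smult (of_nat c * D $ 1 $ 2) (gen_poly (a + 1) (c - 1) Z)
    + smult (of_nat c * D $ 2 $ 2) (gen_poly a c Z)) s"
    unfolding a[symmetric] c[symmetric] pd[symmetric]
    by (simp add: F algebra_simps)
  finally show "poly (\<Sum>i\<in>UNIV. \<Sum>j\<in>UNIV. smult (V $ i $ j) (gen_poly_grad a c i j Z)) s = \<dots>" .
qed

text \<open>Since the traces of \<open>A\<close> and \<open>D\<close> vanish, \<open>N\<close> is invariant and the factor \<open>N\<^sup>k\<close> is inert. The rest
  compares the coefficients of \<open>s\<^sup>b\<close> in \<open>gen_poly_action\<close>.\<close>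

lemma act_BH_basis_fun:
  assumes X: "(A, D) \<in> sl2sl2"
  shows "act_BH (A, D) (basis_fun k a c b) =
    fscale ((of_nat a - of_nat c) * D $ 1 $ 1 + (of_nat (a + c) - 2 * of_nat b) * A $ 1 $ 1) (basis_fun k a c b) -
    fscale (if b = 0 then 0 else (of_nat (a + c) + 1 - of_nat b) * A $ 1 $ 2) (basis_fun k a c (b - 1)) -
    fscale (of_nat (b + 1) * A $ 2 $ 1) (basis_fun k a c (b + 1)) +
    fscale (of_nat a * D $ 2 $ 1) (basis_fun k (a - 1) (c + 1) b) +
    fscale (of_nat c * D $ 1 $ 2) (basis_fun k (a + 1) (c - 1) b)"
proof -
  have tr: "A $ 2 $ 2 = - (A $ 1 $ 1)" "D $ 2 $ 2 = - (D $ 1 $ 1)"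
    using X by (auto simp: sl2sl2_def Re_hc_def trace_def sum_2 eq_neg_iff_add_eq_0 add.commute)
  let ?g = "\<lambda>i j Z. coeff (gen_poly_grad a c i j Z) b"
  have grad: "has_grad (mcoef a c b) ?g"
    using has_poly_grad_gen_poly[of a c] by (simp add: has_poly_grad_def mcoef_def[abs_def])
  have "pairing (Z ** D - A ** Z) (\<lambda>i j. of_int k * normN Z powi (k - 1) * cofactor i j Z * mcoef a c b Z +
        normN Z powi k * ?g i j Z) = normN Z powi k *
      (((of_nat a - of_nat c) * D $ 1 $ 1 + (of_nat (a + c) - 2 * of_nat b) * A $ 1 $ 1) * mcoef a c b Z -
        (if b = 0 then 0 else (of_nat (a + c) + 1 - of_nat b) * A $ 1 $ 2) * mcoef a c (b - 1) Z -
        of_nat (b + 1) * A $ 2 $ 1 * mcoef a c (b + 1) Z +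
        of_nat a * D $ 2 $ 1 * mcoef (a - 1) (c + 1) b Z +
        of_nat c * D $ 1 $ 2 * mcoef (a + 1) (c - 1) b Z)" for Z
  proof -
    \<comment> \<open>The vector field annihilates \<open>N\<close>: the derivative is \<open>(tr D - tr A) N\<close>.\<close>
    have N: "pairing (Z ** D - A ** Z) (\<lambda>i j. cofactor i j Z) = 0"
      by (simp add: pairing_2 cofactor_def matrix_matrix_mult_def sum_2 tr algebra_simps)
    have lin: "pairing V (\<lambda>i j. x * C i j * m + y * G i j) = x * m * pairing V C + y * pairing V G"
      for V x y m and C G :: "2 \<Rightarrow> 2 \<Rightarrow> complex"
      by (simp add: pairing_2 algebra_simps)
    have "pairing (Z ** D - A ** Z) (\<lambda>i j. ?g i j Z) =
        coeff (\<Sum>i\<in>UNIV. \<Sum>j\<in>UNIV. smult ((Z ** D - A ** Z) $ i $ j) (gen_poly_grad a c i j Z)) b"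
      by (simp add: pairing_def coeff_sum)
    also have "\<dots> = ((of_nat a - of_nat c) * D $ 1 $ 1 + (of_nat (a + c) - 2 * of_nat b) * A $ 1 $ 1) * mcoef a c b Z -
        (if b = 0 then 0 else (of_nat (a + c) + 1 - of_nat b) * A $ 1 $ 2) * mcoef a c (b - 1) Z -
        of_nat (b + 1) * A $ 2 $ 1 * mcoef a c (b + 1) Z +
        of_nat a * D $ 2 $ 1 * mcoef (a - 1) (c + 1) b Z +
        of_nat c * D $ 1 $ 2 * mcoef (a + 1) (c - 1) b Z"
    proof (cases b)
      case 0
      then show ?thesis
        unfolding gen_poly_action
        by (simp add: coeff_pderiv mcoef_def tr algebra_simps)
    next
      case (Suc m)
      then show ?thesis
        unfolding gen_poly_action
        by (cases m) (simp_all add: coeff_pderiv mcoef_def tr algebra_simps)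
    qed
    finally show ?thesis unfolding lin N by simp
  qed
  then show ?thesis
    unfolding basis_fun_def[of k a c b]
      act_BH_eq[OF has_grad_on_inv[OF has_grad_mult[OF has_grad_normN_powi grad]]]
    by (intro ext) (simp add: basis_fun_def on_inv_def fscale_def algebra_simps)
qed

lemma pairing_sum:
  "pairing V (\<lambda>a b. \<Sum>i\<in>I. u i * g i a b) = (\<Sum>i\<in>I. u i * pairing V (g i))"
  by (simp add: pairing_2 sum.distrib sum_distrib_left algebra_simps)

lemma act_BH_sum:
  assumes fin: "finite I" and reg: "\<And>i. i \<in> I \<Longrightarrow> f i \<in> regular_fun"
  shows "act_BH (A, D) (\<Sum>i\<in>I. fscale (u i) (f i)) = (\<Sum>i\<in>I. fscale (u i) (act_BH (A, D) (f i)))"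
proof -
  have "\<forall>i\<in>I. \<exists>G. has_grad (f i) G" using regular_grad reg by blast
  then obtain G where G: "\<And>i. i \<in> I \<Longrightarrow> has_grad (f i) (G i)" by metis
  have e: "(\<Sum>i\<in>I. fscale (u i) (f i)) = (\<lambda>Z. \<Sum>i\<in>I. u i * f i Z)"
    by (rule ext) (rule sum_fun_apply)
  have "has_grad (\<Sum>i\<in>I. fscale (u i) (f i)) (\<lambda>a b Z. \<Sum>i\<in>I. u i * G i a b Z)"
    unfolding e using fin G by (intro has_grad_sum has_grad_scale)
  from act_BH_eq[OF this]
  have "act_BH (A, D) (\<Sum>i\<in>I. fscale (u i) (f i)) =
      on_inv (\<lambda>Z. pairing (Z ** D - A ** Z) (\<lambda>a b. \<Sum>i\<in>I. u i * G i a b Z))" .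
  also have "\<dots> = (\<Sum>i\<in>I. fscale (u i) (on_inv (\<lambda>Z. pairing (Z ** D - A ** Z) (\<lambda>a b. G i a b Z))))"
    by (rule ext) (simp add: sum_fun_apply on_inv_def pairing_sum)
  also have "\<dots> = (\<Sum>i\<in>I. fscale (u i) (act_BH (A, D) (f i)))"
    by (intro sum.cong refl) (simp add: act_BH_eq[OF G])
  finally show ?thesis .
qed

text \<open>On the matrix of rank one with column \<open>(\<xi>\<^sub>2, - \<xi>\<^sub>1)\<close> and row \<open>\<eta>\<close>, the rescaled matrix coefficient is
  exactly the monomial \<open>\<xi>\<^sub>1\<^sup>b \<xi>\<^sub>2\<^sup>p\<^sup>-\<^sup>b \<eta>\<^sub>1\<^sup>a \<eta>\<^sub>2\<^sup>p\<^sup>-\<^sup>a\<close>. The reflection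
  \<open>b \<mapsto> p - b\<close> and the alternating sign turn the contragredient action \<open>Z \<mapsto> exp (-tA) Z\<close> into the
  action of \<open>exp (tA)\<close> on rows \<open>\<xi>\<close>.\<close>

definition weight_vector :: "int \<Rightarrow> nat \<Rightarrow> nat \<times> nat \<Rightarrow> hc \<Rightarrow> complex"
  where "weight_vector k p = (\<lambda>(a, b).
    fscale ((-1) ^ b / of_nat (p choose b)) (basis_fun k a (p - a) (p - b)))"

lemma act_BH_scale:
  assumes "f \<in> regular_fun"
  shows "act_BH (A, D) (fscale r f) = fscale r (act_BH (A, D) f)"
  using act_BH_sum[of "{()}" "\<lambda>_. f" A D "\<lambda>_. r"] assms by simp

text \<open>This ratio moves the normalizing binomial coefficient to the neighbouring index.\<close>

lemma binomial_ratio_step: "Suc b * (p choose Suc b) = (p - b) * (p choose b)"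
  by (simp only: binomial_absorption binomial_absorb_comp)

lemma act_BH_weight_vector:
  assumes X: "(A, D) \<in> sl2sl2" and i: "i \<in> weight_grid p"
  shows "act_BH (A, D) (weight_vector k p i) = weight_action p A D (weight_vector k p) i"
proof -
  obtain a b where i: "i = (a, b)" "a \<le> p" "b \<le> p" using i by (cases i) auto
  let ?s = "(-1) ^ b / of_nat (p choose b) :: complex"
  have pa: "a + (p - a) = p" using i by simp
  have nz: "of_nat (p choose b) \<noteq> (0::complex)" using i by (simp add: binomial_eq_0_iff)
  have c0: "(of_nat a - of_nat (p - a)) * D $ 1 $ 1 + (of_nat p - 2 * of_nat (p - b)) * A $ 1 $ 1 =
      (2 * of_nat b - of_nat p) * A $ 1 $ 1 + (2 * of_nat a - of_nat p) * D $ 1 $ 1"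
    using i by (simp add: of_nat_diff algebra_simps)
  \<comment> \<open>Neighbouring vectors differ in their normalization by a sign and a ratio of binomial coefficients.\<close>
  have c1: "fscale ?s (fscale (if p - b = 0 then 0 else (of_nat p + 1 - of_nat (p - b)) * A $ 1 $ 2)
        (basis_fun k a (p - a) (p - b - 1))) =
      - fscale (of_nat (p - b) * A $ 1 $ 2) (weight_vector k p (a, b + 1))"
  proof (cases "b = p")
    case False
    then have lt: "b < p" using i by simp
    have "of_nat (Suc b) * of_nat (p choose Suc b) = (of_nat (p - b) * of_nat (p choose b) :: complex)"
      using binomial_ratio_step[of b p] by (metis of_nat_mult)
    moreover have "of_nat (p choose Suc b) \<noteq> (0::complex)" using lt by (simp add: binomial_eq_0_iff)
    ultimately have r: "of_nat (Suc b) / of_nat (p choose b) =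
        (of_nat (p - b) / of_nat (p choose Suc b) :: complex)"
      using nz by (simp add: frac_eq_eq mult.commute del: of_nat_Suc of_nat_diff)
    have "of_nat p + 1 - of_nat (p - b) = (of_nat (Suc b) :: complex)"
      using lt by (simp add: of_nat_diff)
    then have "?s * ((of_nat p + 1 - of_nat (p - b)) * A $ 1 $ 2) =
        (-1) ^ b * A $ 1 $ 2 * (of_nat (Suc b) / of_nat (p choose b))" by simp
    also have "\<dots> = - (of_nat (p - b) * A $ 1 $ 2 * ((-1) ^ (b + 1) / of_nat (p choose (b + 1))))"
      unfolding r by simp
    finally show ?thesis
      using lt by (simp add: weight_vector_def del: of_nat_diff)
  qed (simp add: fscale_def fun_eq_iff)
  have c2: "fscale ?s (fscale (of_nat (p - b + 1) * A $ 2 $ 1) (basis_fun k a (p - a) (p - b + 1))) =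
      - fscale (of_nat b * A $ 2 $ 1) (weight_vector k p (a, b - 1))"
  proof (cases b)
    case 0
    have "basis_fun k a (p - a) (p + 1) = 0"
      using i by (auto simp: basis_fun_def mcoef_eq_0 on_inv_def)
    then show ?thesis by (simp add: 0)
  next
    case (Suc m)
    have "of_nat b * of_nat (p choose b) = (of_nat (p - m) * of_nat (p choose m) :: complex)"
      using binomial_ratio_step[of m p] unfolding Suc by (metis of_nat_mult)
    moreover have "of_nat (p choose m) \<noteq> (0::complex)" using i Suc by (simp add: binomial_eq_0_iff)
    ultimately have r: "of_nat (p - m) / of_nat (p choose b) = (of_nat b / of_nat (p choose m) :: complex)"
      using nz by (simp add: frac_eq_eq mult.commute del: of_nat_diff)
    have pm: "p - b + 1 = p - m" using i Suc by simp
    have "?s * (of_nat (p - m) * A $ 2 $ 1) =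
        (-1) ^ b * A $ 2 $ 1 * (of_nat (p - m) / of_nat (p choose b))" by simp
    also have "\<dots> = - (of_nat b * A $ 2 $ 1 * ((-1) ^ m / of_nat (p choose m)))"
      unfolding r by (simp add: Suc)
    finally show ?thesis
      unfolding pm by (simp add: weight_vector_def Suc del: of_nat_diff of_nat_Suc)
  qed
  have c3: "fscale ?s (fscale (of_nat a * D $ 2 $ 1) (basis_fun k (a - 1) (p - a + 1) (p - b))) =
      fscale (of_nat a * D $ 2 $ 1) (weight_vector k p (a - 1, b))"
    using i by (cases a) (simp_all add: weight_vector_def mult.commute Suc_diff_Suc)
  have c4: "fscale ?s (fscale (of_nat (p - a) * D $ 1 $ 2) (basis_fun k (a + 1) (p - a - 1) (p - b))) =
      fscale (of_nat (p - a) * D $ 1 $ 2) (weight_vector k p (a + 1, b))"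
    by (simp add: weight_vector_def mult.commute)
  have "act_BH (A, D) (weight_vector k p (a, b)) =
      fscale ?s (act_BH (A, D) (basis_fun k a (p - a) (p - b)))"
    by (simp only: weight_vector_def prod.case act_BH_scale[OF regular_basis_fun])
  also have "\<dots> = weight_action p A D (weight_vector k p) (a, b)"
    unfolding act_BH_basis_fun[OF X] pa fvs.scale_right_distrib fvs.scale_right_diff_distrib c1 c2 c3 c4
      weight_action_def prod.case c0[symmetric]
    by (simp add: weight_vector_def mult.commute algebra_simps)
  finally show ?thesis unfolding i(1) .
qed


section \<open>Matrix coefficients of the inverse and contour integrals\<close>

text \<open>Both sides are the multinomial coefficient \<open>(i + q + r + s)! / (i! q! r! s!)\<close>, built from two
  different ways of grouping the four parts.\<close>

lemma binomial_multinomial_swap: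
  "((i + q + r + s) choose (i + q)) * ((i + q) choose i) * ((r + s) choose r) =
   ((i + q + r + s) choose (i + r)) * ((i + r) choose i) * ((q + s) choose q)"
proof -
  have "complex_of_nat (((i + q + r + s) choose (i + q)) * ((i + q) choose i) * ((r + s) choose r)) =
    of_nat (((i + q + r + s) choose (i + r)) * ((i + r) choose i) * ((q + s) choose q))"
    by (simp add: binomial_fact field_simps)
  then show ?thesis by (simp only: of_nat_eq_iff)
qed

lemma mcoef_explicit:
  "mcoef a c b Z = (\<Sum>i\<in>{i. i \<le> a \<and> i \<le> b \<and> b - i \<le> c}.
    of_nat ((a choose i) * (c choose (b - i))) *
    (Z $ 1 $ 1 ^ i * Z $ 2 $ 1 ^ (a - i) * Z $ 1 $ 2 ^ (b - i) * Z $ 2 $ 2 ^ (c - (b - i))))"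
proof -
  have l: "coeff ([:x, y:] ^ n) i = of_nat (n choose i) * y ^ i * x ^ (n - i)" for x y :: complex and n i
  proof (cases "i \<le> n")
    case False
    have "degree ([:x, y:] ^ n) \<le> n"
      using degree_power_le[of "[:x, y:]" n] by (auto split: if_splits)
    with False show ?thesis by (simp add: coeff_eq_0)
  qed (rule coeff_linear_poly_power)
  show ?thesis
    unfolding mcoef_def gen_poly_def coeff_mult l
    by (rule sum.mono_neutral_cong_right) auto
qed

text \<open>The matrix \<open>adj Z\<close> is the transpose of \<open>Z\<close>, conjugated by a signed permutation matrix. Transposition
  exchanges the two indices, the permutation reflects them, and the signs collect to \<open>(-1)\<^sup>a\<^sup>+\<^sup>b\<close>.
  In the explicit formula each term of one sum corresponds to one term of the other, and the
  coefficients agree by \<open>binomial_multinomial_swap\<close>.\<close>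

lemma mcoef_adj:
  assumes "a \<le> p" "b \<le> p"
  shows "of_nat (p choose a) * mcoef a (p - a) b (adj Z) =
    (-1) ^ (a + b) * of_nat (p choose b) * mcoef (p - b) b (p - a) Z"
  unfolding mcoef_explicit sum_distrib_left
proof (rule sum.reindex_bij_witness[of _ "\<lambda>j. b - (p - a - j)" "\<lambda>i. p - a - (b - i)"])
  fix i assume "i \<in> {i. i \<le> a \<and> i \<le> b \<and> b - i \<le> p - a}"
  then have i: "i \<le> a" "i \<le> b" "b - i \<le> p - a" by auto
  \<comment> \<open>The exponents of the four entries in one term of the expansion.\<close>
  define q r s where "q = a - i" "r = b - i" "s = p - a - (b - i)"
  have e: "a = i + q" "b = i + r" "p = i + q + r + s" using i assms by (auto simp: q_r_s_def)
  have e': "p - a = r + s" "p - b = q + s" "a - i = q" "b - i = r" "r + s - r = s" "q + s - s = q"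
    "b - r = i" "r + s - s = r"
    using e by auto
  show "p - a - (b - i) \<in> {j. j \<le> p - b \<and> j \<le> p - a \<and> p - a - j \<le> b}" "b - (p - a - (p - a - (b - i))) = i"
    using e by auto
  have c: "of_nat (p choose a) * complex_of_nat ((a choose i) * ((r + s) choose r)) =
      of_nat (p choose b) * of_nat (((q + s) choose s) * (b choose r))"
  proof -
    have "(q + s) choose s = (q + s) choose q" "b choose r = (i + r) choose i"
      unfolding e(2) by (metis binomial_symmetric add_diff_cancel_left' le_add1 add.commute
          add_diff_cancel_right' le_add2)+
    moreover have "i + q = a" "i + r = b" "a + r + s = p" using e by auto
    ultimately show ?thesis
      using binomial_multinomial_swap[of i q r s, THEN arg_cong[of _ _ complex_of_nat]]
      by (simp add: mult_ac)
  qed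
  have sgn: "(-1) ^ (a + b) = ((-1) ^ q * (-1) ^ r :: complex)"
    unfolding e(1,2) by (simp add: power_add mult_ac)
  show "(-1) ^ (a + b) * of_nat (p choose b) *
      (of_nat (((p - b) choose (p - a - (b - i))) * (b choose (p - a - (p - a - (b - i))))) *
       (Z $ 1 $ 1 ^ (p - a - (b - i)) * Z $ 2 $ 1 ^ (p - b - (p - a - (b - i))) *
        Z $ 1 $ 2 ^ (p - a - (p - a - (b - i))) * Z $ 2 $ 2 ^ (b - (p - a - (p - a - (b - i)))))) =
    of_nat (p choose a) *
      (of_nat ((a choose i) * ((p - a) choose (b - i))) *
       (adj Z $ 1 $ 1 ^ i * adj Z $ 2 $ 1 ^ (a - i) * adj Z $ 1 $ 2 ^ (b - i) * adj Z $ 2 $ 2 ^ (p - a - (b - i))))"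
    unfolding e' adj_entries sgn power_minus[of "Z $ 1 $ 2"] power_minus[of "Z $ 2 $ 1"]
    using arg_cong[OF c[symmetric], of "\<lambda>t. t * ((-1) ^ q * (-1) ^ r *
        (Z $ 1 $ 1 ^ s * Z $ 2 $ 1 ^ q * Z $ 1 $ 2 ^ r * Z $ 2 $ 2 ^ i))"]
    by (simp add: mult_ac del: of_nat_mult)
next
  fix j assume "j \<in> {j. j \<le> p - b \<and> j \<le> p - a \<and> p - a - j \<le> b}"
  then show "p - a - (b - (b - (p - a - j))) = j" "b - (p - a - j) \<in> {i. i \<le> a \<and> i \<le> b \<and> b - i \<le> p - a}"
    using assms by auto
qed

text \<open>Cauchy's formula for the \<open>b\<close>-th derivative at \<open>0\<close> extracts the coefficient of \<open>s\<^sup>b\<close>.\<close>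

lemma tcoef_eq_mcoef:
  assumes "e = - int b"
  shows "1 / (2 * of_real pi * \<i>) * contour_integral (circlepath 0 1) (\<lambda>s.
      (s * Z $ 1 $ 1 + Z $ 2 $ 1) ^ a * (s * Z $ 1 $ 2 + Z $ 2 $ 2) ^ c * s powi e / s) = mcoef a c b Z"
proof -
  let ?f = "poly (gen_poly a c Z)"
  have "((\<lambda>u. ?f u / (u - 0) ^ Suc b) has_contour_integral (2 * pi * \<i>) / fact b * (deriv ^^ b) ?f 0)
      (circlepath 0 1)"
    by (rule Cauchy_has_contour_integral_higher_derivative_circlepath)
      (auto intro!: continuous_intros holomorphic_intros)
  moreover have "(deriv ^^ b) (poly P) = poly ((pderiv ^^ b) P)" for P :: "complex poly"
  proof (induction b)
    case (Suc b)
    have "deriv (poly Q) = poly (pderiv Q)" for Q :: "complex poly"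
      by (rule ext, rule DERIV_imp_deriv, rule poly_DERIV)
    with Suc show ?case by simp
  qed simp
  moreover have "poly ((pderiv ^^ b) (gen_poly a c Z)) 0 = fact b * mcoef a c b Z"
    by (simp add: poly_0_coeff_0 coeff_higher_pderiv mcoef_def pochhammer_fact)
  moreover have "(\<lambda>u. ?f u / (u - 0) ^ Suc b) = (\<lambda>s. (s * Z $ 1 $ 1 + Z $ 2 $ 1) ^ a *
      (s * Z $ 1 $ 2 + Z $ 2 $ 2) ^ c * s powi e / s)"
    by (auto simp: fun_eq_iff gen_poly_def assms power_int_minus power_int_of_nat field_simps)
  ultimately have "((\<lambda>s. (s * Z $ 1 $ 1 + Z $ 2 $ 1) ^ a *
      (s * Z $ 1 $ 2 + Z $ 2 $ 2) ^ c * s powi e / s) has_contour_integral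
      2 * pi * \<i> * mcoef a c b Z) (circlepath 0 1)"
    by (simp add: mult.assoc)
  from contour_integral_unique[OF this] show ?thesis by simp
qed


section \<open>Irreducible components and the decomposition\<close>

lemma weight_vector_eq: "weight_vector k p (a, b) =
    fscale ((-1) ^ b / of_nat (p choose b)) (basis_at (k, a, p - a, p - b))"
  by (simp add: weight_vector_def basis_at_def)

lemma regular_weight_vector: "weight_vector k p i \<in> regular_fun"
  by (cases i) (auto simp: weight_vector_def
      intro: fvs.subspace_scale[OF regular_subspace] regular_basis_fun)

lemma weight_module_BH: "weight_module act_BH p (weight_vector k p)"
proof
  fix A D u assume X: "(A, D) \<in> sl2sl2"
  show "act_BH (A, D) (grid_sum p (weight_vector k p) u) =
      grid_sum p (weight_action p A D (weight_vector k p)) u"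
    unfolding grid_sum_def
    by (subst act_BH_sum) (auto simp: regular_weight_vector act_BH_weight_vector[OF X] intro!: sum.cong)
next
  fix u i assume zero: "grid_sum p (weight_vector k p) u = 0" and i: "i \<in> weight_grid p"
  define h where "h = (\<lambda>(a, b). (k, a, p - a, p - b))"
  define w where "w = (\<lambda>(k :: int, a, c :: nat, b). u (a, p - b) * ((-1) ^ (p - b) / of_nat (p choose (p - b))))"
  have inj: "inj_on h (weight_grid p)" by (auto simp: h_def intro!: inj_onI)
  have sub: "h ` weight_grid p \<subseteq> basis_index" by (auto simp: h_def basis_index_def)
  have w: "fscale (w (h j)) (basis_at (h j)) = fscale (u j) (weight_vector k p j)"
    if "j \<in> weight_grid p" for j
    using that by (cases j) (auto simp: h_def w_def weight_vector_eq)
  have "(\<Sum>j\<in>h ` weight_grid p. fscale (w j) (basis_at j)) = grid_sum p (weight_vector k p) u"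
    unfolding sum.reindex[OF inj] grid_sum_def using w by (intro sum.cong) simp_all
  then have "w (h i) = 0"
    using basis_at_independent[OF _ sub, of w "h i"] zero i by simp
  then show "u i = 0" using i by (cases i) (simp add: w_def h_def binomial_eq_0_iff)
qed

lemma span_rescaled:
  assumes "\<And>i. i \<in> A \<Longrightarrow> f i = fscale (r i) (g (h i))" "\<And>i. i \<in> A \<Longrightarrow> r i \<noteq> 0" "h ` A = B"
  shows "fvs.span (f ` A) = fvs.span (g ` B)"
proof (rule fvs.span_eq[THEN iffD2], intro conjI subsetI)
  fix x assume "x \<in> f ` A"
  then obtain i where i: "i \<in> A" "x = f i" by blast
  then have "g (h i) \<in> fvs.span (g ` B)" using assms(3) by (blast intro: fvs.span_base)
  then show "x \<in> fvs.span (g ` B)" using i assms(1) by (simp add: fvs.span_scale)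
next
  fix x assume "x \<in> g ` B"
  then obtain i where i: "i \<in> A" "x = g (h i)" using assms(3) by blast
  then have "f i \<in> fvs.span (f ` A)" by (blast intro: fvs.span_base)
  then have "fscale (inverse (r i)) (f i) \<in> fvs.span (f ` A)" by (rule fvs.span_scale)
  then show "x \<in> fvs.span (f ` A)" using i assms(1,2) by simp
qed

text \<open>The indices of the functions \<open>N\<^sup>k t\<close> with \<open>t\<close> of degree \<open>p\<close>, which span one irreducible component.\<close>

definition component_index :: "int \<Rightarrow> nat \<Rightarrow> (int \<times> nat \<times> nat \<times> nat) set"
  where "component_index k p = (\<lambda>(a, b). (k, a, p - a, b)) ` weight_grid p"

lemma component_index_eq: "component_index k p = {(k', a, c, b). k' = k \<and> a + c = p \<and> b \<le> p}"
proof
  show "{(k', a, c, b). k' = k \<and> a + c = p \<and> b \<le> p} \<subseteq> component_index k p"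
  proof safe
    fix a c b :: nat assume "b \<le> a + c"
    then show "(k, a, c, b) \<in> component_index k (a + c)"
      unfolding component_index_def by (intro image_eqI[of _ _ "(a, b)"]) auto
  qed
qed (auto simp: component_index_def)

lemma span_weight_vectors:
  "fvs.span (weight_vector k p ` weight_grid p) = fvs.span (basis_at ` component_index k p)"
proof (rule span_rescaled[where r = "\<lambda>(a, b). (-1) ^ b / of_nat (p choose b)"])
  show "(\<lambda>(a, b). (k, a, p - a, p - b)) ` weight_grid p = component_index k p" (is "?h ` _ = _")
  proof
    show "component_index k p \<subseteq> ?h ` weight_grid p"
    proof (unfold component_index_def, safe)
      fix a b assume "a \<le> p" "b \<le> p"
      then show "(k, a, p - a, b) \<in> ?h ` weight_grid p"
        by (intro image_eqI[of _ _ "(a, p - b)"]) auto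
    qed
  qed (auto simp: component_index_def)
qed (auto simp: weight_vector_eq binomial_eq_0_iff)

text \<open>Among the solutions \<open>k = 0, 1, - p, - p - 1\<close> of the biharmonic condition only the first two have
  degree \<open>p + 2 k = n \<ge> 0\<close>, apart from the coincidence \<open>k = p = 0\<close> when \<open>n = 0\<close>.\<close>

lemma BH_index_nonneg:
  "BH_index (int n) = component_index 0 n \<union> (if n \<ge> 2 then component_index 1 (n - 2) else {})"
proof -
  have "bibox_factor (k, a, c, b) = 0 \<longleftrightarrow> k = 0 \<or> k = 1 \<or> k = - int (a + c) \<or> k = - int (a + c) - 1"
    for k a c b by (auto simp: bibox_factor_def)
  then show ?thesis
    by (auto simp: BH_index_def basis_index_def basis_degree_def component_index_eq)
qed

text \<open>Here the solutions \<open>k = - p\<close> and \<open>k = - p - 1\<close> occur, with \<open>p = n\<close> and \<open>p = n - 2\<close>.\<close>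

lemma BH_index_nonpos:
  "BH_index (- int n) = component_index (- int n) n \<union>
    (if n \<ge> 2 then component_index (1 - int n) (n - 2) else {})"
proof -
  have "bibox_factor (k, a, c, b) = 0 \<longleftrightarrow> k = 0 \<or> k = 1 \<or> k = - int (a + c) \<or> k = - int (a + c) - 1"
    for k a c b by (auto simp: bibox_factor_def)
  then show ?thesis
    by (auto simp: BH_index_def basis_index_def basis_degree_def component_index_eq)
qed

lemma component_index_subset: "component_index k p \<subseteq> basis_index"
  by (auto simp: component_index_eq basis_index_def)

lemma finite_component_index: "finite (component_index k p)"
  by (simp add: component_index_def)

lemma card_component_index: "card (component_index k p) = (p + 1) ^ 2"
  unfolding component_index_def
  by (subst card_image) (auto simp: inj_on_def power2_eq_square)

lemma direct_sum_basis_at: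
  assumes fin: "finite I" "finite J" and sub: "I \<union> J \<subseteq> basis_index" and disj: "I \<inter> J = {}"
  shows "direct_sum (fvs.span (basis_at ` (I \<union> J))) (fvs.span (basis_at ` I)) (fvs.span (basis_at ` J))"
  unfolding direct_sum_def image_Un
proof (intro conjI fvs.subspace_span fvs.span_Un)
  show "fvs.span (basis_at ` I) \<inter> fvs.span (basis_at ` J) = {0}"
  proof (intro equalityI subsetI)
    fix x assume "x \<in> fvs.span (basis_at ` I) \<inter> fvs.span (basis_at ` J)"
    then have x: "x \<in> fvs.span (basis_at ` I)" "x \<in> fvs.span (basis_at ` J)" by auto
    obtain K u where K: "finite K" "K \<subseteq> I" "x = (\<Sum>i\<in>K. fscale (u i) (basis_at i))"
      by (rule in_span_image_explicit[OF x(1)])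
    obtain L w where L: "finite L" "L \<subseteq> J" "x = (\<Sum>i\<in>L. fscale (w i) (basis_at i))"
      by (rule in_span_image_explicit[OF x(2)])
    have KL: "K \<inter> L = {}" using K L disj by blast
    let ?v = "\<lambda>i. if i \<in> K then u i else - w i"
    have "(\<Sum>i\<in>K \<union> L. fscale (?v i) (basis_at i)) =
        (\<Sum>i\<in>K. fscale (?v i) (basis_at i)) + (\<Sum>i\<in>L. fscale (?v i) (basis_at i))"
      using K(1) L(1) KL by (rule sum.union_disjoint)
    also have "(\<Sum>i\<in>K. fscale (?v i) (basis_at i)) = x"
      unfolding K(3) by (intro sum.cong) auto
    also have "(\<Sum>i\<in>L. fscale (?v i) (basis_at i)) = (\<Sum>i\<in>L. - fscale (w i) (basis_at i))"
      using KL by (intro sum.cong) auto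
    also have "\<dots> = - x" unfolding L(3) by (rule sum_negf)
    also have "x + - x = 0" by (rule add.right_inverse)
    finally have "(\<Sum>i\<in>K \<union> L. fscale (?v i) (basis_at i)) = 0" .
    then have "?v i = 0" if "i \<in> K" for i
      using that K L sub by (intro basis_at_independent[of "K \<union> L" ?v i]) auto
    then have "x = 0" unfolding K(3) by (intro sum.neutral) auto
    then show "x \<in> {0}" by simp
  qed (auto intro: fvs.span_zero)
qed

lemma dim_span_basis_at:
  assumes "finite I" "I \<subseteq> basis_index"
  shows "fvs.dim (fvs.span (basis_at ` I)) = card I"
proof -
  have inj: "inj_on basis_at I"
  proof (rule inj_onI, rule ccontr)
    fix i j assume ij: "i \<in> I" "j \<in> I" "basis_at i = basis_at j" "i \<noteq> j"
    have "(\<Sum>m\<in>{i, j}. fscale (if m = i then 1 else -1) (basis_at m)) = 0"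
      using ij(3,4) by simp
    from basis_at_independent[OF _ _ this, of i] ij assms show False by auto
  qed
  have "\<not> fvs.dependent (basis_at ` I)"
  proof (rule fvs.independent_if_scalars_zero)
    fix f x assume zero: "(\<Sum>x\<in>basis_at ` I. fscale (f x) x) = 0" and x: "x \<in> basis_at ` I"
    from zero have "(\<Sum>i\<in>I. fscale (f (basis_at i)) (basis_at i)) = 0"
      by (simp add: sum.reindex[OF inj])
    from basis_at_independent[OF assms this] x show "f x = 0" by auto
  qed (use assms in simp)
  then show ?thesis
    by (simp add: fvs.dim_eq_card_independent card_image[OF inj])
qed

lemma act_zero: "act_BH X 0 = 0" "act_tensor X 0 = 0"
proof -
  show "act_BH X 0 = 0"
    using act_BH_sum[of "{}"] by (cases X) simp
  show "act_tensor X 0 = 0"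
    by (cases X) (auto simp: act_tensor_def fun_eq_iff)
qed

lemma submodule_zero: "submodule act_BH {0}" "submodule act_tensor {0}"
  by (simp_all add: submodule_def act_zero fvs.subspace_single_0)

lemma ext_tensor_zero: "{0} \<boxtimes> {0} = {0}"
proof -
  have "{(\<lambda>(\<xi>, \<eta>). p \<xi> * q \<eta>) |p q. p \<in> {0 :: c2 \<Rightarrow> complex} \<and> q \<in> {0 :: c2 \<Rightarrow> complex}} = {0}"
    by (auto simp: fun_eq_iff intro!: exI[of _ 0])
  then show ?thesis by (simp add: ext_tensor_def)
qed

lemma module_iso_component:
  "module_iso act_BH (fvs.span (basis_at ` component_index k p)) act_tensor (sym_power p \<boxtimes> sym_power p)"
  unfolding tensor_monomial_span span_weight_vectors[symmetric]
  by (rule weight_module_iso[OF weight_module_BH weight_module_tensor])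

lemma irreducible_component:
  "irreducible_module act_BH (fvs.span (basis_at ` component_index k p))"
  unfolding span_weight_vectors[symmetric]
  by (rule weight_module.irreducible[OF weight_module_BH])

lemma Vmod_half: "Vmod (real n / 2) = sym_power n"
  by (simp add: Vmod_def)

lemma decomposition_components:
  assumes "k1 \<noteq> k2" and J_def: "J = (if n \<ge> 2 then component_index k2 (n - 2) else {})"
  shows "decomposition (real n / 2) (fvs.span (basis_at ` (component_index k1 n \<union> J)))
    (fvs.span (basis_at ` component_index k1 n)) (fvs.span (basis_at ` J))"
  unfolding decomposition_def
proof (intro conjI impI)
  show "direct_sum (fvs.span (basis_at ` (component_index k1 n \<union> J)))
      (fvs.span (basis_at ` component_index k1 n)) (fvs.span (basis_at ` J))"
    using assms component_index_subset finite_component_index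
    by (intro direct_sum_basis_at) (auto simp: component_index_eq)
  show "module_iso act_BH (fvs.span (basis_at ` component_index k1 n)) act_tensor
      (Vmod (real n / 2) \<boxtimes> Vmod (real n / 2))"
    unfolding Vmod_half by (rule module_iso_component)
  show "irreducible_module act_BH (fvs.span (basis_at ` component_index k1 n))"
    by (rule irreducible_component)
  show "irreducible_module act_BH (fvs.span (basis_at ` J))" if "real n / 2 \<ge> 1"
    using that irreducible_component by (simp add: J_def)
  show "module_iso act_BH (fvs.span (basis_at ` J)) act_tensor
      (Vmod (real n / 2 - 1) \<boxtimes> Vmod (real n / 2 - 1))"
  proof (cases "n \<ge> 2")
    case True
    then have "real n / 2 - 1 = real (n - 2) / 2" by (simp add: of_nat_diff field_simps)
    then have "Vmod (real n / 2 - 1) = sym_power (n - 2)" by (simp only: Vmod_half)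
    then show ?thesis using True by (simp add: J_def module_iso_component)
  next
    case False
    then have "Vmod (real n / 2 - 1) = {0}" by (simp add: Vmod_def)
    then have "Vmod (real n / 2 - 1) \<boxtimes> Vmod (real n / 2 - 1) = {0}" by (simp add: ext_tensor_zero)
    moreover have "fvs.span (basis_at ` J) = {0}" using False by (simp add: J_def)
    moreover have "module_iso act_BH {0} act_tensor {0}"
      unfolding module_iso_def
      by (intro conjI submodule_zero exI[of _ "\<lambda>_. 0"]) (auto simp: bij_betw_def act_zero)
    ultimately show ?thesis by simp
  qed
qed

text \<open>The sum of the two submodules is invariant because the action is additive on regular functions.\<close>

lemma decomposition_submodule:
  assumes "decomposition l W U1 U2" "W \<subseteq> regular_fun"
  shows "submodule act_BH W"
proof -
  have W: "W = {u + v |u v. u \<in> U1 \<and> v \<in> U2}" and U: "submodule act_BH U1" "submodule act_BH U2"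
    using assms(1) unfolding decomposition_def direct_sum_def module_iso_def by blast+
  have sub: "U1 \<subseteq> W" "U2 \<subseteq> W"
  proof -
    have "0 \<in> U1" "0 \<in> U2" using U unfolding submodule_def by (blast intro: fvs.subspace_0)+
    then have "u + 0 \<in> W" "0 + v \<in> W" if "u \<in> U1" "v \<in> U2" for u v
      unfolding W using that by blast+
    then show "U1 \<subseteq> W" "U2 \<subseteq> W" using \<open>0 \<in> U1\<close> \<open>0 \<in> U2\<close> by auto
  qed
  have add: "act_BH X (u + v) = act_BH X u + act_BH X v" if "u \<in> U1" "v \<in> U2" for X u v
  proof -
    have "u \<in> regular_fun" "v \<in> regular_fun" using that sub assms(2) by auto
    then show ?thesis
      using act_BH_sum[of "{True, False}" "\<lambda>b. if b then u else v" "fst X" "snd X" "\<lambda>_. 1"] by simp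
  qed
  show ?thesis
    unfolding submodule_def
  proof (intro conjI ballI)
    show "fvs.subspace W"
      using fvs.subspace_sums[of U1 U2] U unfolding W submodule_def by (simp add: conj_commute)
    fix X f assume X: "X \<in> sl2sl2" "f \<in> W"
    then obtain u v where uv: "u \<in> U1" "v \<in> U2" "f = u + v" unfolding W by blast
    then have "act_BH X u \<in> U1" "act_BH X v \<in> U2" using U X(1) unfolding submodule_def by auto
    then show "act_BH X f \<in> W" unfolding uv(3) add[OF uv(1,2)] W by blast
  qed
qed

lemma weights_eq: "weights (real n / 2) = (\<lambda>a. real n / 2 - real a) ` {..n}"
proof
  show "weights (real n / 2) \<subseteq> (\<lambda>a. real n / 2 - real a) ` {..n}"
  proof
    fix m assume "m \<in> weights (real n / 2)"
    then have m: "m - real n / 2 \<in> \<int>" "- (real n / 2) \<le> m" "m \<le> real n / 2" by (auto simp: weights_def)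
    obtain z where z: "m - real n / 2 = of_int z" using m(1) by (auto elim: Ints_cases)
    with m have "z \<le> 0" by linarith
    then have "m = real n / 2 - real (nat (- z))" using z by simp
    moreover have "nat (- z) \<le> n" using \<open>z \<le> 0\<close> z m(2) by linarith
    ultimately show "m \<in> (\<lambda>a. real n / 2 - real a) ` {..n}" by blast
  qed
  show "(\<lambda>a. real n / 2 - real a) ` {..n} \<subseteq> weights (real n / 2)"
    by (auto simp: weights_def field_simps)
qed

lemma weights_neg: "l < 0 \<Longrightarrow> weights l = {}"
  by (auto simp: weights_def)

lemma tcoef_eq:
  assumes "a \<le> p" "b \<le> p"
  shows "tcoef (real p / 2) (real p / 2 - real b) (real p / 2 - real a) Z = mcoef a (p - a) b Z"
proof -
  have "\<lfloor>real p / 2 - (real p / 2 - real a)\<rfloor> = int a" by simp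
  moreover have "real p / 2 + (real p / 2 - real a) = real (p - a)"
    using assms by (simp add: of_nat_diff field_simps)
  then have "\<lfloor>real p / 2 + (real p / 2 - real a)\<rfloor> = int (p - a)" by (simp only: floor_of_nat)
  moreover have "- (real p / 2) + (real p / 2 - real b) = real_of_int (- int b)" by simp
  then have "\<lfloor>- (real p / 2) + (real p / 2 - real b)\<rfloor> = - int b" by (simp only: floor_of_int)
  ultimately show ?thesis
    unfolding tcoef_def using tcoef_eq_mcoef[OF refl, where b = b and a = a and c = "p - a"] by simp
qed

text \<open>By homogeneity the value at \<open>Z\<^sup>-\<^sup>1 = adj Z / N Z\<close> is \<open>N\<^sup>-\<^sup>p\<close> times the value at \<open>adj Z\<close>, which
  \<open>mcoef_adj\<close> expresses by another matrix coefficient of \<open>Z\<close>.\<close>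

lemma tcoef_inverse_eq:
  assumes "a \<le> p" "b \<le> p" "normN Z \<noteq> 0"
  shows "tcoef (real p / 2) (real p / 2 - real b) (real p / 2 - real a) (matrix_inv Z) =
    (-1) ^ (a + b) * of_nat (p choose b) / of_nat (p choose a) *
    (normN Z powi (- int p) * mcoef (p - b) b (p - a) Z)"
proof -
  have "of_nat (p choose a) \<noteq> (0::complex)" using assms(1) by (simp add: binomial_eq_0_iff)
  then have "mcoef a (p - a) b (adj Z) =
      (-1) ^ (a + b) * of_nat (p choose b) / of_nat (p choose a) * mcoef (p - b) b (p - a) Z"
    using mcoef_adj[OF assms(1,2), of Z] by (simp add: field_simps)
  moreover have "inverse (normN Z) ^ p = normN Z powi (- int p)"
    by (simp add: power_int_minus power_int_of_nat power_inverse)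
  ultimately show ?thesis
    using assms(1) by (simp add: tcoef_eq[OF assms(1,2)] matrix_inv_hc[OF assms(3)] mcoef_cscale)
qed

lemma set_weights:
  "{f m n |m n. m \<in> weights (real p / 2) \<and> n \<in> weights (real p / 2)} =
    (\<lambda>(a, b). f (real p / 2 - real a) (real p / 2 - real b)) ` weight_grid p"
  unfolding weights_eq by auto

lemma span_phi1:
  "fvs.span {phi1 (real p / 2) m n |m n. m \<in> weights (real p / 2) \<and> n \<in> weights (real p / 2)} =
    fvs.span (basis_at ` component_index 0 p)"
  unfolding set_weights
  by (rule span_rescaled[where r = "\<lambda>_. 1", OF _ _ component_index_def[symmetric]])
    (auto simp: phi1_def tcoef_eq basis_at_def basis_fun_def on_inv_def fun_eq_iff)

lemma span_phi2:
  assumes "l - 1 = real p / 2"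
  shows "fvs.span {phi2 l m n |m n. m \<in> weights (l - 1) \<and> n \<in> weights (l - 1)} =
    fvs.span (basis_at ` component_index 1 p)"
  unfolding assms set_weights
  by (rule span_rescaled[where r = "\<lambda>_. 1", OF _ _ component_index_def[symmetric]])
    (auto simp: phi2_def assms tcoef_eq basis_at_def basis_fun_def on_inv_def fun_eq_iff)

lemma component_index_reflect:
  "(\<lambda>(a, b). (k, p - a, a, p - b)) ` weight_grid p = component_index k p" (is "?h ` _ = _")
proof
  show "component_index k p \<subseteq> ?h ` weight_grid p"
  proof (unfold component_index_def, safe)
    fix a b assume "a \<le> p" "b \<le> p"
    then show "(k, a, p - a, b) \<in> ?h ` weight_grid p"
      by (intro image_eqI[of _ _ "(p - a, p - b)"]) auto
  qed
qed (auto simp: component_index_eq)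

lemma span_phi1':
  "fvs.span {phi1' (real p / 2) m n |m n. m \<in> weights (real p / 2) \<and> n \<in> weights (real p / 2)} =
    fvs.span (basis_at ` component_index (- int p) p)"
  unfolding set_weights
proof (rule span_rescaled[where r = "\<lambda>(a, b). (-1) ^ (b + a) * of_nat (p choose a) / of_nat (p choose b)",
      OF _ _ component_index_reflect])
  fix i assume "i \<in> weight_grid p"
  then obtain a b where i: "i = (a, b)" "a \<le> p" "b \<le> p" by (cases i) auto
  show "(case i of (a, b) \<Rightarrow> phi1' (real p / 2) (real p / 2 - real a) (real p / 2 - real b)) =
      fscale (case i of (a, b) \<Rightarrow> (-1) ^ (b + a) * of_nat (p choose a) / of_nat (p choose b))
        (basis_at (case i of (a, b) \<Rightarrow> (- int p, p - a, a, p - b)))"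
    unfolding i(1) prod.case basis_at_def basis_fun_def phi1'_def
    by (rule ext) (simp add: on_inv_def fscale_def tcoef_inverse_eq[OF i(3,2)])
  show "(case i of (a, b) \<Rightarrow> (-1) ^ (b + a) * of_nat (p choose a) / of_nat (p choose b)) \<noteq> (0::complex)"
    using i by (simp add: binomial_eq_0_iff)
qed

lemma span_phi2':
  assumes l: "l - 1 = real p / 2"
  shows "fvs.span {phi2' l m n |m n. m \<in> weights (l - 1) \<and> n \<in> weights (l - 1)} =
    fvs.span (basis_at ` component_index (- 1 - int p) p)"
  unfolding l set_weights
proof (rule span_rescaled[where r = "\<lambda>(a, b). (-1) ^ (b + a) * of_nat (p choose a) / of_nat (p choose b)",
      OF _ _ component_index_reflect])
  fix i assume "i \<in> weight_grid p"
  then obtain a b where i: "i = (a, b)" "a \<le> p" "b \<le> p" by (cases i) auto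
  have N: "inverse (normN Z) * normN Z powi (- int p) = normN Z powi (- 1 - int p)" if "normN Z \<noteq> 0" for Z
    using that by (simp add: power_int_diff power_int_minus field_simps)
  have "phi2' l (real p / 2 - real a) (real p / 2 - real b) Z =
      (-1) ^ (b + a) * of_nat (p choose a) / of_nat (p choose b) * basis_fun (- 1 - int p) (p - a) a (p - b) Z" for Z
    by (cases "normN Z = 0")
      (simp_all add: phi2'_def l on_inv_def basis_fun_def tcoef_inverse_eq[OF i(3,2)] flip: N)
  then show "(case i of (a, b) \<Rightarrow> phi2' l (real p / 2 - real a) (real p / 2 - real b)) =
      fscale (case i of (a, b) \<Rightarrow> (-1) ^ (b + a) * of_nat (p choose a) / of_nat (p choose b))
        (basis_at (case i of (a, b) \<Rightarrow> (- 1 - int p, p - a, a, p - b)))"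
    unfolding i(1) prod.case basis_at_def fscale_def by blast
  show "(case i of (a, b) \<Rightarrow> (-1) ^ (b + a) * of_nat (p choose a) / of_nat (p choose b)) \<noteq> (0::complex)"
    using i by (simp add: binomial_eq_0_iff)
qed

lemma BH_decomposition_nonneg:
  "decomposition (real n / 2) (BH (int n)) (fvs.span (basis_at ` component_index 0 n))
    (fvs.span (basis_at ` (if n \<ge> 2 then component_index 1 (n - 2) else {})))"
  unfolding BH_eq_span BH_index_nonneg by (rule decomposition_components) simp_all

lemma BH_decomposition_nonpos:
  "decomposition (real n / 2) (BH (- int n)) (fvs.span (basis_at ` component_index (- int n) n))
    (fvs.span (basis_at ` (if n \<ge> 2 then component_index (1 - int n) (n - 2) else {})))"
  unfolding BH_eq_span BH_index_nonpos by (rule decomposition_components) simp_all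

lemma dim_BH_0: "fvs.dim (BH 0) = 1"
  using dim_span_basis_at[OF finite_component_index[of 0 0] component_index_subset]
    BH_index_nonneg[of 0]
  by (simp add: BH_eq_span card_component_index)

lemma card_two_components:
  assumes "n > 0" "k1 \<noteq> k2"
  shows "int (card (component_index k1 n \<union> (if n \<ge> 2 then component_index k2 (n - 2) else {}))) =
    2 * int n ^ 2 + 2"
proof (cases "n \<ge> 2")
  case True
  have "card (component_index k1 n \<union> component_index k2 (n - 2)) = (n + 1) ^ 2 + (n - 2 + 1) ^ 2"
  proof (subst card_Un_disjoint)
    show "component_index k1 n \<inter> component_index k2 (n - 2) = {}"
      using assms(2) by (auto simp: component_index_eq)
  qed (simp_all only: finite_component_index card_component_index)
  moreover obtain m where "n = m + 2" using True by (metis le_Suc_ex add.commute)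
  ultimately show ?thesis by (simp add: power2_eq_square algebra_simps)
next
  case False
  then have "n = 1" using assms by simp
  then show ?thesis by (simp add: card_component_index)
qed

lemma dim_BH:
  assumes "d \<noteq> 0"
  shows "int (fvs.dim (BH d)) = 2 * d ^ 2 + 2"
proof -
  define n where "n = nat \<bar>d\<bar>"
  have n: "n > 0" "d ^ 2 = int n ^ 2" "d = int n \<or> d = - int n" using assms by (auto simp: n_def)
  have fin: "finite (BH_index d)"
    using n(3) by (auto simp: BH_index_nonneg BH_index_nonpos finite_component_index)
  have sub: "BH_index d \<subseteq> basis_index" by (auto simp: BH_index_def)
  have "int (card (BH_index d)) = 2 * int n ^ 2 + 2"
    using n(3) card_two_components[OF n(1)] by (auto simp: BH_index_nonneg BH_index_nonpos)
  then show ?thesis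
    unfolding BH_eq_span dim_span_basis_at[OF fin sub] n(2) .
qed

theorem proposition4:
  shows "(\<forall>d. submodule act_BH (BH d)) \<and>
    (\<forall>l::real. 2 * l \<in> \<nat> \<longrightarrow>
      (\<exists>U1 U2. decomposition l (BH \<lfloor>2 * l\<rfloor>) U1 U2 \<and>
        fvs.span {phi1 l m n |m n. m \<in> weights l \<and> n \<in> weights l} = U1 \<and>
        fvs.span {phi2 l m n |m n. m \<in> weights (l - 1) \<and> n \<in> weights (l - 1)} = U2) \<and>
      (\<exists>U1 U2. decomposition l (BH (- \<lfloor>2 * l\<rfloor>)) U1 U2 \<and>
        fvs.span {phi1' l m n |m n. m \<in> weights l \<and> n \<in> weights l} = U1 \<and>
        fvs.span {phi2' l m n |m n. m \<in> weights (l - 1) \<and> n \<in> weights (l - 1)} = U2)) \<and>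
    fvs.dim (BH 0) = 1 \<and>
    (\<forall>d. d \<noteq> 0 \<longrightarrow> int (fvs.dim (BH d)) = 2 * d ^ 2 + 2)"
proof (intro conjI allI impI)
  fix d
  have "BH d \<subseteq> regular_fun" by (auto simp: BH_def biharmonic_def)
  moreover have "d = int (nat \<bar>d\<bar>) \<or> d = - int (nat \<bar>d\<bar>)" by linarith
  then obtain n where "d = int n \<or> d = - int n" by blast
  ultimately show "submodule act_BH (BH d)"
    using decomposition_submodule[OF BH_decomposition_nonneg]
      decomposition_submodule[OF BH_decomposition_nonpos] by blast
next
  fix l :: real assume "2 * l \<in> \<nat>"
  then obtain n where "2 * l = real n" by (auto elim: Nats_cases)
  then have l: "l = real n / 2" and floor: "\<lfloor>2 * l\<rfloor> = int n" by simp_all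
  have l1: "l - 1 = real (n - 2) / 2" if "n \<ge> 2"
    using that by (simp add: l of_nat_diff field_simps)
  have empty: "weights (l - 1) = {}" if "\<not> n \<ge> 2"
    using that by (intro weights_neg) (simp add: l)
  show "\<exists>U1 U2. decomposition l (BH \<lfloor>2 * l\<rfloor>) U1 U2 \<and>
      fvs.span {phi1 l m n |m n. m \<in> weights l \<and> n \<in> weights l} = U1 \<and>
      fvs.span {phi2 l m n |m n. m \<in> weights (l - 1) \<and> n \<in> weights (l - 1)} = U2"
  proof (intro exI conjI)
    show "decomposition l (BH \<lfloor>2 * l\<rfloor>) (fvs.span (basis_at ` component_index 0 n))
        (fvs.span (basis_at ` (if n \<ge> 2 then component_index 1 (n - 2) else {})))"
      unfolding floor using BH_decomposition_nonneg[of n] by (simp add: l)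
    show "fvs.span {phi1 l m n |m n. m \<in> weights l \<and> n \<in> weights l} =
        fvs.span (basis_at ` component_index 0 n)"
      unfolding l by (rule span_phi1)
    show "fvs.span {phi2 l m n |m n. m \<in> weights (l - 1) \<and> n \<in> weights (l - 1)} =
        fvs.span (basis_at ` (if n \<ge> 2 then component_index 1 (n - 2) else {}))"
      using span_phi2[OF l1] empty by (cases "n \<ge> 2") simp_all
  qed
  show "\<exists>U1 U2. decomposition l (BH (- \<lfloor>2 * l\<rfloor>)) U1 U2 \<and>
      fvs.span {phi1' l m n |m n. m \<in> weights l \<and> n \<in> weights l} = U1 \<and>
      fvs.span {phi2' l m n |m n. m \<in> weights (l - 1) \<and> n \<in> weights (l - 1)} = U2"
  proof (intro exI conjI)
    show "decomposition l (BH (- \<lfloor>2 * l\<rfloor>)) (fvs.span (basis_at ` component_index (- int n) n))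
        (fvs.span (basis_at ` (if n \<ge> 2 then component_index (1 - int n) (n - 2) else {})))"
      unfolding floor using BH_decomposition_nonpos[of n] by (simp add: l)
    show "fvs.span {phi1' l m n |m n. m \<in> weights l \<and> n \<in> weights l} =
        fvs.span (basis_at ` component_index (- int n) n)"
      unfolding l by (rule span_phi1')
    have "- 1 - int (n - 2) = 1 - int n" if "n \<ge> 2" using that by simp
    then show "fvs.span {phi2' l m n |m n. m \<in> weights (l - 1) \<and> n \<in> weights (l - 1)} =
        fvs.span (basis_at ` (if n \<ge> 2 then component_index (1 - int n) (n - 2) else {}))"
      using span_phi2'[OF l1] empty by (cases "n \<ge> 2") simp_all
  qed
qed (rule dim_BH_0, rule dim_BH)

end
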